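(* Let $B$ be a finite left regular band monoid, $\Bbbk$ a commutative ring with unit, and $X,Y\in\Lambda(B)$. Then \[ \mathrm{Ext}^n_{\Bbbk B}(\Bbbk_X,\Bbbk_Y)\cong \begin{cases} \widetilde H^{n-1}(\Delta(X,Y),\Bbbk), & \text{if } X<Y \text{ and } n\geq 1,\\ \Bbbk, & \text{if } X=Y \text{ and } n=0,\\ 0, & \text{otherwise.} \end{cases} \]
   Context: A left regular band is a semigroup $B$ with $x^2=x$ and $xyx=xy$ for all $x,y\in B$; here $B$ is finite with identity $1$. The $\mathcal R$-order on $B$ is the partial order $a\leq b$ iff $ba=a$. $\Lambda(B)=\{Ba : a\in B\}$ (where $Ba=\{ba:b\in B\}$) is the set of principal left ideals ordered by inclusion (a lattice, the support lattice), and $\sigma:B\to\Lambda(B)$, $\sigma(a)=Ba$, is the support map. For $X\in\Lambda(B)$, $\Bbbk_X$ denotes the $\Bbbk B$-module $\Bbbk$ on which $b\in B$ acts as the identity if $\sigma(b)\geq X$ and as $0$ otherwise. For $X,Y\in\Lambda(B)$, choose $y\in B$ with $\sigma(y)=Y$ and set $B[X,Y]=\{z\in B: X\leq\sigma(z),\ z\leq y\}$ (with the $\mathcal R$-order); $\Delta(X,Y)$ is the order complex (simplicial complex of finite chains) of the poset $B[X,Y]\setminus\{y\}$, which up to isomorphism does not depend on the choice of $y$. $\widetilde H$ denotes reduced simplicial cohomology. *)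

theory Defs
  imports "HOL-Algebra.Module" "HOL-Algebra.AbelCoset"
begin

section \<open>Left regular bands and their supports\<close>

locale left_regular_band_monoid = monoid B for B (structure) +
  assumes finite_carrier: "finite (carrier B)"
    and idem: "x \<in> carrier B \<Longrightarrow> x \<otimes> x = x"
    and left_regular: "\<lbrakk>x \<in> carrier B; y \<in> carrier B\<rbrakk> \<Longrightarrow> x \<otimes> y \<otimes> x = x \<otimes> y"

definition R_le :: "('b, 'z) monoid_scheme \<Rightarrow> 'b \<Rightarrow> 'b \<Rightarrow> bool" where
  "R_le B a b \<longleftrightarrow> b \<otimes>\<^bsub>B\<^esub> a = a"

definition supp :: "('b, 'z) monoid_scheme \<Rightarrow> 'b \<Rightarrow> 'b set" where
  "supp B a = (\<lambda>b. b \<otimes>\<^bsub>B\<^esub> a) ` carrier B"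

definition support_lattice :: "('b, 'z) monoid_scheme \<Rightarrow> 'b set set" where
  "support_lattice B = supp B ` carrier B"

text \<open>The interval \<open>B[X,Y]\<close>, where \<open>y\<close> is the chosen element of support \<open>Y\<close>.\<close>

definition interval :: "('b, 'z) monoid_scheme \<Rightarrow> 'b set \<Rightarrow> 'b \<Rightarrow> 'b set" where
  "interval B X y = {z \<in> carrier B. X \<subseteq> supp B z \<and> R_le B z y}"


section \<open>Left modules over a not necessarily commutative ring\<close>

text \<open>The locale \<^locale>\<open>module\<close> of the library requires a commutative base ring.
  In records of type \<open>module\<close> the fields \<open>mult\<close> and \<open>one\<close> play no role.\<close>

locale left_module = R?: ring R + M?: abelian_group M for R (structure) and M (structure) +
  assumes smult_closed:
      "\<lbrakk>a \<in> carrier R; x \<in> carrier M\<rbrakk> \<Longrightarrow> a \<odot>\<^bsub>M\<^esub> x \<in> carrier M"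
    and smult_l_distr:
      "\<lbrakk>a \<in> carrier R; b \<in> carrier R; x \<in> carrier M\<rbrakk> \<Longrightarrow>
        (a \<oplus> b) \<odot>\<^bsub>M\<^esub> x = a \<odot>\<^bsub>M\<^esub> x \<oplus>\<^bsub>M\<^esub> b \<odot>\<^bsub>M\<^esub> x"
    and smult_r_distr:
      "\<lbrakk>a \<in> carrier R; x \<in> carrier M; y \<in> carrier M\<rbrakk> \<Longrightarrow>
        a \<odot>\<^bsub>M\<^esub> (x \<oplus>\<^bsub>M\<^esub> y) = a \<odot>\<^bsub>M\<^esub> x \<oplus>\<^bsub>M\<^esub> a \<odot>\<^bsub>M\<^esub> y"
    and smult_assoc:
      "\<lbrakk>a \<in> carrier R; b \<in> carrier R; x \<in> carrier M\<rbrakk> \<Longrightarrow>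
        (a \<otimes> b) \<odot>\<^bsub>M\<^esub> x = a \<odot>\<^bsub>M\<^esub> (b \<odot>\<^bsub>M\<^esub> x)"
    and smult_one: "x \<in> carrier M \<Longrightarrow> \<one> \<odot>\<^bsub>M\<^esub> x = x"

text \<open>Homomorphisms are taken to be extensional, so that equality of homomorphisms is
  equality of functions.\<close>

definition mod_hom ::
  "('r, 'z) ring_scheme \<Rightarrow> ('r, 'm) module \<Rightarrow> ('r, 'n) module \<Rightarrow> ('m \<Rightarrow> 'n) set" where
  "mod_hom R M N = {f \<in> carrier M \<rightarrow>\<^sub>E carrier N.
     (\<forall>x\<in>carrier M. \<forall>y\<in>carrier M. f (x \<oplus>\<^bsub>M\<^esub> y) = f x \<oplus>\<^bsub>N\<^esub> f y) \<and>
     (\<forall>r\<in>carrier R. \<forall>x\<in>carrier M. f (r \<odot>\<^bsub>M\<^esub> x) = r \<odot>\<^bsub>N\<^esub> f x)}"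

definition mod_isomorphic ::
  "('r, 'z) ring_scheme \<Rightarrow> ('r, 'm) module \<Rightarrow> ('r, 'n) module \<Rightarrow> bool" where
  "mod_isomorphic R M N \<longleftrightarrow> (\<exists>f\<in>mod_hom R M N. bij_betw f (carrier M) (carrier N))"

definition regular_module :: "('r, 'z) ring_scheme \<Rightarrow> ('r, 'r) module" where
  "regular_module R = \<lparr>carrier = carrier R, mult = mult R, one = one R, zero = zero R,
     add = add R, smult = mult R\<rparr>"

definition quotient_module :: "('r, 'm) module \<Rightarrow> 'm set \<Rightarrow> ('r, 'm set) module" where
  "quotient_module M N = \<lparr>carrier = a_rcosets\<^bsub>M\<^esub> N, mult = undefined, one = undefined,
     zero = N, add = set_add M,
     smult = (\<lambda>r C. \<Union>x\<in>C. N +>\<^bsub>M\<^esub> (r \<odot>\<^bsub>M\<^esub> x))\<rparr>"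

definition free_module :: "('r, 'z) ring_scheme \<Rightarrow> 'i set \<Rightarrow> ('r, 'i \<Rightarrow> 'r) module" where
  "free_module R I = \<lparr>carrier = {f \<in> I \<rightarrow>\<^sub>E carrier R. finite {i \<in> I. f i \<noteq> \<zero>\<^bsub>R\<^esub>}},
     mult = undefined, one = undefined, zero = (\<lambda>i\<in>I. \<zero>\<^bsub>R\<^esub>),
     add = (\<lambda>f g. \<lambda>i\<in>I. f i \<oplus>\<^bsub>R\<^esub> g i),
     smult = (\<lambda>r f. \<lambda>i\<in>I. r \<otimes>\<^bsub>R\<^esub> f i)\<rparr>"

text \<open>Projective modules as direct summands of free modules. Letting the basis \<open>I\<close> range over
  subsets of the type of elements of \<open>P\<close> is no restriction: a projective module is a direct
  summand of the free module on its own carrier.\<close>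

definition projective :: "('r, 'z) ring_scheme \<Rightarrow> ('r, 'p) module \<Rightarrow> bool" where
  "projective R P \<longleftrightarrow> left_module R P \<and>
     (\<exists>(I :: 'p set). \<exists>s\<in>mod_hom R P (free_module R I). \<exists>p\<in>mod_hom R (free_module R I) P.
        \<forall>x\<in>carrier P. p (s x) = x)"

text \<open>Exactness of
  \<open>\<dots> \<rightarrow> P\<^sub>2 \<rightarrow> P\<^sub>1 \<rightarrow> P\<^sub>0 \<rightarrow> M \<rightarrow> 0\<close>, with \<open>d n : P\<^sub>n\<^sub>+\<^sub>1 \<rightarrow> P\<^sub>n\<close>.\<close>

definition projective_resolution ::
  "('r, 'z) ring_scheme \<Rightarrow> ('r, 'm) module \<Rightarrow> (nat \<Rightarrow> ('r, 'p) module) \<Rightarrow> (nat \<Rightarrow> 'p \<Rightarrow> 'p) \<Rightarrow>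
   ('p \<Rightarrow> 'm) \<Rightarrow> bool" where
  "projective_resolution R M P d \<epsilon> \<longleftrightarrow>
     (\<forall>n. projective R (P n)) \<and>
     (\<forall>n. d n \<in> mod_hom R (P (Suc n)) (P n)) \<and>
     \<epsilon> \<in> mod_hom R (P 0) M \<and>
     \<epsilon> ` carrier (P 0) = carrier M \<and>
     d 0 ` carrier (P 1) = {x \<in> carrier (P 0). \<epsilon> x = \<zero>\<^bsub>M\<^esub>} \<and>
     (\<forall>n. d (Suc n) ` carrier (P (Suc (Suc n))) =
          {x \<in> carrier (P (Suc n)). d n x = \<zero>\<^bsub>P n\<^esub>})"


section \<open>Cohomology of cochain complexes and Ext\<close>

definition cohomology ::
  "(nat \<Rightarrow> ('k, 'c) module) \<Rightarrow> (nat \<Rightarrow> 'c \<Rightarrow> 'c) \<Rightarrow> nat \<Rightarrow> ('k, 'c set) module" where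
  "cohomology C \<delta> n = quotient_module
     ((C n)\<lparr>carrier := {x \<in> carrier (C n). \<delta> n x = \<zero>\<^bsub>C (Suc n)\<^esub>}\<rparr>)
     (case n of 0 \<Rightarrow> {\<zero>\<^bsub>C 0\<^esub>} | Suc m \<Rightarrow> \<delta> m ` carrier (C m))"

text \<open>For a \<open>k\<close>-algebra \<open>S\<close> with structure map \<open>\<iota> : k \<rightarrow> S\<close> (a ring homomorphism into the
  centre), \<open>Hom\<^sub>S(M,N)\<close> as a \<open>k\<close>-module.\<close>

definition hom_module ::
  "('k \<Rightarrow> 's) \<Rightarrow> ('s, 'z) ring_scheme \<Rightarrow> ('s, 'm) module \<Rightarrow> ('s, 'n) module \<Rightarrow>
   ('k, 'm \<Rightarrow> 'n) module" where
  "hom_module \<iota> S M N = \<lparr>carrier = mod_hom S M N, mult = undefined, one = undefined,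
     zero = (\<lambda>x\<in>carrier M. \<zero>\<^bsub>N\<^esub>),
     add = (\<lambda>f g. \<lambda>x\<in>carrier M. f x \<oplus>\<^bsub>N\<^esub> g x),
     smult = (\<lambda>r f. \<lambda>x\<in>carrier M. \<iota> r \<odot>\<^bsub>N\<^esub> f x)\<rparr>"

text \<open>\<open>Ext\<^sup>n\<^sub>S(M,N)\<close> computed from the projective resolution \<open>(P, d)\<close> of \<open>M\<close>: the
  cohomology of \<open>Hom\<^sub>S(P\<^sub>0,N) \<rightarrow> Hom\<^sub>S(P\<^sub>1,N) \<rightarrow> \<dots>\<close>. Different resolutions have modules of
  elements of different types, so statements about Ext quantify over the resolution.\<close>

definition Ext ::
  "('k \<Rightarrow> 's) \<Rightarrow> ('s, 'z) ring_scheme \<Rightarrow> (nat \<Rightarrow> ('s, 'p) module) \<Rightarrow> (nat \<Rightarrow> 'p \<Rightarrow> 'p) \<Rightarrow>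
   ('s, 'n) module \<Rightarrow> nat \<Rightarrow> ('k, ('p \<Rightarrow> 'n) set) module" where
  "Ext \<iota> S P d N = cohomology (\<lambda>n. hom_module \<iota> S (P n) N)
     (\<lambda>n f. \<lambda>x\<in>carrier (P (Suc n)). f (d n x))"


section \<open>The monoid algebra and its modules\<close>

text \<open>For finite monoids only: no finite support condition is imposed.\<close>

definition monoid_scalar ::
  "('k, 'y) ring_scheme \<Rightarrow> ('b, 'z) monoid_scheme \<Rightarrow> 'k \<Rightarrow> 'b \<Rightarrow> 'k" where
  "monoid_scalar k B r = (\<lambda>c\<in>carrier B. if c = \<one>\<^bsub>B\<^esub> then r else \<zero>\<^bsub>k\<^esub>)"

definition monoid_algebra ::
  "('k, 'y) ring_scheme \<Rightarrow> ('b, 'z) monoid_scheme \<Rightarrow> ('b \<Rightarrow> 'k) ring" where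
  "monoid_algebra k B = \<lparr>carrier = carrier B \<rightarrow>\<^sub>E carrier k,
     mult = (\<lambda>f g. \<lambda>c\<in>carrier B.
       \<Oplus>\<^bsub>k\<^esub>p\<in>{p \<in> carrier B \<times> carrier B. fst p \<otimes>\<^bsub>B\<^esub> snd p = c}. f (fst p) \<otimes>\<^bsub>k\<^esub> g (snd p)),
     one = monoid_scalar k B \<one>\<^bsub>k\<^esub>,
     zero = (\<lambda>c\<in>carrier B. \<zero>\<^bsub>k\<^esub>),
     add = (\<lambda>f g. \<lambda>c\<in>carrier B. f c \<oplus>\<^bsub>k\<^esub> g c)\<rparr>"

text \<open>The module \<open>k\<^sub>X\<close>: the action of \<open>B\<close> on \<open>k\<close> in which \<open>b\<close> acts as the identity if
  \<open>X \<subseteq> supp b\<close> and as \<open>0\<close> otherwise, extended linearly to the monoid algebra.\<close>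

definition support_module ::
  "('k, 'y) ring_scheme \<Rightarrow> ('b, 'z) monoid_scheme \<Rightarrow> 'b set \<Rightarrow> ('b \<Rightarrow> 'k, 'k) module" where
  "support_module k B X = \<lparr>carrier = carrier k, mult = mult k, one = one k, zero = zero k,
     add = add k,
     smult = (\<lambda>a r. \<Oplus>\<^bsub>k\<^esub>b\<in>carrier B. a b \<otimes>\<^bsub>k\<^esub> (if X \<subseteq> supp B b then r else \<zero>\<^bsub>k\<^esub>))\<rparr>"


section \<open>Order complexes and reduced simplicial cohomology\<close>

text \<open>A simplicial complex is given by the set of its simplices, including the empty one.\<close>

definition order_complex :: "'v set \<Rightarrow> ('v \<Rightarrow> 'v \<Rightarrow> bool) \<Rightarrow> 'v set set" where
  "order_complex V leq = {s. finite s \<and> s \<subseteq> V \<and> (\<forall>v\<in>s. \<forall>w\<in>s. leq v w \<or> leq w v)}"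

text \<open>Augmented simplicial cochains of a simplicial complex \<open>K\<close> whose vertices are partially
  ordered by \<open>leq\<close>, totally on each simplex; this order orients the simplices. The cochains in
  index \<open>n\<close> are the functions on the simplices with \<open>n\<close> vertices, that is, of dimension
  \<open>n - 1\<close>; the empty simplex, in index \<open>0\<close>, is the augmentation.\<close>

definition simplicial_cochains ::
  "('k, 'y) ring_scheme \<Rightarrow> 'v set set \<Rightarrow> nat \<Rightarrow> ('k, 'v set \<Rightarrow> 'k) module" where
  "simplicial_cochains k K n = (let S = {s \<in> K. card s = n} in
     \<lparr>carrier = S \<rightarrow>\<^sub>E carrier k, mult = undefined, one = undefined,
      zero = (\<lambda>s\<in>S. \<zero>\<^bsub>k\<^esub>),
      add = (\<lambda>f g. \<lambda>s\<in>S. f s \<oplus>\<^bsub>k\<^esub> g s),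
      smult = (\<lambda>r f. \<lambda>s\<in>S. r \<otimes>\<^bsub>k\<^esub> f s)\<rparr>)"

text \<open>If \<open>v\<close> is the \<open>i\<close>-th vertex of \<open>s\<close>, counted from \<open>0\<close>, then the face \<open>s - {v}\<close>
  occurs with sign \<open>(-1)\<^sup>i\<close>.\<close>

definition simplicial_coboundary ::
  "('k, 'y) ring_scheme \<Rightarrow> 'v set set \<Rightarrow> ('v \<Rightarrow> 'v \<Rightarrow> bool) \<Rightarrow> nat \<Rightarrow>
   ('v set \<Rightarrow> 'k) \<Rightarrow> 'v set \<Rightarrow> 'k" where
  "simplicial_coboundary k K leq n f = (\<lambda>s\<in>{s \<in> K. card s = Suc n}.
     \<Oplus>\<^bsub>k\<^esub>v\<in>s. (\<ominus>\<^bsub>k\<^esub> \<one>\<^bsub>k\<^esub>) [^]\<^bsub>k\<^esub> card {w \<in> s. leq w v \<and> w \<noteq> v} \<otimes>\<^bsub>k\<^esub> f (s - {v}))"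

definition reduced_cohomology ::
  "('k, 'y) ring_scheme \<Rightarrow> 'v set set \<Rightarrow> ('v \<Rightarrow> 'v \<Rightarrow> bool) \<Rightarrow> nat \<Rightarrow>
   ('k, ('v set \<Rightarrow> 'k) set) module" where
  "reduced_cohomology k K leq q =
     cohomology (simplicial_cochains k K) (simplicial_coboundary k K leq) (Suc q)"

definition Delta :: "('b, 'z) monoid_scheme \<Rightarrow> 'b set \<Rightarrow> 'b \<Rightarrow> 'b set set" where
  "Delta B X y = order_complex (interval B X y - {y}) (R_le B)"

end

theory Submission
  imports Defs
begin

text \<open>Let \<open>X = supp x\<close>. The elements \<open>z\<close> with \<open>X \<subseteq> supp z\<close> form a poset under the
  \<open>R\<close>-order with largest element \<open>1\<close>, so its simplicial chain complex \<open>Q\<close> is contractible by coning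
  with \<open>1\<close> and resolves \<open>k\<^sub>X\<close>. Left multiplication makes \<open>Q\<close> a complex of modules over the monoid
  algebra, and these are projective: surjections onto \<open>Q\<^sub>n\<close> split by induction on the support of the
  largest element of a chain. A homomorphism from \<open>Q\<^sub>n\<close> to \<open>k\<^sub>Y\<close> is determined by its values on the
  chains with largest element \<open>y\<close>, that is, on the chains with \<open>n\<close> elements in \<open>B[X,Y] - {y}\<close>, and
  vanishes on chains whose largest element is strictly below \<open>y\<close>. Hence \<open>Hom(Q,k\<^sub>Y)\<close> is the augmented
  simplicial cochain complex of \<open>\<Delta>(X,Y)\<close>. Finally, Ext does not depend on the projective resolution.\<close>

section \<open>Finite sums\<close>

lemma additive_finsum:
  assumes G: "abelian_monoid G" and H: "abelian_monoid H"
    and e: "\<And>x. x \<in> carrier G \<Longrightarrow> e x \<in> carrier H" "e \<zero>\<^bsub>G\<^esub> = \<zero>\<^bsub>H\<^esub>"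
      "\<And>x y. x \<in> carrier G \<Longrightarrow> y \<in> carrier G \<Longrightarrow> e (x \<oplus>\<^bsub>G\<^esub> y) = e x \<oplus>\<^bsub>H\<^esub> e y"
    and f: "f \<in> I \<rightarrow> carrier G"
  shows "e (\<Oplus>\<^bsub>G\<^esub>i\<in>I. f i) = (\<Oplus>\<^bsub>H\<^esub>i\<in>I. e (f i))"
proof -
  interpret G: abelian_monoid G by fact
  interpret H: abelian_monoid H by fact
  show ?thesis using f
  proof (induction I rule: infinite_finite_induct)
    case (insert i I)
    then have "f \<in> I \<rightarrow> carrier G" "f i \<in> carrier G" by auto
    with insert show ?case
      by (simp add: G.finsum_insert H.finsum_insert e Pi_def)
  qed (simp_all add: e)
qed

context abelian_monoid
begin

lemma finsum_single:
  assumes "finite I" "i \<in> I" "f i \<in> carrier G" "\<And>j. j \<in> I \<Longrightarrow> j \<noteq> i \<Longrightarrow> f j = \<zero>"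
  shows "(\<Oplus>j\<in>I. f j) = f i"
proof -
  have "(\<Oplus>j\<in>insert i (I - {i}). f j) = f i \<oplus> (\<Oplus>j\<in>I - {i}. f j)"
    using assms by (intro finsum_insert) auto
  also have "(\<Oplus>j\<in>I - {i}. f j) = \<zero>" using assms by (intro add.finprod_one_eqI) auto
  finally show ?thesis using assms by (simp add: insert_absorb)
qed

lemma finsum_group:
  assumes "finite I" "finite J" "\<And>i. i \<in> I \<Longrightarrow> g i \<in> J" "\<And>i. i \<in> I \<Longrightarrow> f i \<in> carrier G"
  shows "(\<Oplus>j\<in>J. \<Oplus>i\<in>{i \<in> I. g i = j}. f i) = (\<Oplus>i\<in>I. f i)"
proof -
  have "(\<Oplus>i\<in>I. f i) = (\<Oplus>i\<in>(\<Union>j\<in>J. {i \<in> I. g i = j}). f i)"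
    using assms(3) by (intro arg_cong2[where f = "finsum G"] refl) auto
  also have "\<dots> = (\<Oplus>j\<in>J. \<Oplus>i\<in>{i \<in> I. g i = j}. f i)"
    using assms by (intro add.finprod_UN_disjoint) (auto simp: pairwise_def disjnt_def)
  finally show ?thesis ..
qed

lemma finsum_cartesian:
  assumes "finite I" "finite J" "\<And>i j. i \<in> I \<Longrightarrow> j \<in> J \<Longrightarrow> f i j \<in> carrier G"
  shows "(\<Oplus>p\<in>I \<times> J. f (fst p) (snd p)) = (\<Oplus>i\<in>I. \<Oplus>j\<in>J. f i j)"
proof -
  have "(\<Oplus>p\<in>I \<times> J. f (fst p) (snd p)) = (\<Oplus>i\<in>I. \<Oplus>p\<in>{p \<in> I \<times> J. fst p = i}. f (fst p) (snd p))"
    using assms by (intro finsum_group[symmetric]) auto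
  also have "\<dots> = (\<Oplus>i\<in>I. \<Oplus>j\<in>J. f i j)"
  proof (intro finsum_cong' refl)
    fix i assume i: "i \<in> I"
    have "{p \<in> I \<times> J. fst p = i} = Pair i ` J" using i by auto
    moreover have "(\<Oplus>p\<in>Pair i ` J. f (fst p) (snd p)) = (\<Oplus>j\<in>J. f (fst (i, j)) (snd (i, j)))"
      using i assms(3) by (intro finsum_reindex) (auto simp: inj_on_def)
    ultimately show "(\<Oplus>p\<in>{p \<in> I \<times> J. fst p = i}. f (fst p) (snd p)) = (\<Oplus>j\<in>J. f i j)"
      by simp
  qed (use assms in \<open>auto intro!: finsum_closed\<close>)
  finally show ?thesis .
qed

end

section \<open>Homomorphisms of left modules\<close>

lemma mod_homI:
  assumes "\<And>x. x \<in> carrier M \<Longrightarrow> f x \<in> carrier N" "\<And>x. x \<notin> carrier M \<Longrightarrow> f x = undefined"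
    "\<And>x y. x \<in> carrier M \<Longrightarrow> y \<in> carrier M \<Longrightarrow> f (x \<oplus>\<^bsub>M\<^esub> y) = f x \<oplus>\<^bsub>N\<^esub> f y"
    "\<And>r x. r \<in> carrier R \<Longrightarrow> x \<in> carrier M \<Longrightarrow> f (r \<odot>\<^bsub>M\<^esub> x) = r \<odot>\<^bsub>N\<^esub> f x"
  shows "f \<in> mod_hom R M N"
  using assms by (auto simp: mod_hom_def)

lemma mod_hom_closed: "f \<in> mod_hom R M N \<Longrightarrow> x \<in> carrier M \<Longrightarrow> f x \<in> carrier N"
  by (auto simp: mod_hom_def)

lemma mod_hom_undefined: "f \<in> mod_hom R M N \<Longrightarrow> x \<notin> carrier M \<Longrightarrow> f x = undefined"
  by (auto simp: mod_hom_def)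

lemma mod_hom_add:
  "f \<in> mod_hom R M N \<Longrightarrow> x \<in> carrier M \<Longrightarrow> y \<in> carrier M \<Longrightarrow> f (x \<oplus>\<^bsub>M\<^esub> y) = f x \<oplus>\<^bsub>N\<^esub> f y"
  by (auto simp: mod_hom_def)

lemma mod_hom_smult:
  "f \<in> mod_hom R M N \<Longrightarrow> r \<in> carrier R \<Longrightarrow> x \<in> carrier M \<Longrightarrow> f (r \<odot>\<^bsub>M\<^esub> x) = r \<odot>\<^bsub>N\<^esub> f x"
  by (auto simp: mod_hom_def)

lemma mod_hom_eqI:
  assumes "f \<in> mod_hom R M N" "g \<in> mod_hom R M N" "\<And>x. x \<in> carrier M \<Longrightarrow> f x = g x"
  shows "f = g"
proof
  fix x show "f x = g x"
    using assms(3)[of x] mod_hom_undefined[OF assms(1)] mod_hom_undefined[OF assms(2)]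
    by (cases "x \<in> carrier M") auto
qed

lemma mod_hom_group_hom:
  assumes "f \<in> mod_hom R M N" "abelian_group M" "abelian_group N"
  shows "group_hom (add_monoid M) (add_monoid N) f"
  using assms
  by (auto simp: group_hom_def group_hom_axioms_def hom_def abelian_group.a_group mod_hom_closed
      mod_hom_add)

lemma mod_hom_zero:
  assumes "f \<in> mod_hom R M N" "abelian_group M" "abelian_group N"
  shows "f \<zero>\<^bsub>M\<^esub> = \<zero>\<^bsub>N\<^esub>"
  using group_hom.hom_one[OF mod_hom_group_hom[OF assms]] by simp

lemma mod_hom_inv:
  assumes "f \<in> mod_hom R M N" "abelian_group M" "abelian_group N" "x \<in> carrier M"
  shows "f (\<ominus>\<^bsub>M\<^esub> x) = \<ominus>\<^bsub>N\<^esub> f x"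
  unfolding a_inv_def using group_hom.hom_inv[OF mod_hom_group_hom[OF assms(1-3)], of x] assms(4) by simp

lemma mod_hom_minus:
  assumes "f \<in> mod_hom R M N" "abelian_group M" "abelian_group N" "x \<in> carrier M" "y \<in> carrier M"
  shows "f (x \<ominus>\<^bsub>M\<^esub> y) = f x \<ominus>\<^bsub>N\<^esub> f y"
proof -
  interpret M: abelian_group M by fact
  show ?thesis
    using assms by (simp add: a_minus_def mod_hom_inv mod_hom_add)
qed

lemma mod_hom_compose:
  assumes "left_module R L" "f \<in> mod_hom R L M" "g \<in> mod_hom R M N"
  shows "compose (carrier L) g f \<in> mod_hom R L N"
proof (rule mod_homI)
  interpret L: left_module R L by fact
  fix x y assume "x \<in> carrier L" "y \<in> carrier L"
  then show "compose (carrier L) g f (x \<oplus>\<^bsub>L\<^esub> y) =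
      compose (carrier L) g f x \<oplus>\<^bsub>N\<^esub> compose (carrier L) g f y"
    using assms by (simp add: compose_def mod_hom_add mod_hom_closed)
next
  interpret L: left_module R L by fact
  fix r x assume "r \<in> carrier R" "x \<in> carrier L"
  then show "compose (carrier L) g f (r \<odot>\<^bsub>L\<^esub> x) = r \<odot>\<^bsub>N\<^esub> compose (carrier L) g f x"
    using assms by (simp add: compose_def mod_hom_closed mod_hom_smult L.smult_closed)
qed (use assms in \<open>auto simp: compose_def mod_hom_closed\<close>)

context left_module begin

lemma smult_zero:
  assumes "a \<in> carrier R" shows "a \<odot>\<^bsub>M\<^esub> \<zero>\<^bsub>M\<^esub> = \<zero>\<^bsub>M\<^esub>"
proof -
  have "a \<odot>\<^bsub>M\<^esub> \<zero>\<^bsub>M\<^esub> \<oplus>\<^bsub>M\<^esub> a \<odot>\<^bsub>M\<^esub> \<zero>\<^bsub>M\<^esub> = a \<odot>\<^bsub>M\<^esub> \<zero>\<^bsub>M\<^esub>"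
    using assms smult_r_distr[of a "\<zero>\<^bsub>M\<^esub>" "\<zero>\<^bsub>M\<^esub>"] by simp
  then show ?thesis using assms smult_closed[of a "\<zero>\<^bsub>M\<^esub>"] by (simp add: M.add.l_cancel_one)
qed

lemma zero_smult:
  assumes "x \<in> carrier M" shows "\<zero> \<odot>\<^bsub>M\<^esub> x = \<zero>\<^bsub>M\<^esub>"
proof -
  have "\<zero> \<odot>\<^bsub>M\<^esub> x \<oplus>\<^bsub>M\<^esub> \<zero> \<odot>\<^bsub>M\<^esub> x = \<zero> \<odot>\<^bsub>M\<^esub> x"
    using assms smult_l_distr[of "\<zero>" "\<zero>" x] by simp
  then show ?thesis using assms smult_closed[of "\<zero>" x] by (simp add: M.add.l_cancel_one)
qed

lemma smult_minus:
  assumes "a \<in> carrier R" "x \<in> carrier M" shows "a \<odot>\<^bsub>M\<^esub> (\<ominus>\<^bsub>M\<^esub> x) = \<ominus>\<^bsub>M\<^esub> (a \<odot>\<^bsub>M\<^esub> x)"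
proof -
  have "a \<odot>\<^bsub>M\<^esub> (\<ominus>\<^bsub>M\<^esub> x) \<oplus>\<^bsub>M\<^esub> a \<odot>\<^bsub>M\<^esub> x = \<zero>\<^bsub>M\<^esub>"
    using assms by (simp add: smult_r_distr[symmetric] smult_zero M.l_neg)
  then have "\<ominus>\<^bsub>M\<^esub> (a \<odot>\<^bsub>M\<^esub> x) = a \<odot>\<^bsub>M\<^esub> (\<ominus>\<^bsub>M\<^esub> x)"
    using assms smult_closed by (intro M.minus_equality) auto
  then show ?thesis ..
qed

lemma smult_diff:
  assumes "a \<in> carrier R" "x \<in> carrier M" "y \<in> carrier M"
  shows "a \<odot>\<^bsub>M\<^esub> (x \<ominus>\<^bsub>M\<^esub> y) = a \<odot>\<^bsub>M\<^esub> x \<ominus>\<^bsub>M\<^esub> a \<odot>\<^bsub>M\<^esub> y"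
  using assms by (simp add: a_minus_def smult_r_distr smult_minus)

lemma smult_finsum:
  assumes "a \<in> carrier R" "g \<in> I \<rightarrow> carrier M"
  shows "a \<odot>\<^bsub>M\<^esub> (\<Oplus>\<^bsub>M\<^esub>i\<in>I. g i) = (\<Oplus>\<^bsub>M\<^esub>i\<in>I. a \<odot>\<^bsub>M\<^esub> g i)"
  using assms(2)
proof (induction I rule: infinite_finite_induct)
  case (insert i I)
  then have "g \<in> I \<rightarrow> carrier M" "g i \<in> carrier M" by auto
  with insert show ?case
    using assms(1) by (simp add: M.finsum_insert smult_r_distr smult_closed Pi_def)
qed (use assms in \<open>simp_all add: smult_zero\<close>)

lemma finsum_smult:
  assumes "x \<in> carrier M" "g \<in> I \<rightarrow> carrier R"
  shows "(\<Oplus>i\<in>I. g i) \<odot>\<^bsub>M\<^esub> x = (\<Oplus>\<^bsub>M\<^esub>i\<in>I. g i \<odot>\<^bsub>M\<^esub> x)"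
  using assms(2)
proof (induction I rule: infinite_finite_induct)
  case (insert i I)
  then have "g \<in> I \<rightarrow> carrier R" "g i \<in> carrier R" by auto
  with insert show ?case
    using assms(1) by (simp add: M.finsum_insert R.finsum_insert smult_l_distr smult_closed Pi_def)
qed (use assms in \<open>simp_all add: zero_smult\<close>)

end

lemma left_module_abelian_group: "left_module R M \<Longrightarrow> abelian_group M"
  by (simp add: left_module_def)

lemma mod_hom_diff_fun:
  assumes "f \<in> mod_hom R M N" "g \<in> mod_hom R M N" "left_module R M" "left_module R N"
  shows "(\<lambda>x\<in>carrier M. f x \<ominus>\<^bsub>N\<^esub> g x) \<in> mod_hom R M N"
proof -
  interpret M: left_module R M by fact
  interpret N: left_module R N by fact
  have "a \<oplus>\<^bsub>N\<^esub> b \<ominus>\<^bsub>N\<^esub> (c \<oplus>\<^bsub>N\<^esub> e) = (a \<ominus>\<^bsub>N\<^esub> c) \<oplus>\<^bsub>N\<^esub> (b \<ominus>\<^bsub>N\<^esub> e)"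
    if "a \<in> carrier N" "b \<in> carrier N" "c \<in> carrier N" "e \<in> carrier N" for a b c e
    using that by (simp add: a_minus_def N.minus_add N.a_ac)
  then show ?thesis using assms(1,2)
    by (intro mod_homI) (auto simp: mod_hom_add mod_hom_closed mod_hom_smult M.smult_closed N.smult_diff)
qed

lemma mod_hom_id: "left_module R M \<Longrightarrow> (\<lambda>x\<in>carrier M. x) \<in> mod_hom R M M"
proof -
  assume "left_module R M"
  then interpret left_module R M .
  show ?thesis by (rule mod_homI) (auto simp: smult_closed)
qed

section \<open>Free and projective modules\<close>

definition free_basis :: "('r, 'z) ring_scheme \<Rightarrow> 'i set \<Rightarrow> 'i \<Rightarrow> 'i \<Rightarrow> 'r" where
  "free_basis R I i = (\<lambda>j\<in>I. if j = i then \<one>\<^bsub>R\<^esub> else \<zero>\<^bsub>R\<^esub>)"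

context ring begin

lemma free_basis_closed: "free_basis R I i \<in> carrier (free_module R I)"
proof -
  have "finite {j \<in> I. free_basis R I i j \<noteq> \<zero>}"
    by (rule finite_subset[of _ "{i}"]) (auto simp: free_basis_def)
  then show ?thesis by (auto simp: free_module_def free_basis_def)
qed

lemma free_module_mem: "f \<in> carrier (free_module R I) \<Longrightarrow> i \<in> I \<Longrightarrow> f i \<in> carrier R"
  by (auto simp: free_module_def)

lemma free_module_eqI:
  assumes "f \<in> carrier (free_module R I)" "g \<in> carrier (free_module R I)" "\<And>i. i \<in> I \<Longrightarrow> f i = g i"
  shows "f = g"
  using assms by (auto simp: free_module_def intro: PiE_ext)

lemma free_module_closedI:
  assumes "f \<in> I \<rightarrow>\<^sub>E carrier R" "finite J" "\<And>i. i \<in> I \<Longrightarrow> f i \<noteq> \<zero> \<Longrightarrow> i \<in> J"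
  shows "f \<in> carrier (free_module R I)"
  using assms by (auto simp: free_module_def intro: finite_subset[of _ J])

lemma free_module_left_module: "left_module R (free_module R I)"
proof -
  let ?F = "free_module R I"
  note mem = free_module_mem[of _ I]
  have fin: "finite {i \<in> I. f i \<noteq> \<zero>}" if "f \<in> carrier ?F" for f
    using that by (simp add: free_module_def)
  have add: "f \<oplus>\<^bsub>?F\<^esub> g = (\<lambda>i\<in>I. f i \<oplus> g i)" and zero: "\<zero>\<^bsub>?F\<^esub> = (\<lambda>i\<in>I. \<zero>)"
    and smult: "r \<odot>\<^bsub>?F\<^esub> f = (\<lambda>i\<in>I. r \<otimes> f i)" for f g r
    by (simp_all add: free_module_def)
  have add_closed: "f \<oplus>\<^bsub>?F\<^esub> g \<in> carrier ?F" if "f \<in> carrier ?F" "g \<in> carrier ?F" for f g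
    unfolding add using that fin mem
    by (intro free_module_closedI[of _ _ "{i \<in> I. f i \<noteq> \<zero>} \<union> {i \<in> I. g i \<noteq> \<zero>}"]) auto
  have zero_closed: "\<zero>\<^bsub>?F\<^esub> \<in> carrier ?F"
    unfolding zero by (rule free_module_closedI[of _ _ "{}"]) auto
  have smult_closed: "r \<odot>\<^bsub>?F\<^esub> f \<in> carrier ?F" if "f \<in> carrier ?F" "r \<in> carrier R" for f r
    unfolding smult using that fin mem
    by (intro free_module_closedI[of _ _ "{i \<in> I. f i \<noteq> \<zero>}"]) auto
  have "abelian_group ?F"
  proof (rule abelian_groupI)
    fix f assume f: "f \<in> carrier ?F"
    show "\<exists>g\<in>carrier ?F. g \<oplus>\<^bsub>?F\<^esub> f = \<zero>\<^bsub>?F\<^esub>"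
    proof
      show *: "(\<lambda>i\<in>I. \<ominus> (f i)) \<in> carrier ?F"
        using f fin mem by (intro free_module_closedI[of _ _ "{i \<in> I. f i \<noteq> \<zero>}"]) auto
      show "(\<lambda>i\<in>I. \<ominus> (f i)) \<oplus>\<^bsub>?F\<^esub> f = \<zero>\<^bsub>?F\<^esub>"
        by (rule free_module_eqI[OF add_closed[OF * f] zero_closed]) (simp add: add zero f mem l_neg)
    qed
    show "\<zero>\<^bsub>?F\<^esub> \<oplus>\<^bsub>?F\<^esub> f = f"
      by (rule free_module_eqI[OF add_closed[OF zero_closed f] f]) (simp add: add zero f mem)
  next
    fix f g h assume fgh: "f \<in> carrier ?F" "g \<in> carrier ?F" "h \<in> carrier ?F"
    show "f \<oplus>\<^bsub>?F\<^esub> g \<oplus>\<^bsub>?F\<^esub> h = f \<oplus>\<^bsub>?F\<^esub> (g \<oplus>\<^bsub>?F\<^esub> h)"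
      by (rule free_module_eqI[of _ I]) (simp_all add: add_closed fgh, simp add: add fgh mem a_assoc)
  next
    fix f g assume fg: "f \<in> carrier ?F" "g \<in> carrier ?F"
    show "f \<oplus>\<^bsub>?F\<^esub> g = g \<oplus>\<^bsub>?F\<^esub> f"
      by (rule free_module_eqI[of _ I]) (simp_all add: add_closed fg, simp add: add fg mem a_comm)
  qed (fact add_closed zero_closed)+
  moreover have "left_module_axioms R ?F"
  proof (unfold_locales, goal_cases)
    case (1 a f) then show ?case by (intro smult_closed)
  next
    case (2 a b f) then show ?case
      by (intro free_module_eqI[of _ I]) (simp_all add: add_closed smult_closed, simp add: add smult mem l_distr)
  next
    case (3 a f g) then show ?case
      by (intro free_module_eqI[of _ I]) (simp_all add: add_closed smult_closed, simp add: add smult mem r_distr)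
  next
    case (4 a b f) then show ?case
      by (intro free_module_eqI[of _ I]) (simp_all add: add_closed smult_closed, simp add: add smult mem m_assoc)
  next
    case (5 f) then show ?case
      by (intro free_module_eqI[of _ I]) (simp_all add: add_closed smult_closed, simp add: add smult mem)
  qed
  ultimately show ?thesis by (simp add: left_module_def ring_axioms)
qed

end

lemma free_module_hom_exists:
  assumes "left_module R M" "v \<in> I \<rightarrow> carrier M"
  shows "\<exists>h\<in>mod_hom R (free_module R I) M. \<forall>i\<in>I. h (free_basis R I i) = v i"
proof
  interpret left_module R M by fact
  let ?F = "free_module R I"
  let ?S = "\<lambda>f. {i \<in> I. f i \<noteq> \<zero>\<^bsub>R\<^esub>}"
  define h where "h = (\<lambda>f\<in>carrier ?F. \<Oplus>\<^bsub>M\<^esub>i\<in>?S f. f i \<odot>\<^bsub>M\<^esub> v i)"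
  interpret F: left_module R ?F by (rule R.free_module_left_module)
  have term_closed: "f i \<odot>\<^bsub>M\<^esub> v i \<in> carrier M" if "f \<in> carrier ?F" "i \<in> I" for f i
    using that assms by (auto simp: free_module_def intro!: smult_closed)
  have h_eq: "h f = (\<Oplus>\<^bsub>M\<^esub>i\<in>J. f i \<odot>\<^bsub>M\<^esub> v i)" if "f \<in> carrier ?F" "finite J" "?S f \<subseteq> J" "J \<subseteq> I" for f J
    unfolding h_def using that term_closed[OF that(1)] assms
    by (auto intro!: M.add.finprod_mono_neutral_cong_left zero_smult)
  have fin: "finite (?S f)" if "f \<in> carrier ?F" for f using that by (simp add: free_module_def)
  show "h \<in> mod_hom R ?F M"
  proof (rule mod_homI)
    fix f assume "f \<in> carrier ?F" then show "h f \<in> carrier M"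
      using term_closed by (auto simp: h_def intro!: M.finsum_closed)
  next
    fix f g assume fg: "f \<in> carrier ?F" "g \<in> carrier ?F"
    let ?J = "?S f \<union> ?S g"
    have J: "finite ?J" using fin[OF fg(1)] fin[OF fg(2)] by simp
    have "h (f \<oplus>\<^bsub>?F\<^esub> g) = (\<Oplus>\<^bsub>M\<^esub>i\<in>?J. (f \<oplus>\<^bsub>?F\<^esub> g) i \<odot>\<^bsub>M\<^esub> v i)"
    proof (rule h_eq)
      show "?S (f \<oplus>\<^bsub>?F\<^esub> g) \<subseteq> ?J" by (auto simp: free_module_def)
    qed (use F.a_closed[OF fg] J in auto)
    also have "\<dots> = (\<Oplus>\<^bsub>M\<^esub>i\<in>?J. f i \<odot>\<^bsub>M\<^esub> v i \<oplus>\<^bsub>M\<^esub> g i \<odot>\<^bsub>M\<^esub> v i)"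
    proof (intro M.finsum_cong' refl)
      fix i assume "i \<in> ?J"
      then have "i \<in> I" by auto
      then show "(f \<oplus>\<^bsub>?F\<^esub> g) i \<odot>\<^bsub>M\<^esub> v i = f i \<odot>\<^bsub>M\<^esub> v i \<oplus>\<^bsub>M\<^esub> g i \<odot>\<^bsub>M\<^esub> v i"
        using assms(2) R.free_module_mem[OF fg(1)] R.free_module_mem[OF fg(2)]
        by (auto simp: free_module_def Pi_def smult_l_distr)
    qed (use term_closed fg in auto)
    also have "\<dots> = h f \<oplus>\<^bsub>M\<^esub> h g"
      using fg term_closed
      by (subst M.finsum_addf) (auto simp: h_eq[of f ?J, OF _ J] h_eq[of g ?J, OF _ J])
    finally show "h (f \<oplus>\<^bsub>?F\<^esub> g) = h f \<oplus>\<^bsub>M\<^esub> h g" .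
  next
    fix r f assume rf: "r \<in> carrier R" "f \<in> carrier ?F"
    have "h (r \<odot>\<^bsub>?F\<^esub> f) = (\<Oplus>\<^bsub>M\<^esub>i\<in>?S f. (r \<odot>\<^bsub>?F\<^esub> f) i \<odot>\<^bsub>M\<^esub> v i)"
    proof (rule h_eq)
      show "?S (r \<odot>\<^bsub>?F\<^esub> f) \<subseteq> ?S f" using rf(1) by (auto simp: free_module_def)
    qed (use F.smult_closed[OF rf] fin[OF rf(2)] in auto)
    also have "\<dots> = (\<Oplus>\<^bsub>M\<^esub>i\<in>?S f. r \<odot>\<^bsub>M\<^esub> (f i \<odot>\<^bsub>M\<^esub> v i))"
    proof (intro M.finsum_cong' refl)
      fix i assume "i \<in> ?S f"
      then have "i \<in> I" by auto
      then show "(r \<odot>\<^bsub>?F\<^esub> f) i \<odot>\<^bsub>M\<^esub> v i = r \<odot>\<^bsub>M\<^esub> (f i \<odot>\<^bsub>M\<^esub> v i)"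
        using assms(2) rf(1) R.free_module_mem[OF rf(2)]
        by (auto simp: free_module_def Pi_def smult_assoc)
    qed (use term_closed rf smult_closed in auto)
    also have "\<dots> = r \<odot>\<^bsub>M\<^esub> h f"
      using smult_finsum[OF rf(1), of "\<lambda>i. f i \<odot>\<^bsub>M\<^esub> v i" "?S f"] term_closed[OF rf(2)] rf(2)
      by (simp add: h_def)
    finally show "h (r \<odot>\<^bsub>?F\<^esub> f) = r \<odot>\<^bsub>M\<^esub> h f" .
  qed (simp add: h_def)
  show "\<forall>i\<in>I. h (free_basis R I i) = v i"
  proof
    fix i assume i: "i \<in> I"
    have "h (free_basis R I i) = (\<Oplus>\<^bsub>M\<^esub>j\<in>{i}. free_basis R I i j \<odot>\<^bsub>M\<^esub> v j)"
      using i by (intro h_eq R.free_basis_closed) (auto simp: free_basis_def)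
    also have "\<dots> = v i" using i assms smult_one[of "v i"]
      by (auto simp: free_basis_def Pi_def)
    finally show "h (free_basis R I i) = v i" .
  qed
qed

lemma free_module_hom_eq:
  assumes R: "ring R" and N: "left_module R N"
    and hom: "f \<in> mod_hom R (free_module R I) N" "g \<in> mod_hom R (free_module R I) N"
    and eq: "\<And>i. i \<in> I \<Longrightarrow> f (free_basis R I i) = g (free_basis R I i)"
    and x: "x \<in> carrier (free_module R I)"
  shows "f x = g x"
proof -
  interpret R: ring R by fact
  let ?F = "free_module R I"
  interpret F: left_module R ?F by (rule R.free_module_left_module)
  interpret N: left_module R N by fact
  have "f x = g x" if "finite J" "x \<in> carrier ?F" "{i \<in> I. x i \<noteq> \<zero>\<^bsub>R\<^esub>} \<subseteq> J" "J \<subseteq> I" for J x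
    using that
  proof (induction J arbitrary: x)
    case empty
    then have "x i = \<zero>\<^bsub>?F\<^esub> i" if "i \<in> I" for i
      using that by (auto simp: free_module_def)
    then have "x = \<zero>\<^bsub>?F\<^esub>" using empty.prems(1) by (intro R.free_module_eqI[of _ I]) auto
    then show ?case using mod_hom_zero[OF hom(1)] mod_hom_zero[OF hom(2)]
      by (simp add: F.abelian_group_axioms N.abelian_group_axioms)
  next
    case (insert j J)
    define x' where "x' = (\<lambda>i\<in>I. if i = j then \<zero>\<^bsub>R\<^esub> else x i)"
    have j: "j \<in> I" using insert.prems by simp
    have x': "x' \<in> carrier ?F"
      by (rule R.free_module_closedI[of _ _ J])
        (use R.free_module_mem[OF insert.prems(1)] insert.prems insert.hyps in \<open>auto simp: x'_def split: if_splits\<close>)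
    have xj: "x j \<in> carrier R" using R.free_module_mem[OF insert.prems(1) j] .
    have b: "free_basis R I j \<in> carrier ?F" by (rule R.free_basis_closed)
    have "x i = (x' \<oplus>\<^bsub>?F\<^esub> x j \<odot>\<^bsub>?F\<^esub> free_basis R I j) i" if "i \<in> I" for i
      using that xj R.free_module_mem[OF insert.prems(1) that]
      by (auto simp: free_module_def x'_def free_basis_def)
    then have "x = x' \<oplus>\<^bsub>?F\<^esub> x j \<odot>\<^bsub>?F\<^esub> free_basis R I j"
      using insert.prems(1) x' b xj by (intro R.free_module_eqI[of _ I]) (auto simp: F.smult_closed)
    moreover have "f x' = g x'" by (rule insert.IH[OF x']) (use insert.prems in \<open>auto simp: x'_def\<close>)
    moreover have "f (free_basis R I j) = g (free_basis R I j)" using eq insert.prems by simp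
    ultimately show ?case
      using mod_hom_add[OF hom(1) x' F.smult_closed[OF xj b]] mod_hom_smult[OF hom(1) xj b]
        mod_hom_add[OF hom(2) x' F.smult_closed[OF xj b]] mod_hom_smult[OF hom(2) xj b]
      by metis
  qed
  from this[of "{i \<in> I. x i \<noteq> \<zero>\<^bsub>R\<^esub>}" x] show ?thesis using x by (auto simp: free_module_def)
qed

lemma projective_lift:
  fixes P :: "('r, 'p) module"
  assumes P: "projective R P" and M: "left_module R M" and N: "left_module R N"
    and f: "f \<in> mod_hom R P N" and \<pi>: "\<pi> \<in> mod_hom R M N" and im: "f ` carrier P \<subseteq> \<pi> ` carrier M"
  shows "\<exists>h\<in>mod_hom R P M. \<forall>x\<in>carrier P. \<pi> (h x) = f x"
proof -
  interpret R: ring R using M by (simp add: left_module_def)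
  interpret M: left_module R M by fact
  interpret P: left_module R P using P by (simp add: projective_def)
  obtain I :: "'p set" and s p where s: "s \<in> mod_hom R P (free_module R I)" and p: "p \<in> mod_hom R (free_module R I) P"
    and ps: "\<And>x. x \<in> carrier P \<Longrightarrow> p (s x) = x"
    using P unfolding projective_def by blast
  let ?F = "free_module R I"
  interpret F: left_module R ?F by (rule R.free_module_left_module)
  let ?b = "free_basis R I"
  have "\<exists>m. m \<in> carrier M \<and> \<pi> m = f (p (?b i))" for i
  proof -
    have "f (p (?b i)) \<in> f ` carrier P"
      using mod_hom_closed[OF p R.free_basis_closed] by (rule imageI)
    with im obtain m where "m \<in> carrier M" "\<pi> m = f (p (?b i))" by (metis (no_types) subsetD imageE)
    then show ?thesis by blast
  qed
  then obtain v where v: "\<And>i. v i \<in> carrier M" "\<And>i. \<pi> (v i) = f (p (?b i))" by metis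
  obtain h where h: "h \<in> mod_hom R ?F M" "\<And>i. i \<in> I \<Longrightarrow> h (?b i) = v i"
    using free_module_hom_exists[OF M, of v I] v by auto
  have "compose (carrier ?F) \<pi> h \<in> mod_hom R ?F N" "compose (carrier ?F) f p \<in> mod_hom R ?F N"
    using h p f \<pi> F.left_module_axioms by (auto intro: mod_hom_compose)
  from free_module_hom_eq[OF R.ring_axioms N this] have "\<pi> (h x) = f (p x)" if "x \<in> carrier ?F" for x
    using that v h R.free_basis_closed[of I] by (simp add: compose_def)
  moreover have "compose (carrier P) h s \<in> mod_hom R P M"
    using s h P.left_module_axioms by (auto intro: mod_hom_compose)
  ultimately show ?thesis using ps s
    by (intro bexI[of _ "compose (carrier P) h s"]) (auto simp: compose_def mod_hom_closed)
qed

lemma projectiveI: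
  fixes P :: "('r, 'p) module" and R :: "('r, 'z) ring_scheme"
  assumes P: "left_module R P"
    and split: "\<And>(M :: ('r, 'p \<Rightarrow> 'r) module) \<pi>. left_module R M \<Longrightarrow> \<pi> \<in> mod_hom R M P \<Longrightarrow>
      \<pi> ` carrier M = carrier P \<Longrightarrow> \<exists>\<sigma>\<in>mod_hom R P M. \<forall>x\<in>carrier P. \<pi> (\<sigma> x) = x"
  shows "projective R P"
proof -
  interpret R: ring R using P by (simp add: left_module_def)
  let ?F = "free_module R (carrier P)"
  obtain p where p: "p \<in> mod_hom R ?F P" "\<And>x. x \<in> carrier P \<Longrightarrow> p (free_basis R (carrier P) x) = x"
    using free_module_hom_exists[OF P, of "\<lambda>x. x" "carrier P"] by auto
  have "p ` carrier ?F = carrier P"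
  proof
    show "carrier P \<subseteq> p ` carrier ?F"
    proof
      fix x assume "x \<in> carrier P"
      then show "x \<in> p ` carrier ?F"
        using p(2)[of x] imageI[OF R.free_basis_closed[of "carrier P" x], of p] by simp
    qed
  qed (use p in \<open>auto simp: mod_hom_closed\<close>)
  from split[OF R.free_module_left_module p(1) this]
  obtain \<sigma> where "\<sigma> \<in> mod_hom R P ?F" "\<forall>x\<in>carrier P. p (\<sigma> x) = x" ..
  with p(1) show ?thesis
    unfolding projective_def by (intro conjI P exI[of _ "carrier P"] bexI)
qed

section \<open>Comparison of projective resolutions\<close>

definition resolution_cycles ::
  "('r, 'm) module \<Rightarrow> (nat \<Rightarrow> ('r, 'p) module) \<Rightarrow> (nat \<Rightarrow> 'p \<Rightarrow> 'p) \<Rightarrow> ('p \<Rightarrow> 'm) \<Rightarrow> nat \<Rightarrow> 'p set" where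
  "resolution_cycles M P d \<epsilon> n = {x \<in> carrier (P n).
     case n of 0 \<Rightarrow> \<epsilon> x = \<zero>\<^bsub>M\<^esub> | Suc m \<Rightarrow> d m x = \<zero>\<^bsub>P m\<^esub>}"

lemma projective_resolution_cycles:
  assumes "projective_resolution R M P d \<epsilon>"
  shows "d n ` carrier (P (Suc n)) = resolution_cycles M P d \<epsilon> n"
  using assms by (cases n) (auto simp: projective_resolution_def resolution_cycles_def)

lemma projective_resolution_module:
  assumes "projective_resolution R M P d \<epsilon>"
  shows "projective R (P n)" "left_module R (P n)" "d n \<in> mod_hom R (P (Suc n)) (P n)"
    "\<epsilon> \<in> mod_hom R (P 0) M"
  using assms by (auto simp: projective_resolution_def projective_def)

lemma resolution_cycles_closed: "x \<in> resolution_cycles M P d \<epsilon> n \<Longrightarrow> x \<in> carrier (P n)"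
  by (simp add: resolution_cycles_def)

lemma projective_resolution_boundary:
  assumes "projective_resolution R M P d \<epsilon>" "x \<in> carrier (P (Suc n))"
  shows "d n x \<in> resolution_cycles M P d \<epsilon> n"
  using projective_resolution_cycles[OF assms(1), of n] assms(2) by blast

lemma projective_resolution_lift:
  assumes P: "projective_resolution R M P d \<epsilon>" and Q: "projective_resolution R M' Q d' \<epsilon>'"
    and f: "f \<in> mod_hom R (P m) (Q n)" "f ` carrier (P m) \<subseteq> resolution_cycles M' Q d' \<epsilon>' n"
  shows "\<exists>h\<in>mod_hom R (P m) (Q (Suc n)). \<forall>x\<in>carrier (P m). d' n (h x) = f x"
  using projective_lift[OF projective_resolution_module(1)[OF P]
      projective_resolution_module(2)[OF Q] projective_resolution_module(2)[OF Q] f(1)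
      projective_resolution_module(3)[OF Q]] f(2)
  by (simp add: projective_resolution_cycles[OF Q])

lemma chain_map_exists:
  assumes P: "projective_resolution R M P d \<epsilon>" and Q: "projective_resolution R M Q d' \<epsilon>'"
    and M: "left_module R M"
  shows "\<exists>f. (\<forall>n. f n \<in> mod_hom R (P n) (Q n)) \<and> (\<forall>x\<in>carrier (P 0). \<epsilon>' (f 0 x) = \<epsilon> x) \<and>
    (\<forall>n. \<forall>x\<in>carrier (P (Suc n)). d' n (f (Suc n) x) = f n (d n x))"
proof -
  note P' = projective_resolution_module[OF P] and Q' = projective_resolution_module[OF Q]
  let ?Z = "resolution_cycles M P d \<epsilon>" and ?Z' = "resolution_cycles M Q d' \<epsilon>'"
  define good where "good n f \<longleftrightarrow> f \<in> mod_hom R (P n) (Q n) \<and> f ` ?Z n \<subseteq> ?Z' n \<and>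
    (n = 0 \<longrightarrow> (\<forall>x\<in>carrier (P 0). \<epsilon>' (f x) = \<epsilon> x))" for n f
  have "\<epsilon> ` carrier (P 0) \<subseteq> \<epsilon>' ` carrier (Q 0)"
    using P Q by (simp add: projective_resolution_def)
  from projective_lift[OF P'(1) Q'(2) M P'(4) Q'(4) this]
  obtain f0 where f0: "f0 \<in> mod_hom R (P 0) (Q 0)" "\<forall>x\<in>carrier (P 0). \<epsilon>' (f0 x) = \<epsilon> x" by blast
  have base: "\<exists>f. good 0 f"
    unfolding good_def using f0
    by (intro exI[of _ f0]) (auto simp: resolution_cycles_def mod_hom_closed)
  have step: "\<exists>g. good (Suc n) g \<and> (\<forall>x\<in>carrier (P (Suc n)). d' n (g x) = f (d n x))" if "good n f" for f n
  proof -
    have f: "f \<in> mod_hom R (P n) (Q n)" "f ` ?Z n \<subseteq> ?Z' n" using that by (auto simp: good_def)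
    have g1: "compose (carrier (P (Suc n))) f (d n) \<in> mod_hom R (P (Suc n)) (Q n)"
      by (rule mod_hom_compose[OF P'(2) P'(3) f(1)])
    have g2: "compose (carrier (P (Suc n))) f (d n) ` carrier (P (Suc n)) \<subseteq> ?Z' n"
      using f(2) projective_resolution_boundary[OF P] by (auto simp: compose_def)
    from projective_resolution_lift[OF P Q g1 g2] obtain g
      where g: "g \<in> mod_hom R (P (Suc n)) (Q (Suc n))"
        "\<And>x. x \<in> carrier (P (Suc n)) \<Longrightarrow> d' n (g x) = f (d n x)"
      by (auto simp: compose_def)
    have "f \<zero>\<^bsub>P n\<^esub> = \<zero>\<^bsub>Q n\<^esub>"
      by (rule mod_hom_zero[OF f(1) left_module_abelian_group[OF P'(2)] left_module_abelian_group[OF Q'(2)]])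
    then have "g ` ?Z (Suc n) \<subseteq> ?Z' (Suc n)"
      using g by (auto simp: resolution_cycles_def mod_hom_closed)
    with g show ?thesis by (auto simp: good_def)
  qed
  obtain f where f: "\<And>n. good n (f n)"
    "\<And>n. \<forall>x\<in>carrier (P (Suc n)). d' n (f (Suc n) x) = f n (d n x)"
    using dependent_nat_choice[of good "\<lambda>n f g. \<forall>x\<in>carrier (P (Suc n)). d' n (g x) = f (d n x)",
        OF base step] by blast
  show ?thesis
    by (rule exI[of _ f]) (use f in \<open>auto simp: good_def\<close>)
qed

lemma null_homotopy_exists:
  assumes P: "projective_resolution R M P d \<epsilon>" and Q: "projective_resolution R M' Q d' \<epsilon>'"
    and f: "\<And>n. f n \<in> mod_hom R (P n) (Q n)"
      "\<And>x. x \<in> carrier (P 0) \<Longrightarrow> \<epsilon>' (f 0 x) = \<zero>\<^bsub>M'\<^esub>"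
      "\<And>n x. x \<in> carrier (P (Suc n)) \<Longrightarrow> d' n (f (Suc n) x) = f n (d n x)"
  shows "\<exists>s. (\<forall>n. s n \<in> mod_hom R (P n) (Q (Suc n))) \<and> (\<forall>x\<in>carrier (P 0). f 0 x = d' 0 (s 0 x)) \<and>
    (\<forall>n. \<forall>x\<in>carrier (P (Suc n)). f (Suc n) x = d' (Suc n) (s (Suc n) x) \<oplus>\<^bsub>Q (Suc n)\<^esub> s n (d n x))"
proof -
  note P' = projective_resolution_module[OF P] and Q' = projective_resolution_module[OF Q]
  note Pg = left_module_abelian_group[OF P'(2)] and Qg = left_module_abelian_group[OF Q'(2)]
  let ?Z = "resolution_cycles M P d \<epsilon>" and ?Z' = "resolution_cycles M' Q d' \<epsilon>'"
  define good where "good n s \<longleftrightarrow> s \<in> mod_hom R (P n) (Q (Suc n)) \<and> (\<forall>x\<in>?Z n. d' n (s x) = f n x) \<and>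
    (n = 0 \<longrightarrow> (\<forall>x\<in>carrier (P 0). f 0 x = d' 0 (s x)))" for n s
  define next_ok where "next_ok n s t \<longleftrightarrow>
    (\<forall>x\<in>carrier (P (Suc n)). d' (Suc n) (t x) = f (Suc n) x \<ominus>\<^bsub>Q (Suc n)\<^esub> s (d n x))" for n s t
  have "f 0 ` carrier (P 0) \<subseteq> ?Z' 0"
    using f(2) mod_hom_closed[OF f(1)[of 0]] by (auto simp: resolution_cycles_def)
  from projective_resolution_lift[OF P Q f(1) this]
  obtain s where "s \<in> mod_hom R (P 0) (Q (Suc 0))" "\<forall>x\<in>carrier (P 0). d' 0 (s x) = f 0 x" ..
  then have base: "\<exists>s. good 0 s"
    by (intro exI[of _ s]) (simp add: good_def resolution_cycles_def)
  have step: "\<exists>t. good (Suc n) t \<and> next_ok n s t" if "good n s" for s n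
  proof -
    interpret Q0: abelian_group "Q n" by (rule Qg)
    interpret Q1: abelian_group "Q (Suc n)" by (rule Qg)
    have s: "s \<in> mod_hom R (P n) (Q (Suc n))" "\<And>x. x \<in> ?Z n \<Longrightarrow> d' n (s x) = f n x"
      using that by (auto simp: good_def)
    define g where "g = (\<lambda>x\<in>carrier (P (Suc n)).
      f (Suc n) x \<ominus>\<^bsub>Q (Suc n)\<^esub> compose (carrier (P (Suc n))) s (d n) x)"
    have g: "g \<in> mod_hom R (P (Suc n)) (Q (Suc n))"
      unfolding g_def
      by (intro mod_hom_diff_fun f(1) mod_hom_compose[OF P'(2) P'(3) s(1)] P'(2) Q'(2))
    have geq: "g x = f (Suc n) x \<ominus>\<^bsub>Q (Suc n)\<^esub> s (d n x)" if "x \<in> carrier (P (Suc n))" for x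
      using that by (simp add: g_def compose_def)
    have "g x \<in> ?Z' (Suc n)" if x: "x \<in> carrier (P (Suc n))" for x
    proof -
      have dx: "d n x \<in> ?Z n" by (rule projective_resolution_boundary[OF P x])
      have c: "f (Suc n) x \<in> carrier (Q (Suc n))" "s (d n x) \<in> carrier (Q (Suc n))"
        using mod_hom_closed[OF f(1) x] mod_hom_closed[OF s(1) resolution_cycles_closed[OF dx]] .
      have "d' n (g x) = d' n (f (Suc n) x) \<ominus>\<^bsub>Q n\<^esub> d' n (s (d n x))"
        unfolding geq[OF x] by (rule mod_hom_minus[OF Q'(3) Qg Qg c])
      also have "\<dots> = \<zero>\<^bsub>Q n\<^esub>"
        using mod_hom_closed[OF f(1) resolution_cycles_closed[OF dx]]
        by (simp add: f(3)[OF x] s(2)[OF dx] a_minus_def Q0.r_neg)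
      finally show ?thesis using mod_hom_closed[OF g x] by (simp add: resolution_cycles_def)
    qed
    then have "g ` carrier (P (Suc n)) \<subseteq> ?Z' (Suc n)" by blast
    from projective_resolution_lift[OF P Q g this] obtain t where
      t: "t \<in> mod_hom R (P (Suc n)) (Q (Suc (Suc n)))"
         "\<And>x. x \<in> carrier (P (Suc n)) \<Longrightarrow> d' (Suc n) (t x) = g x" by blast
    have "g x = f (Suc n) x" if "x \<in> ?Z (Suc n)" for x
    proof -
      have x: "x \<in> carrier (P (Suc n))" "d n x = \<zero>\<^bsub>P n\<^esub>" using that by (auto simp: resolution_cycles_def)
      then show ?thesis
        using mod_hom_zero[OF s(1) Pg Qg] mod_hom_closed[OF f(1) x(1)] by (simp add: geq a_minus_def)
    qed
    then show ?thesis
      using t geq by (intro exI[of _ t]) (auto simp: good_def next_ok_def resolution_cycles_closed)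
  qed
  obtain s where s: "\<And>n. good n (s n)" "\<And>n. next_ok n (s n) (s (Suc n))"
    using dependent_nat_choice[of good next_ok, OF base step] by blast
  have "f (Suc n) x = d' (Suc n) (s (Suc n) x) \<oplus>\<^bsub>Q (Suc n)\<^esub> s n (d n x)"
    if x: "x \<in> carrier (P (Suc n))" for n x
  proof -
    interpret Q1: abelian_group "Q (Suc n)" by (rule Qg)
    have "s n \<in> mod_hom R (P n) (Q (Suc n))" using s(1) by (simp add: good_def)
    then have "s n (d n x) \<in> carrier (Q (Suc n))" using mod_hom_closed mod_hom_closed[OF P'(3) x] by metis
    moreover have "d' (Suc n) (s (Suc n) x) = f (Suc n) x \<ominus>\<^bsub>Q (Suc n)\<^esub> s n (d n x)"
      using s(2)[of n] x by (simp add: next_ok_def)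
    ultimately show ?thesis
      using mod_hom_closed[OF f(1) x] by (simp add: a_minus_def Q1.a_assoc Q1.l_neg)
  qed
  with s show ?thesis by (intro exI[of _ s]) (auto simp: good_def)
qed

section \<open>Cohomology of cochain complexes\<close>

lemma submoduleI_left:
  assumes M: "left_module R M" and H: "H \<subseteq> carrier M" "\<zero>\<^bsub>M\<^esub> \<in> H"
    "\<And>x y. x \<in> H \<Longrightarrow> y \<in> H \<Longrightarrow> x \<oplus>\<^bsub>M\<^esub> y \<in> H" "\<And>r x. r \<in> carrier R \<Longrightarrow> x \<in> H \<Longrightarrow> r \<odot>\<^bsub>M\<^esub> x \<in> H"
  shows "submodule H R M"
proof -
  interpret M: left_module R M by fact
  have "\<ominus>\<^bsub>M\<^esub> x \<in> H" if "x \<in> H" for x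
  proof -
    have x: "x \<in> carrier M" using that H(1) by auto
    have one: "\<one>\<^bsub>R\<^esub> \<in> carrier R" and neg: "\<ominus>\<^bsub>R\<^esub> \<one>\<^bsub>R\<^esub> \<in> carrier R" by auto
    have "(\<ominus>\<^bsub>R\<^esub> \<one>\<^bsub>R\<^esub>) \<odot>\<^bsub>M\<^esub> x \<oplus>\<^bsub>M\<^esub> x = (\<ominus>\<^bsub>R\<^esub> \<one>\<^bsub>R\<^esub> \<oplus>\<^bsub>R\<^esub> \<one>\<^bsub>R\<^esub>) \<odot>\<^bsub>M\<^esub> x"
      using x by (simp add: M.smult_l_distr[OF neg one x] M.smult_one)
    also have "\<dots> = \<zero>\<^bsub>M\<^esub>" using x by (simp add: M.R.l_neg M.zero_smult)
    finally have "\<ominus>\<^bsub>M\<^esub> x = (\<ominus>\<^bsub>R\<^esub> \<one>\<^bsub>R\<^esub>) \<odot>\<^bsub>M\<^esub> x"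
      using x M.smult_closed[OF neg x] by (intro M.M.minus_equality) auto
    then show ?thesis using H(4)[OF neg that] by simp
  qed
  with H show ?thesis
    by (intro submodule.intro subgroup.intro submodule_axioms.intro) (auto simp: a_inv_def)
qed

lemma submodule_left_module:
  assumes M: "left_module R M" and H: "submodule H R M"
  shows "left_module R (M\<lparr>carrier := H\<rparr>)"
proof -
  interpret M: left_module R M by fact
  interpret H: submodule H R M by fact
  have sub: "x \<in> carrier M" if "x \<in> H" for x using that H.subset by auto
  have "abelian_group (M\<lparr>carrier := H\<rparr>)"
  proof (rule abelian_groupI)
    fix x assume "x \<in> carrier (M\<lparr>carrier := H\<rparr>)"
    then have x: "x \<in> H" by simp
    then have "\<ominus>\<^bsub>M\<^esub> x \<in> H" using H.m_inv_closed by (simp add: a_inv_def)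
    with x sub show "\<exists>y\<in>carrier (M\<lparr>carrier := H\<rparr>). y \<oplus>\<^bsub>M\<lparr>carrier := H\<rparr>\<^esub> x = \<zero>\<^bsub>M\<lparr>carrier := H\<rparr>\<^esub>"
      by (intro bexI[of _ "\<ominus>\<^bsub>M\<^esub> x"]) (simp_all add: M.M.l_neg)
  qed (use H.m_closed H.one_closed sub M.M.a_assoc M.M.a_comm in auto)
  then show ?thesis
    using H.smult_closed sub M.smult_l_distr M.smult_r_distr M.smult_assoc M.smult_one
    by (simp add: left_module_def left_module_axioms_def M.R.ring_axioms)
qed

lemma submodule_abelian_subgroup:
  assumes "left_module R M" "submodule N R M"
  shows "abelian_subgroup N M"
  using assms
  by (intro abelian_subgroupI3 additive_subgroupI) (auto simp: left_module_def submodule_def)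

lemma quotient_module_simps:
  "carrier (quotient_module M N) = a_rcosets\<^bsub>M\<^esub> N" "\<zero>\<^bsub>quotient_module M N\<^esub> = N"
  "C \<oplus>\<^bsub>quotient_module M N\<^esub> D = C <+>\<^bsub>M\<^esub> D"
  "r \<odot>\<^bsub>quotient_module M N\<^esub> C = (\<Union>x\<in>C. N +>\<^bsub>M\<^esub> (r \<odot>\<^bsub>M\<^esub> x))"
  by (simp_all add: quotient_module_def)

lemma quotient_smult_coset:
  assumes M: "left_module k M" and N: "submodule N k M" and r: "r \<in> carrier k" and x: "x \<in> carrier M"
  shows "(\<Union>z\<in>N +>\<^bsub>M\<^esub> x. N +>\<^bsub>M\<^esub> (r \<odot>\<^bsub>M\<^esub> z)) = N +>\<^bsub>M\<^esub> (r \<odot>\<^bsub>M\<^esub> x)"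
proof -
  interpret M: left_module k M by fact
  interpret N: abelian_subgroup N M using submodule_abelian_subgroup[OF M N] .
  show ?thesis
  proof (rule UN_constant_eq[OF N.a_rcos_self[OF x]], rule ballI)
    fix z assume "z \<in> N +>\<^bsub>M\<^esub> x"
    then obtain h where h: "h \<in> N" "z = h \<oplus>\<^bsub>M\<^esub> x" by (auto simp: a_r_coset_def')
    then have "r \<odot>\<^bsub>M\<^esub> z = r \<odot>\<^bsub>M\<^esub> h \<oplus>\<^bsub>M\<^esub> r \<odot>\<^bsub>M\<^esub> x"
      using r x N.a_subset by (auto intro: M.smult_r_distr)
    moreover have "r \<odot>\<^bsub>M\<^esub> h \<in> N" using submodule.smult_closed[OF N r h(1)] .
    ultimately have "r \<odot>\<^bsub>M\<^esub> z \<in> N +>\<^bsub>M\<^esub> (r \<odot>\<^bsub>M\<^esub> x)" by (auto simp: a_r_coset_def')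
    from N.a_repr_independence'[OF this M.smult_closed[OF r x]]
    show "N +>\<^bsub>M\<^esub> (r \<odot>\<^bsub>M\<^esub> z) = N +>\<^bsub>M\<^esub> (r \<odot>\<^bsub>M\<^esub> x)" by simp
  qed
qed

lemma quotient_module_isomorphic:
  fixes M :: "('k, 'm) module" and M' :: "('k, 'n) module"
  assumes M: "left_module k M" and M': "left_module k M'"
    and N: "submodule N k M" and N': "submodule N' k M'"
    and F: "F \<in> mod_hom k M M'" "F ` N \<subseteq> N'"
    and inj: "\<And>x. x \<in> carrier M \<Longrightarrow> F x \<in> N' \<Longrightarrow> x \<in> N"
    and surj: "\<And>y. y \<in> carrier M' \<Longrightarrow> \<exists>x\<in>carrier M. \<exists>b\<in>N'. y = b \<oplus>\<^bsub>M'\<^esub> F x"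
  shows "mod_isomorphic k (quotient_module M N) (quotient_module M' N')"
proof -
  interpret M: left_module k M by fact
  interpret M': left_module k M' by fact
  interpret N: abelian_subgroup N M using submodule_abelian_subgroup[OF M N] .
  interpret N': abelian_subgroup N' M' using submodule_abelian_subgroup[OF M' N'] .
  let ?c = "\<lambda>x. N +>\<^bsub>M\<^esub> x" and ?c' = "\<lambda>x. N' +>\<^bsub>M'\<^esub> x"
  have F_closed: "F x \<in> carrier M'" if "x \<in> carrier M" for x using mod_hom_closed[OF F(1) that] .
  have mem: "z \<in> ?c x \<longleftrightarrow> (\<exists>h\<in>N. z = h \<oplus>\<^bsub>M\<^esub> x)" for z x by (auto simp: a_r_coset_def')
  have mem': "z \<in> ?c' x \<longleftrightarrow> (\<exists>h\<in>N'. z = h \<oplus>\<^bsub>M'\<^esub> x)" for z x by (auto simp: a_r_coset_def')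
  have F_coset: "?c' (F z) = ?c' (F x)" if x: "x \<in> carrier M" and z: "z \<in> ?c x" for x z
  proof -
    obtain h where h: "h \<in> N" "z = h \<oplus>\<^bsub>M\<^esub> x" using z mem by auto
    then have "F z = F h \<oplus>\<^bsub>M'\<^esub> F x" using x N.a_subset by (auto intro: mod_hom_add[OF F(1)])
    then have "F z \<in> ?c' (F x)" using F(2) h(1) mem' by auto
    then show ?thesis using N'.a_repr_independence'[OF _ F_closed[OF x]] by simp
  qed
  define \<Phi> where "\<Phi> = (\<lambda>C\<in>a_rcosets\<^bsub>M\<^esub> N. \<Union>z\<in>C. ?c' (F z))"
  have \<Phi>: "\<Phi> (?c x) = ?c' (F x)" if "x \<in> carrier M" for x
  proof -
    have "?c x \<in> a_rcosets\<^bsub>M\<^esub> N" using M.a_rcosetsI[OF N.a_subset that] .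
    moreover have "(\<Union>z\<in>?c x. ?c' (F z)) = ?c' (F x)"
      by (rule UN_constant_eq[OF N.a_rcos_self[OF that]]) (use F_coset[OF that] in blast)
    ultimately show ?thesis by (simp add: \<Phi>_def)
  qed
  note smult = quotient_smult_coset[OF M N] and smult' = quotient_smult_coset[OF M' N']
  have cosets: "a_rcosets\<^bsub>M\<^esub> N = ?c ` carrier M" "a_rcosets\<^bsub>M'\<^esub> N' = ?c' ` carrier M'"
    by (auto simp: A_RCOSETS_def')
  have hom: "\<Phi> \<in> mod_hom k (quotient_module M N) (quotient_module M' N')"
  proof (rule mod_homI, unfold quotient_module_def module.simps partial_object.simps ring.simps)
    fix C assume "C \<in> a_rcosets\<^bsub>M\<^esub> N"
    then show "\<Phi> C \<in> a_rcosets\<^bsub>M'\<^esub> N'" by (auto simp: cosets \<Phi> F_closed)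
  next
    fix C D assume "C \<in> a_rcosets\<^bsub>M\<^esub> N" "D \<in> a_rcosets\<^bsub>M\<^esub> N"
    then show "\<Phi> (C <+>\<^bsub>M\<^esub> D) = \<Phi> C <+>\<^bsub>M'\<^esub> \<Phi> D"
      by (auto simp: cosets \<Phi> F_closed N.a_rcos_sum N'.a_rcos_sum mod_hom_add[OF F(1)])
  next
    fix r C assume r: "r \<in> carrier k" and "C \<in> a_rcosets\<^bsub>M\<^esub> N"
    then obtain x where x: "x \<in> carrier M" "C = ?c x" by (auto simp: cosets)
    show "\<Phi> (\<Union>x\<in>C. ?c (r \<odot>\<^bsub>M\<^esub> x)) = (\<Union>x\<in>\<Phi> C. ?c' (r \<odot>\<^bsub>M'\<^esub> x))"
      unfolding x(2) \<Phi>[OF x(1)] smult[OF r x(1)] smult'[OF r F_closed[OF x(1)]]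
        \<Phi>[OF M.smult_closed[OF r x(1)]] mod_hom_smult[OF F(1) r x(1)] ..
  qed (simp add: \<Phi>_def)
  moreover have "bij_betw \<Phi> (a_rcosets\<^bsub>M\<^esub> N) (a_rcosets\<^bsub>M'\<^esub> N')"
  proof (rule bij_betw_imageI)
    show "inj_on \<Phi> (a_rcosets\<^bsub>M\<^esub> N)"
    proof (rule inj_onI)
      fix C D assume "C \<in> a_rcosets\<^bsub>M\<^esub> N" "D \<in> a_rcosets\<^bsub>M\<^esub> N" and eq: "\<Phi> C = \<Phi> D"
      then obtain x z where x: "x \<in> carrier M" "C = ?c x" and z: "z \<in> carrier M" "D = ?c z"
        by (auto simp: cosets)
      have "F z \<in> ?c' (F x)" using eq x z N'.a_rcos_self[OF F_closed[OF z(1)]] by (simp add: \<Phi>)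
      then obtain h where h: "h \<in> N'" "F z = h \<oplus>\<^bsub>M'\<^esub> F x" using mem' by auto
      have "F (z \<ominus>\<^bsub>M\<^esub> x) = F z \<ominus>\<^bsub>M'\<^esub> F x"
        by (rule mod_hom_minus[OF F(1) M.abelian_group_axioms M'.abelian_group_axioms z(1) x(1)])
      also have "\<dots> = h"
        using h F_closed[OF x(1)] N'.a_subset by (auto simp: a_minus_def M'.M.a_assoc M'.M.r_neg)
      finally have "F (z \<ominus>\<^bsub>M\<^esub> x) = h" .
      then have "z \<ominus>\<^bsub>M\<^esub> x \<in> N" using inj x z h by auto
      moreover have "z = (z \<ominus>\<^bsub>M\<^esub> x) \<oplus>\<^bsub>M\<^esub> x" using x z by (simp add: a_minus_def M.M.a_assoc M.M.l_neg)
      ultimately have "z \<in> ?c x" using mem by auto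
      then show "C = D" using N.a_repr_independence'[OF _ x(1)] x z by simp
    qed
    have "?c' y \<in> \<Phi> ` (a_rcosets\<^bsub>M\<^esub> N)" if y: "y \<in> carrier M'" for y
    proof -
      obtain x b where xb: "x \<in> carrier M" "b \<in> N'" "y = b \<oplus>\<^bsub>M'\<^esub> F x" using surj[OF y] by auto
      then have "y \<in> ?c' (F x)" using mem' by auto
      then have "?c' y = \<Phi> (?c x)" using N'.a_repr_independence'[OF _ F_closed[OF xb(1)]] \<Phi>[OF xb(1)] by simp
      then show ?thesis using xb(1) cosets by auto
    qed
    then show "\<Phi> ` (a_rcosets\<^bsub>M\<^esub> N) = a_rcosets\<^bsub>M'\<^esub> N'"
      by (auto simp: cosets \<Phi> F_closed)
  qed
  ultimately show ?thesis
    unfolding mod_isomorphic_def by (intro bexI[of _ \<Phi>]) (auto simp: quotient_module_def)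
qed

lemma quotient_module_closed:
  assumes M: "left_module k M" and N: "submodule N k M"
  shows "C \<in> carrier (quotient_module M N) \<Longrightarrow> D \<in> carrier (quotient_module M N) \<Longrightarrow>
      C \<oplus>\<^bsub>quotient_module M N\<^esub> D \<in> carrier (quotient_module M N)"
    and "r \<in> carrier k \<Longrightarrow> C \<in> carrier (quotient_module M N) \<Longrightarrow>
      r \<odot>\<^bsub>quotient_module M N\<^esub> C \<in> carrier (quotient_module M N)"
    and "\<zero>\<^bsub>quotient_module M N\<^esub> \<in> carrier (quotient_module M N)"
proof -
  interpret M: left_module k M by fact
  interpret N: abelian_subgroup N M using submodule_abelian_subgroup[OF M N] .
  have cosets: "a_rcosets\<^bsub>M\<^esub> N = (\<lambda>x. N +>\<^bsub>M\<^esub> x) ` carrier M" by (auto simp: A_RCOSETS_def')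
  show "C \<in> carrier (quotient_module M N) \<Longrightarrow> D \<in> carrier (quotient_module M N) \<Longrightarrow>
      C \<oplus>\<^bsub>quotient_module M N\<^esub> D \<in> carrier (quotient_module M N)"
    by (auto simp: quotient_module_simps cosets N.a_rcos_sum)
  show "r \<odot>\<^bsub>quotient_module M N\<^esub> C \<in> carrier (quotient_module M N)"
    if r: "r \<in> carrier k" and C: "C \<in> carrier (quotient_module M N)"
  proof -
    obtain x where x: "x \<in> carrier M" "C = N +>\<^bsub>M\<^esub> x"
      using C unfolding quotient_module_simps cosets by blast
    show ?thesis
      unfolding quotient_module_simps cosets x(2) quotient_smult_coset[OF M N r x(1)]
      by (rule imageI[OF M.smult_closed[OF r x(1)]])
  qed
  show "\<zero>\<^bsub>quotient_module M N\<^esub> \<in> carrier (quotient_module M N)"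
    unfolding quotient_module_simps by (rule N.a_subgroup_in_rcosets)
qed

lemma quotient_module_trivial:
  assumes M: "left_module k M" and N: "submodule N k M" and sub: "carrier M \<subseteq> N"
  shows "carrier (quotient_module M N) = {\<zero>\<^bsub>quotient_module M N\<^esub>}"
proof -
  interpret M: left_module k M by fact
  interpret N: abelian_subgroup N M using submodule_abelian_subgroup[OF M N] .
  have "N +>\<^bsub>M\<^esub> x = N" if "x \<in> carrier M" for x
    using M.a_coset_join2[OF that N.a_subgroup] sub that by auto
  then have "a_rcosets\<^bsub>M\<^esub> N = (\<Union>x\<in>carrier M. {N})"
    unfolding A_RCOSETS_def' by (intro SUP_cong) auto
  then show ?thesis using M.M.zero_closed by (auto simp: quotient_module_simps)
qed

lemma quotient_zero_isomorphic:
  assumes M: "left_module k M" and F: "F \<in> mod_hom k M M'" "bij_betw F (carrier M) (carrier M')"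
  shows "mod_isomorphic k (quotient_module M {\<zero>\<^bsub>M\<^esub>}) M'"
proof -
  interpret M: left_module k M by fact
  have coset: "{\<zero>\<^bsub>M\<^esub>} +>\<^bsub>M\<^esub> x = {x}" if "x \<in> carrier M" for x
    using that by (simp add: a_r_coset_def')
  then have cosets: "a_rcosets\<^bsub>M\<^esub> {\<zero>\<^bsub>M\<^esub>} = (\<lambda>x. {x}) ` carrier M" by (auto simp: A_RCOSETS_def')
  define \<Phi> where "\<Phi> = (\<lambda>C\<in>a_rcosets\<^bsub>M\<^esub> {\<zero>\<^bsub>M\<^esub>}. F (the_elem C))"
  have \<Phi>: "\<Phi> {x} = F x" if "x \<in> carrier M" for x using that by (simp add: \<Phi>_def cosets)
  have hom: "\<Phi> \<in> mod_hom k (quotient_module M {\<zero>\<^bsub>M\<^esub>}) M'"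
  proof (rule mod_homI, unfold quotient_module_simps)
    fix C assume "C \<in> a_rcosets\<^bsub>M\<^esub> {\<zero>\<^bsub>M\<^esub>}"
    then show "\<Phi> C \<in> carrier M'" using mod_hom_closed[OF F(1)] by (auto simp: cosets \<Phi>)
  next
    fix C D assume "C \<in> a_rcosets\<^bsub>M\<^esub> {\<zero>\<^bsub>M\<^esub>}" "D \<in> a_rcosets\<^bsub>M\<^esub> {\<zero>\<^bsub>M\<^esub>}"
    then obtain x z where "x \<in> carrier M" "z \<in> carrier M" "C = {x}" "D = {z}" by (auto simp: cosets)
    then show "\<Phi> (C <+>\<^bsub>M\<^esub> D) = \<Phi> C \<oplus>\<^bsub>M'\<^esub> \<Phi> D"
      by (simp add: set_add_def' \<Phi> mod_hom_add[OF F(1)])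
  next
    fix r C assume r: "r \<in> carrier k" and "C \<in> a_rcosets\<^bsub>M\<^esub> {\<zero>\<^bsub>M\<^esub>}"
    then obtain x where x: "x \<in> carrier M" "C = {x}" by (auto simp: cosets)
    then show "\<Phi> (\<Union>x\<in>C. {\<zero>\<^bsub>M\<^esub>} +>\<^bsub>M\<^esub> (r \<odot>\<^bsub>M\<^esub> x)) = r \<odot>\<^bsub>M'\<^esub> \<Phi> C"
      using M.smult_closed[OF r x(1)] r by (simp add: coset \<Phi> mod_hom_smult[OF F(1)])
  qed (simp add: \<Phi>_def)
  have "bij_betw (\<lambda>x. {x}) (carrier M) (a_rcosets\<^bsub>M\<^esub> {\<zero>\<^bsub>M\<^esub>})"
    by (auto simp: bij_betw_def cosets)
  moreover have "bij_betw (\<Phi> \<circ> (\<lambda>x. {x})) (carrier M) (carrier M')"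
    using F(2) \<Phi> by (simp add: bij_betw_cong[of "carrier M" "\<Phi> \<circ> (\<lambda>x. {x})" F])
  ultimately have "bij_betw \<Phi> (a_rcosets\<^bsub>M\<^esub> {\<zero>\<^bsub>M\<^esub>}) (carrier M')"
    by (rule iffD2[OF bij_betw_comp_iff])
  with hom show ?thesis
    unfolding mod_isomorphic_def by (intro bexI[of _ \<Phi>]) (simp_all add: quotient_module_simps)
qed

lemma mod_isomorphic_trans:
  assumes iso: "mod_isomorphic R L M" "mod_isomorphic R M N"
    and closed: "\<And>x y. x \<in> carrier L \<Longrightarrow> y \<in> carrier L \<Longrightarrow> x \<oplus>\<^bsub>L\<^esub> y \<in> carrier L"
      "\<And>r x. r \<in> carrier R \<Longrightarrow> x \<in> carrier L \<Longrightarrow> r \<odot>\<^bsub>L\<^esub> x \<in> carrier L"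
  shows "mod_isomorphic R L N"
proof -
  obtain f g where f: "f \<in> mod_hom R L M" "bij_betw f (carrier L) (carrier M)"
    and g: "g \<in> mod_hom R M N" "bij_betw g (carrier M) (carrier N)"
    using iso by (auto simp: mod_isomorphic_def)
  have "compose (carrier L) g f \<in> mod_hom R L N"
    by (rule mod_homI) (use closed mod_hom_closed[OF f(1)] mod_hom_closed[OF g(1)] in
      \<open>auto simp: compose_def mod_hom_add[OF f(1)] mod_hom_add[OF g(1)] mod_hom_smult[OF f(1)]
        mod_hom_smult[OF g(1)]\<close>)
  moreover have "bij_betw (compose (carrier L) g f) (carrier L) (carrier N)"
    using bij_betw_trans[OF f(2) g(2)] bij_betw_cong[of "carrier L" "compose (carrier L) g f" "g \<circ> f"]
    by (simp add: compose_def)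
  ultimately show ?thesis unfolding mod_isomorphic_def by blast
qed

lemma mod_isomorphic_trivial:
  assumes "mod_isomorphic R L M" "carrier M = {c}" "e \<in> carrier L"
  shows "carrier L = {e}"
proof -
  obtain f where "bij_betw f (carrier L) {c}" using assms by (auto simp: mod_isomorphic_def)
  then have "card (carrier L) = 1" using bij_betw_same_card by fastforce
  with assms(3) show ?thesis by (auto simp: card_1_singleton_iff)
qed

definition cochain_complex ::
  "('k, 'z) ring_scheme \<Rightarrow> (nat \<Rightarrow> ('k, 'c) module) \<Rightarrow> (nat \<Rightarrow> 'c \<Rightarrow> 'c) \<Rightarrow> bool" where
  "cochain_complex k C \<delta> \<longleftrightarrow> (\<forall>n. left_module k (C n) \<and>
     (\<lambda>x\<in>carrier (C n). \<delta> n x) \<in> mod_hom k (C n) (C (Suc n)) \<and>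
     (\<forall>x\<in>carrier (C n). \<delta> (Suc n) (\<delta> n x) = \<zero>\<^bsub>C (Suc (Suc n))\<^esub>))"

definition coboundaries :: "(nat \<Rightarrow> ('k, 'c) module) \<Rightarrow> (nat \<Rightarrow> 'c \<Rightarrow> 'c) \<Rightarrow> nat \<Rightarrow> 'c set" where
  "coboundaries C \<delta> n = (case n of 0 \<Rightarrow> {\<zero>\<^bsub>C 0\<^esub>} | Suc m \<Rightarrow> \<delta> m ` carrier (C m))"

lemma coboundariesI:
  "n = Suc m \<Longrightarrow> u \<in> carrier (C m) \<Longrightarrow> x = \<delta> m u \<Longrightarrow> x \<in> coboundaries C \<delta> n"
  by (simp add: coboundaries_def)

context
  fixes k :: "('k, 'z) ring_scheme" and C :: "nat \<Rightarrow> ('k, 'c) module" and \<delta>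
  assumes C: "cochain_complex k C \<delta>"
begin

lemma cochain_complex_module: "left_module k (C n)"
  using C by (simp add: cochain_complex_def)

lemma cochain_complex_closed: "x \<in> carrier (C n) \<Longrightarrow> \<delta> n x \<in> carrier (C (Suc n))"
  using C mod_hom_closed unfolding cochain_complex_def by fastforce

lemma cochain_complex_zero: "\<delta> n \<zero>\<^bsub>C n\<^esub> = \<zero>\<^bsub>C (Suc n)\<^esub>"
proof -
  interpret left_module k "C n" by (rule cochain_complex_module)
  interpret S: left_module k "C (Suc n)" by (rule cochain_complex_module)
  have "(\<lambda>x\<in>carrier (C n). \<delta> n x) \<in> mod_hom k (C n) (C (Suc n))" using C by (simp add: cochain_complex_def)
  then have "(\<lambda>x\<in>carrier (C n). \<delta> n x) \<zero>\<^bsub>C n\<^esub> = \<zero>\<^bsub>C (Suc n)\<^esub>"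
    by (rule mod_hom_zero[OF _ abelian_group_axioms S.abelian_group_axioms])
  then show ?thesis by simp
qed

lemma cochain_complex_add:
  assumes "x \<in> carrier (C n)" "y \<in> carrier (C n)"
  shows "\<delta> n (x \<oplus>\<^bsub>C n\<^esub> y) = \<delta> n x \<oplus>\<^bsub>C (Suc n)\<^esub> \<delta> n y"
proof -
  interpret left_module k "C n" by (rule cochain_complex_module)
  have "(\<lambda>x\<in>carrier (C n). \<delta> n x) \<in> mod_hom k (C n) (C (Suc n))" using C by (simp add: cochain_complex_def)
  from mod_hom_add[OF this assms] show ?thesis using assms by simp
qed

lemma cochain_complex_smult:
  assumes "r \<in> carrier k" "x \<in> carrier (C n)"
  shows "\<delta> n (r \<odot>\<^bsub>C n\<^esub> x) = r \<odot>\<^bsub>C (Suc n)\<^esub> \<delta> n x"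
proof -
  interpret left_module k "C n" by (rule cochain_complex_module)
  have "(\<lambda>x\<in>carrier (C n). \<delta> n x) \<in> mod_hom k (C n) (C (Suc n))" using C by (simp add: cochain_complex_def)
  from mod_hom_smult[OF this assms] show ?thesis using assms smult_closed[OF assms] by simp
qed

lemma cocycles_submodule: "submodule {x \<in> carrier (C n). \<delta> n x = \<zero>\<^bsub>C (Suc n)\<^esub>} k (C n)"
proof -
  interpret left_module k "C n" by (rule cochain_complex_module)
  interpret S: left_module k "C (Suc n)" by (rule cochain_complex_module)
  show ?thesis
    by (rule submoduleI_left[OF cochain_complex_module])
      (auto simp: cochain_complex_zero cochain_complex_add cochain_complex_smult smult_closed S.smult_zero)
qed

lemma coboundaries_cocycles:
  "coboundaries C \<delta> n \<subseteq> {x \<in> carrier (C n). \<delta> n x = \<zero>\<^bsub>C (Suc n)\<^esub>}"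
proof (cases n)
  case 0
  interpret left_module k "C 0" by (rule cochain_complex_module)
  show ?thesis by (simp add: 0 coboundaries_def cochain_complex_zero)
next
  case (Suc m)
  then show ?thesis
    using C by (auto simp: coboundaries_def cochain_complex_closed cochain_complex_def)
qed

lemma coboundaries_submodule: "submodule (coboundaries C \<delta> n) k (C n)"
proof (cases n)
  case 0
  interpret left_module k "C 0" by (rule cochain_complex_module)
  show ?thesis unfolding 0
    by (rule submoduleI_left[OF cochain_complex_module]) (auto simp: coboundaries_def smult_zero)
next
  case (Suc m)
  interpret left_module k "C m" by (rule cochain_complex_module)
  show ?thesis unfolding Suc
  proof (rule submoduleI_left[OF cochain_complex_module])
    show "coboundaries C \<delta> (Suc m) \<subseteq> carrier (C (Suc m))" using coboundaries_cocycles by blast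
    show "\<zero>\<^bsub>C (Suc m)\<^esub> \<in> coboundaries C \<delta> (Suc m)"
      unfolding coboundaries_def by (auto intro!: image_eqI[of _ _ "\<zero>\<^bsub>C m\<^esub>"] simp: cochain_complex_zero)
    fix x assume "x \<in> coboundaries C \<delta> (Suc m)"
    then obtain u where u: "u \<in> carrier (C m)" "x = \<delta> m u" by (auto simp: coboundaries_def)
    {
      fix y assume "y \<in> coboundaries C \<delta> (Suc m)"
      then obtain v where v: "v \<in> carrier (C m)" "y = \<delta> m v" by (auto simp: coboundaries_def)
      have "x \<oplus>\<^bsub>C (Suc m)\<^esub> y = \<delta> m (u \<oplus>\<^bsub>C m\<^esub> v)" using u v by (simp add: cochain_complex_add)
      then show "x \<oplus>\<^bsub>C (Suc m)\<^esub> y \<in> coboundaries C \<delta> (Suc m)"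
        using u v by (auto simp: coboundaries_def)
    }
    fix r assume r: "r \<in> carrier k"
    have "r \<odot>\<^bsub>C (Suc m)\<^esub> x = \<delta> m (r \<odot>\<^bsub>C m\<^esub> u)" using u r by (simp add: cochain_complex_smult)
    then show "r \<odot>\<^bsub>C (Suc m)\<^esub> x \<in> coboundaries C \<delta> (Suc m)"
      using smult_closed[OF r u(1)] by (auto simp: coboundaries_def)
  qed
qed

end

lemma cohomology_quotient:
  assumes C: "cochain_complex k C \<delta>"
  defines "Z \<equiv> (\<lambda>n. (C n)\<lparr>carrier := {x \<in> carrier (C n). \<delta> n x = \<zero>\<^bsub>C (Suc n)\<^esub>}\<rparr>)"
  shows "cohomology C \<delta> n = quotient_module (Z n) (coboundaries C \<delta> n)" "left_module k (Z n)"
    "submodule (coboundaries C \<delta> n) k (Z n)"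
proof -
  show "cohomology C \<delta> n = quotient_module (Z n) (coboundaries C \<delta> n)"
    by (simp add: cohomology_def coboundaries_def Z_def)
  show M: "left_module k (Z n)"
    unfolding Z_def by (rule submodule_left_module[OF cochain_complex_module[OF C] cocycles_submodule[OF C]])
  interpret submodule "coboundaries C \<delta> n" k "C n" by (rule coboundaries_submodule[OF C])
  show "submodule (coboundaries C \<delta> n) k (Z n)"
    by (rule submoduleI_left[OF M])
      (use coboundaries_cocycles[OF C, of n] m_closed one_closed in \<open>auto simp: Z_def\<close>)
qed

lemma cohomology_isomorphic:
  assumes C: "cochain_complex k C \<delta>" and D: "cochain_complex k D \<delta>'"
    and F: "F \<in> mod_hom k (C n) (D n)"
      "\<And>x. x \<in> carrier (C n) \<Longrightarrow> \<delta> n x = \<zero>\<^bsub>C (Suc n)\<^esub> \<Longrightarrow> \<delta>' n (F x) = \<zero>\<^bsub>D (Suc n)\<^esub>"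
      "F ` coboundaries C \<delta> n \<subseteq> coboundaries D \<delta>' n"
    and inj: "\<And>x. x \<in> carrier (C n) \<Longrightarrow> \<delta> n x = \<zero>\<^bsub>C (Suc n)\<^esub> \<Longrightarrow> F x \<in> coboundaries D \<delta>' n \<Longrightarrow>
      x \<in> coboundaries C \<delta> n"
    and surj: "\<And>y. y \<in> carrier (D n) \<Longrightarrow> \<delta>' n y = \<zero>\<^bsub>D (Suc n)\<^esub> \<Longrightarrow>
      \<exists>x\<in>carrier (C n). \<delta> n x = \<zero>\<^bsub>C (Suc n)\<^esub> \<and> (\<exists>b\<in>coboundaries D \<delta>' n. y = b \<oplus>\<^bsub>D n\<^esub> F x)"
  shows "mod_isomorphic k (cohomology C \<delta> n) (cohomology D \<delta>' n)"
proof -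
  let ?Z = "{x \<in> carrier (C n). \<delta> n x = \<zero>\<^bsub>C (Suc n)\<^esub>}"
  let ?Z' = "{x \<in> carrier (D n). \<delta>' n x = \<zero>\<^bsub>D (Suc n)\<^esub>}"
  let ?M = "(C n)\<lparr>carrier := ?Z\<rparr>" and ?M' = "(D n)\<lparr>carrier := ?Z'\<rparr>"
  note q = cohomology_quotient[OF C, of n] and q' = cohomology_quotient[OF D, of n]
  interpret Mod: left_module k ?M by (rule q(2))
  have F': "(\<lambda>x\<in>?Z. F x) \<in> mod_hom k ?M ?M'"
  proof (rule mod_homI)
    fix x y assume "x \<in> carrier ?M" "y \<in> carrier ?M"
    then show "(\<lambda>x\<in>?Z. F x) (x \<oplus>\<^bsub>?M\<^esub> y) = (\<lambda>x\<in>?Z. F x) x \<oplus>\<^bsub>?M'\<^esub> (\<lambda>x\<in>?Z. F x) y"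
      using Mod.M.a_closed[of x y] mod_hom_add[OF F(1), of x y] by simp
  next
    fix r x assume "r \<in> carrier k" "x \<in> carrier ?M"
    then show "(\<lambda>x\<in>?Z. F x) (r \<odot>\<^bsub>?M\<^esub> x) = r \<odot>\<^bsub>?M'\<^esub> (\<lambda>x\<in>?Z. F x) x"
      using Mod.smult_closed[of r x] mod_hom_smult[OF F(1), of r x] by simp
  qed (use F(2) mod_hom_closed[OF F(1)] in auto)
  have "mod_isomorphic k (quotient_module ?M (coboundaries C \<delta> n)) (quotient_module ?M' (coboundaries D \<delta>' n))"
  proof (rule quotient_module_isomorphic[OF q(2) q'(2) q(3) q'(3) F'])
    show "(\<lambda>x\<in>?Z. F x) ` coboundaries C \<delta> n \<subseteq> coboundaries D \<delta>' n"
      using F(3) coboundaries_cocycles[OF C, of n] by auto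
  next
    fix x assume "x \<in> carrier ?M" "(\<lambda>x\<in>?Z. F x) x \<in> coboundaries D \<delta>' n"
    then show "x \<in> coboundaries C \<delta> n" using inj[of x] by simp
  next
    fix y assume "y \<in> carrier ?M'"
    then obtain x b where "x \<in> carrier (C n)" "\<delta> n x = \<zero>\<^bsub>C (Suc n)\<^esub>" "b \<in> coboundaries D \<delta>' n"
      "y = b \<oplus>\<^bsub>D n\<^esub> F x" using surj[of y] by auto
    then show "\<exists>x\<in>carrier ?M. \<exists>b\<in>coboundaries D \<delta>' n. y = b \<oplus>\<^bsub>?M'\<^esub> (\<lambda>x\<in>?Z. F x) x"
      by (intro bexI[of _ x] bexI[of _ b]) auto
  qed
  then show ?thesis unfolding q(1) q'(1) .
qed

lemma cohomology_trivial:
  assumes C: "cochain_complex k C \<delta>"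
    and "\<And>x. x \<in> carrier (C n) \<Longrightarrow> \<delta> n x = \<zero>\<^bsub>C (Suc n)\<^esub> \<Longrightarrow> x \<in> coboundaries C \<delta> n"
  shows "carrier (cohomology C \<delta> n) = {\<zero>\<^bsub>cohomology C \<delta> n\<^esub>}"
  unfolding cohomology_quotient(1)[OF C]
  by (rule quotient_module_trivial[OF cohomology_quotient(2,3)[OF C]]) (use assms(2) in auto)

lemma cochain_complex_transport:
  assumes C: "cochain_complex k C \<delta>"
    and \<Psi>: "\<And>n. \<Psi> n \<in> mod_hom k (C n) (D n)" "\<And>n. bij_betw (\<Psi> n) (carrier (C n)) (carrier (D n))"
      "\<And>n. \<Psi> n \<zero>\<^bsub>C n\<^esub> = \<zero>\<^bsub>D n\<^esub>"
    and comm: "\<And>n x. x \<in> carrier (C n) \<Longrightarrow> \<delta>' n (\<Psi> n x) = \<Psi> (Suc n) (\<delta> n x)"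
  shows "cochain_complex k D \<delta>'" "mod_isomorphic k (cohomology C \<delta> n) (cohomology D \<delta>' n)"
proof -
  have D: "carrier (D n) = \<Psi> n ` carrier (C n)" for n using \<Psi>(2) by (auto simp: bij_betw_def)
  have inj: "\<Psi> n u = \<Psi> n v \<longleftrightarrow> u = v" if "u \<in> carrier (C n)" "v \<in> carrier (C n)" for n u v
    using inj_on_eq_iff[OF bij_betw_imp_inj_on[OF \<Psi>(2)] that] .
  note add = mod_hom_add[OF \<Psi>(1), symmetric] and smult = mod_hom_smult[OF \<Psi>(1), symmetric]
  note \<delta>c = cochain_complex_closed[OF C]
  have module: "left_module k (D n)" for n
  proof -
    interpret C: left_module k "C n" by (rule cochain_complex_module[OF C])
    have "abelian_group (D n)"
    proof (rule abelian_groupI)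
      fix u assume "u \<in> carrier (D n)"
      then obtain x where x: "x \<in> carrier (C n)" "u = \<Psi> n x" by (auto simp: D)
      then show "\<exists>v\<in>carrier (D n). v \<oplus>\<^bsub>D n\<^esub> u = \<zero>\<^bsub>D n\<^esub>"
        by (intro bexI[of _ "\<Psi> n (\<ominus>\<^bsub>C n\<^esub> x)"]) (simp_all add: D add C.M.l_neg \<Psi>(3))
    qed (auto simp: D add C.M.a_ac \<Psi>(3)[symmetric])
    moreover have "left_module_axioms k (D n)"
    proof (unfold_locales, unfold D, goal_cases)
      case (1 a x) then show ?case by (auto simp: smult C.smult_closed)
    next
      case (2 a b x) then show ?case by (auto simp: smult add C.smult_closed C.smult_l_distr)
    next
      case (3 a x y) then show ?case by (auto simp: smult add C.smult_closed C.smult_r_distr)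
    next
      case (4 a b x) then show ?case by (auto simp: smult C.smult_closed C.smult_assoc)
    next
      case (5 x) then show ?case by (auto simp: smult C.smult_one)
    qed
    ultimately show ?thesis by (simp add: left_module_def C.R.ring_axioms)
  qed
  show CD: "cochain_complex k D \<delta>'"
    unfolding cochain_complex_def
  proof (intro allI conjI ballI module)
    fix n
    interpret C: left_module k "C n" by (rule cochain_complex_module[OF C])
    interpret Dn: left_module k "D n" by (rule module)
    show "(\<lambda>x\<in>carrier (D n). \<delta>' n x) \<in> mod_hom k (D n) (D (Suc n))"
    proof (rule mod_homI)
      fix u v assume uv: "u \<in> carrier (D n)" "v \<in> carrier (D n)"
      then obtain x z where "x \<in> carrier (C n)" "u = \<Psi> n x" "z \<in> carrier (C n)" "v = \<Psi> n z" by (auto simp: D)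
      then show "(\<lambda>x\<in>carrier (D n). \<delta>' n x) (u \<oplus>\<^bsub>D n\<^esub> v) =
          (\<lambda>x\<in>carrier (D n). \<delta>' n x) u \<oplus>\<^bsub>D (Suc n)\<^esub> (\<lambda>x\<in>carrier (D n). \<delta>' n x) v"
        using Dn.M.a_closed[OF uv] uv by (simp add: add comm \<delta>c cochain_complex_add[OF C])
    next
      fix r u assume r: "r \<in> carrier k" and u: "u \<in> carrier (D n)"
      then obtain x where "x \<in> carrier (C n)" "u = \<Psi> n x" by (auto simp: D)
      then show "(\<lambda>x\<in>carrier (D n). \<delta>' n x) (r \<odot>\<^bsub>D n\<^esub> u) = r \<odot>\<^bsub>D (Suc n)\<^esub> (\<lambda>x\<in>carrier (D n). \<delta>' n x) u"
        using Dn.smult_closed[OF r u] u r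
        by (simp add: smult comm \<delta>c cochain_complex_smult[OF C] C.smult_closed)
    qed (auto simp: D comm \<delta>c)
    fix u assume "u \<in> carrier (D n)"
    then obtain x where "x \<in> carrier (C n)" "u = \<Psi> n x" by (auto simp: D)
    moreover from this have "\<delta> (Suc n) (\<delta> n x) = \<zero>\<^bsub>C (Suc (Suc n))\<^esub>"
      using C by (simp add: cochain_complex_def)
    ultimately show "\<delta>' (Suc n) (\<delta>' n u) = \<zero>\<^bsub>D (Suc (Suc n))\<^esub>" by (simp add: comm \<delta>c \<Psi>(3))
  qed
  have zero: "\<delta>' n (\<Psi> n x) = \<zero>\<^bsub>D (Suc n)\<^esub> \<longleftrightarrow> \<delta> n x = \<zero>\<^bsub>C (Suc n)\<^esub>" if "x \<in> carrier (C n)" for n x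
  proof -
    interpret C: left_module k "C (Suc n)" by (rule cochain_complex_module[OF C])
    show ?thesis using that inj[of "\<delta> n x" "Suc n" "\<zero>\<^bsub>C (Suc n)\<^esub>"] by (simp add: comm \<delta>c \<Psi>(3))
  qed
  have cob: "coboundaries D \<delta>' n = \<Psi> n ` coboundaries C \<delta> n"
  proof (cases n)
    case 0 then show ?thesis by (simp add: coboundaries_def \<Psi>(3))
  next
    case (Suc m)
    have "(\<lambda>x. \<delta>' m (\<Psi> m x)) ` carrier (C m) = (\<lambda>x. \<Psi> (Suc m) (\<delta> m x)) ` carrier (C m)"
      by (rule image_cong[OF refl comm])
    then show ?thesis by (simp add: Suc coboundaries_def D image_image)
  qed
  have sub: "coboundaries C \<delta> n \<subseteq> carrier (C n)" using coboundaries_cocycles[OF C, of n] by blast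
  show "mod_isomorphic k (cohomology C \<delta> n) (cohomology D \<delta>' n)"
  proof (rule cohomology_isomorphic[OF C CD \<Psi>(1)])
    fix x assume x: "x \<in> carrier (C n)" and "\<Psi> n x \<in> coboundaries D \<delta>' n"
    then obtain z where "z \<in> coboundaries C \<delta> n" "\<Psi> n x = \<Psi> n z" by (auto simp: cob)
    then show "x \<in> coboundaries C \<delta> n" using inj[OF x] sub by auto
  next
    fix u assume "u \<in> carrier (D n)" and u: "\<delta>' n u = \<zero>\<^bsub>D (Suc n)\<^esub>"
    then obtain x where x: "x \<in> carrier (C n)" "u = \<Psi> n x" by (auto simp: D)
    interpret C: left_module k "C n" by (rule cochain_complex_module[OF C])
    have "\<zero>\<^bsub>C n\<^esub> \<in> coboundaries C \<delta> n"
      using subgroup.one_closed[OF submodule.axioms(1)[OF coboundaries_submodule[OF C]]] by simp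
    then have "\<zero>\<^bsub>D n\<^esub> \<in> coboundaries D \<delta>' n" using \<Psi>(3) cob by (metis imageI)
    moreover have "u = \<zero>\<^bsub>D n\<^esub> \<oplus>\<^bsub>D n\<^esub> \<Psi> n x"
      using x by (simp add: add \<Psi>(3)[symmetric])
    ultimately show "\<exists>x\<in>carrier (C n). \<delta> n x = \<zero>\<^bsub>C (Suc n)\<^esub> \<and> (\<exists>b\<in>coboundaries D \<delta>' n. u = b \<oplus>\<^bsub>D n\<^esub> \<Psi> n x)"
      using u zero[OF x(1)] unfolding x(2) by (intro bexI[OF _ x(1)] conjI bexI) auto
  qed (auto simp: zero cob)
qed

locale central_ring_hom = k: ring k + S: ring S
  for k :: "('k, 'y) ring_scheme" and S :: "('s, 'z) ring_scheme" +
  fixes \<iota> :: "'k \<Rightarrow> 's"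
  assumes \<iota>_hom: "\<iota> \<in> ring_hom k S"
    and \<iota>_central: "r \<in> carrier k \<Longrightarrow> s \<in> carrier S \<Longrightarrow> \<iota> r \<otimes>\<^bsub>S\<^esub> s = s \<otimes>\<^bsub>S\<^esub> \<iota> r"
begin

lemma \<iota>_closed: "r \<in> carrier k \<Longrightarrow> \<iota> r \<in> carrier S"
  using ring_hom_closed[OF \<iota>_hom] .

lemma hom_module_left_module:
  fixes M :: "('s, 'm) module" and N :: "('s, 'n) module"
  assumes M: "left_module S M" and N: "left_module S N"
  shows "left_module k (hom_module \<iota> S M N)"
proof -
  interpret M: left_module S M by fact
  interpret N: left_module S N by fact
  let ?H = "hom_module \<iota> S M N"
  have carrier: "carrier ?H = mod_hom S M N" and zero: "\<zero>\<^bsub>?H\<^esub> = (\<lambda>x\<in>carrier M. \<zero>\<^bsub>N\<^esub>)"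
    and add: "f \<oplus>\<^bsub>?H\<^esub> g = (\<lambda>x\<in>carrier M. f x \<oplus>\<^bsub>N\<^esub> g x)"
    and smult: "r \<odot>\<^bsub>?H\<^esub> f = (\<lambda>x\<in>carrier M. \<iota> r \<odot>\<^bsub>N\<^esub> f x)" for f g r
    by (simp_all add: hom_module_def)
  note c = mod_hom_closed[of _ S M N]
  have zero_closed: "\<zero>\<^bsub>?H\<^esub> \<in> mod_hom S M N"
    by (rule mod_homI) (auto simp: zero N.smult_zero M.smult_closed)
  have add_closed: "f \<oplus>\<^bsub>?H\<^esub> g \<in> mod_hom S M N" if "f \<in> mod_hom S M N" "g \<in> mod_hom S M N" for f g
  proof (rule mod_homI)
    fix x y assume xy: "x \<in> carrier M" "y \<in> carrier M"
    then show "(f \<oplus>\<^bsub>?H\<^esub> g) (x \<oplus>\<^bsub>M\<^esub> y) = (f \<oplus>\<^bsub>?H\<^esub> g) x \<oplus>\<^bsub>N\<^esub> (f \<oplus>\<^bsub>?H\<^esub> g) y"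
      using c[OF that(1)] c[OF that(2)]
      by (simp add: add mod_hom_add[OF that(1) xy] mod_hom_add[OF that(2) xy] N.M.a_ac)
  next
    fix r x assume rx: "r \<in> carrier S" "x \<in> carrier M"
    then show "(f \<oplus>\<^bsub>?H\<^esub> g) (r \<odot>\<^bsub>M\<^esub> x) = r \<odot>\<^bsub>N\<^esub> (f \<oplus>\<^bsub>?H\<^esub> g) x"
      using c[OF that(1)] c[OF that(2)]
      by (simp add: add mod_hom_smult[OF that(1) rx] mod_hom_smult[OF that(2) rx] M.smult_closed
          N.smult_r_distr)
  qed (use c[OF that(1)] c[OF that(2)] in \<open>auto simp: add\<close>)
  have smult_closed: "r \<odot>\<^bsub>?H\<^esub> f \<in> mod_hom S M N" if r: "r \<in> carrier k" and f: "f \<in> mod_hom S M N" for r f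
  proof (rule mod_homI)
    fix x y assume xy: "x \<in> carrier M" "y \<in> carrier M"
    then show "(r \<odot>\<^bsub>?H\<^esub> f) (x \<oplus>\<^bsub>M\<^esub> y) = (r \<odot>\<^bsub>?H\<^esub> f) x \<oplus>\<^bsub>N\<^esub> (r \<odot>\<^bsub>?H\<^esub> f) y"
      using c[OF f] \<iota>_closed[OF r] by (simp add: smult mod_hom_add[OF f xy] N.smult_r_distr)
  next
    fix s x assume sx: "s \<in> carrier S" "x \<in> carrier M"
    then show "(r \<odot>\<^bsub>?H\<^esub> f) (s \<odot>\<^bsub>M\<^esub> x) = s \<odot>\<^bsub>N\<^esub> (r \<odot>\<^bsub>?H\<^esub> f) x"
      using c[OF f] \<iota>_closed[OF r] \<iota>_central[OF r sx(1)]
      by (simp add: smult mod_hom_smult[OF f sx] M.smult_closed flip: N.smult_assoc)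
  qed (use c[OF f] \<iota>_closed[OF r] N.smult_closed in \<open>auto simp: smult\<close>)
  note closed = zero_closed add_closed smult_closed
  note eqI = mod_hom_eqI[of _ S M N]
  have "abelian_group ?H"
  proof (rule abelian_groupI, unfold carrier)
    fix f assume f: "f \<in> mod_hom S M N"
    define g where "g = (\<lambda>x\<in>carrier M. \<ominus>\<^bsub>N\<^esub> f x)"
    have "g = (\<lambda>x\<in>carrier M. \<zero>\<^bsub>?H\<^esub> x \<ominus>\<^bsub>N\<^esub> f x)"
      using c[OF f] by (auto simp: g_def zero a_minus_def)
    then have "g \<in> mod_hom S M N" using mod_hom_diff_fun[OF zero_closed f M N] by simp
    moreover have "g \<oplus>\<^bsub>?H\<^esub> f = \<zero>\<^bsub>?H\<^esub>"
      using c[OF f] by (auto simp: add zero g_def N.M.l_neg)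
    ultimately show "\<exists>g\<in>mod_hom S M N. g \<oplus>\<^bsub>?H\<^esub> f = \<zero>\<^bsub>?H\<^esub>" by (intro bexI)
    show "\<zero>\<^bsub>?H\<^esub> \<oplus>\<^bsub>?H\<^esub> f = f"
      by (rule eqI[OF add_closed[OF zero_closed f] f]) (simp add: add zero c[OF f])
  next
    fix f g h assume fgh: "f \<in> mod_hom S M N" "g \<in> mod_hom S M N" "h \<in> mod_hom S M N"
    show "f \<oplus>\<^bsub>?H\<^esub> g \<oplus>\<^bsub>?H\<^esub> h = f \<oplus>\<^bsub>?H\<^esub> (g \<oplus>\<^bsub>?H\<^esub> h)"
      by (rule eqI) (simp_all add: fgh add_closed, simp add: add N.M.a_assoc fgh[THEN c])
  next
    fix f g assume fg: "f \<in> mod_hom S M N" "g \<in> mod_hom S M N"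
    show "f \<oplus>\<^bsub>?H\<^esub> g = g \<oplus>\<^bsub>?H\<^esub> f"
      by (rule eqI) (simp_all add: fg add_closed, simp add: add N.M.a_comm fg[THEN c])
  qed (fact closed)+
  moreover have "left_module_axioms k ?H"
  proof (unfold_locales, unfold carrier, goal_cases)
    case (1 a x) then show ?case by (rule closed)
  next
    case (2 a b x)
    show ?case
      by (rule eqI) (simp_all add: 2 closed, simp add: add smult 2 c[OF 2(3)] \<iota>_closed
          ring_hom_add[OF \<iota>_hom] N.smult_l_distr)
  next
    case (3 a x y)
    show ?case
      by (rule eqI) (simp_all add: 3 closed, simp add: add smult 3 c[OF 3(2)] c[OF 3(3)] \<iota>_closed
          N.smult_r_distr)
  next
    case (4 a b x)
    show ?case
      by (rule eqI) (simp_all add: 4 closed, simp add: smult 4 c[OF 4(3)] \<iota>_closed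
          ring_hom_mult[OF \<iota>_hom] N.smult_assoc)
  next
    case (5 x)
    show ?case
      by (rule eqI) (simp_all add: 5 closed, simp add: smult c[OF 5] ring_hom_one[OF \<iota>_hom] N.smult_one)
  qed
  ultimately show ?thesis by (simp add: left_module_def k.ring_axioms)
qed

lemma hom_module_precompose:
  fixes L :: "('s, 'l) module" and M :: "('s, 'm) module" and N :: "('s, 'n) module"
  assumes L: "left_module S L" and M: "left_module S M" and N: "left_module S N"
    and g: "g \<in> mod_hom S L M"
  shows "(\<lambda>\<phi>\<in>mod_hom S M N. \<lambda>x\<in>carrier L. \<phi> (g x)) \<in> mod_hom k (hom_module \<iota> S M N) (hom_module \<iota> S L N)"
    (is "?F \<in> _")
proof -
  interpret H: left_module k "hom_module \<iota> S M N" by (rule hom_module_left_module[OF M N])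
  have carrier: "carrier (hom_module \<iota> S M N) = mod_hom S M N" "carrier (hom_module \<iota> S L N) = mod_hom S L N"
    by (simp_all add: hom_module_def)
  have *: "?F \<phi> = (\<lambda>x\<in>carrier L. \<phi> (g x))" if "\<phi> \<in> mod_hom S M N" for \<phi> using that by simp
  show ?thesis
  proof (rule mod_homI, unfold carrier)
    fix \<phi> assume "\<phi> \<in> mod_hom S M N"
    then show "?F \<phi> \<in> mod_hom S L N"
      using mod_hom_compose[OF L g] unfolding compose_def by simp
  next
    fix \<phi> \<psi> assume a: "\<phi> \<in> mod_hom S M N" "\<psi> \<in> mod_hom S M N"
    then have "\<phi> \<oplus>\<^bsub>hom_module \<iota> S M N\<^esub> \<psi> \<in> mod_hom S M N"
      using H.M.a_closed unfolding carrier by simp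
    with a show "?F (\<phi> \<oplus>\<^bsub>hom_module \<iota> S M N\<^esub> \<psi>) = ?F \<phi> \<oplus>\<^bsub>hom_module \<iota> S L N\<^esub> ?F \<psi>"
      using mod_hom_closed[OF g] by (auto simp: hom_module_def)
  next
    fix r \<phi> assume a: "r \<in> carrier k" "\<phi> \<in> mod_hom S M N"
    then have "r \<odot>\<^bsub>hom_module \<iota> S M N\<^esub> \<phi> \<in> mod_hom S M N"
      using H.smult_closed unfolding carrier by simp
    with a show "?F (r \<odot>\<^bsub>hom_module \<iota> S M N\<^esub> \<phi>) = r \<odot>\<^bsub>hom_module \<iota> S L N\<^esub> ?F \<phi>"
      using mod_hom_closed[OF g] by (auto simp: hom_module_def)
  qed auto
qed

lemma hom_cochain_complex:
  fixes N :: "('s, 'n) module"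
  assumes P: "projective_resolution S M P d \<epsilon>" and N: "left_module S N"
  shows "cochain_complex k (\<lambda>n. hom_module \<iota> S (P n) N) (\<lambda>n f. \<lambda>x\<in>carrier (P (Suc n)). f (d n x))"
  unfolding cochain_complex_def
proof (intro allI conjI ballI)
  note P' = projective_resolution_module[OF P]
  fix n
  show "left_module k (hom_module \<iota> S (P n) N)" by (rule hom_module_left_module[OF P'(2) N])
  show "(\<lambda>f\<in>carrier (hom_module \<iota> S (P n) N). \<lambda>x\<in>carrier (P (Suc n)). f (d n x))
      \<in> mod_hom k (hom_module \<iota> S (P n) N) (hom_module \<iota> S (P (Suc n)) N)"
    using hom_module_precompose[OF P'(2) P'(2) N P'(3), of n] by (simp add: hom_module_def)
  fix f assume "f \<in> carrier (hom_module \<iota> S (P n) N)"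
  then have f: "f \<in> mod_hom S (P n) N" by (simp add: hom_module_def)
  have "d n (d (Suc n) x) = \<zero>\<^bsub>P n\<^esub>" if "x \<in> carrier (P (Suc (Suc n)))" for x
    using projective_resolution_boundary[OF P that] by (simp add: resolution_cycles_def)
  moreover have "f \<zero>\<^bsub>P n\<^esub> = \<zero>\<^bsub>N\<^esub>"
    by (rule mod_hom_zero[OF f left_module_abelian_group[OF P'(2)] left_module_abelian_group[OF N]])
  ultimately show "(\<lambda>x\<in>carrier (P (Suc (Suc n))). (\<lambda>x\<in>carrier (P (Suc n)). f (d n x)) (d (Suc n) x)) =
      \<zero>\<^bsub>hom_module \<iota> S (P (Suc (Suc n))) N\<^esub>"
    using mod_hom_closed[OF P'(3)[of "Suc n"]] by (auto simp: hom_module_def)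
qed

end

lemma chain_endomorphism_homotopy:
  assumes P: "projective_resolution R M P d \<epsilon>" and M: "left_module R M"
    and e: "\<And>n. e n \<in> mod_hom R (P n) (P n)" "\<And>x. x \<in> carrier (P 0) \<Longrightarrow> \<epsilon> (e 0 x) = \<epsilon> x"
      "\<And>n x. x \<in> carrier (P (Suc n)) \<Longrightarrow> d n (e (Suc n) x) = e n (d n x)"
  shows "\<exists>s. (\<forall>n. s n \<in> mod_hom R (P n) (P (Suc n))) \<and>
    (\<forall>x\<in>carrier (P 0). x = d 0 (s 0 x) \<oplus>\<^bsub>P 0\<^esub> e 0 x) \<and>
    (\<forall>n. \<forall>x\<in>carrier (P (Suc n)).
      x = d (Suc n) (s (Suc n) x) \<oplus>\<^bsub>P (Suc n)\<^esub> s n (d n x) \<oplus>\<^bsub>P (Suc n)\<^esub> e (Suc n) x)"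
proof -
  note P' = projective_resolution_module[OF P]
  note Pg = left_module_abelian_group[OF P'(2)]
  note ec = mod_hom_closed[OF e(1)] and dc = mod_hom_closed[OF P'(3)]
  define h where "h n = (\<lambda>x\<in>carrier (P n). x \<ominus>\<^bsub>P n\<^esub> e n x)" for n
  have h: "h n \<in> mod_hom R (P n) (P n)" for n
  proof -
    have "(\<lambda>x\<in>carrier (P n). (\<lambda>x\<in>carrier (P n). x) x \<ominus>\<^bsub>P n\<^esub> e n x) \<in> mod_hom R (P n) (P n)"
      by (rule mod_hom_diff_fun[OF mod_hom_id[OF P'(2)] e(1) P'(2) P'(2)])
    moreover have "(\<lambda>x\<in>carrier (P n). (\<lambda>x\<in>carrier (P n). x) x \<ominus>\<^bsub>P n\<^esub> e n x) = h n"
      by (auto simp: h_def)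
    ultimately show ?thesis by simp
  qed
  have split: "x = h n x \<oplus>\<^bsub>P n\<^esub> e n x" if "x \<in> carrier (P n)" for n x
  proof -
    interpret abelian_group "P n" by (rule Pg)
    show ?thesis using that ec[OF that] by (simp add: h_def a_minus_def a_assoc l_neg)
  qed
  have h0: "\<epsilon> (h 0 x) = \<zero>\<^bsub>M\<^esub>" if x: "x \<in> carrier (P 0)" for x
  proof -
    interpret M: left_module R M by fact
    have "\<epsilon> (h 0 x) = \<epsilon> x \<ominus>\<^bsub>M\<^esub> \<epsilon> (e 0 x)"
      using x mod_hom_minus[OF P'(4) Pg M.abelian_group_axioms x ec[OF x]] by (simp add: h_def)
    then show ?thesis
      using e(2)[OF x] mod_hom_closed[OF P'(4) x] by (simp add: a_minus_def M.M.r_neg)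
  qed
  have hS: "d n (h (Suc n) x) = h n (d n x)" if x: "x \<in> carrier (P (Suc n))" for n x
    using x mod_hom_minus[OF P'(3) Pg Pg x ec[OF x]] e(3)[OF x] dc[OF x] by (simp add: h_def)
  obtain s where s: "\<And>n. s n \<in> mod_hom R (P n) (P (Suc n))"
    "\<And>x. x \<in> carrier (P 0) \<Longrightarrow> h 0 x = d 0 (s 0 x)"
    "\<And>n x. x \<in> carrier (P (Suc n)) \<Longrightarrow> h (Suc n) x = d (Suc n) (s (Suc n) x) \<oplus>\<^bsub>P (Suc n)\<^esub> s n (d n x)"
    using null_homotopy_exists[OF P P h h0 hS] by blast
  show ?thesis
    by (intro exI[of _ s] conjI allI ballI s(1)) (simp_all only: s(2,3)[symmetric] split[symmetric])
qed

lemma cocycle_homotopic: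
  assumes P: "projective_resolution R M P d \<epsilon>" and N: "left_module R N"
    and s: "\<And>n. s n \<in> mod_hom R (P n) (P (Suc n))"
      "\<And>x. x \<in> carrier (P 0) \<Longrightarrow> x = d 0 (s 0 x) \<oplus>\<^bsub>P 0\<^esub> e 0 x"
      "\<And>n x. x \<in> carrier (P (Suc n)) \<Longrightarrow>
        x = d (Suc n) (s (Suc n) x) \<oplus>\<^bsub>P (Suc n)\<^esub> s n (d n x) \<oplus>\<^bsub>P (Suc n)\<^esub> e (Suc n) x"
    and e: "\<And>x. x \<in> carrier (P n) \<Longrightarrow> e n x \<in> carrier (P n)"
    and \<phi>: "\<phi> \<in> mod_hom R (P n) N" "\<And>x. x \<in> carrier (P (Suc n)) \<Longrightarrow> \<phi> (d n x) = \<zero>\<^bsub>N\<^esub>"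
    and x: "x \<in> carrier (P n)"
  shows "\<phi> x = (case n of 0 \<Rightarrow> \<zero>\<^bsub>N\<^esub> | Suc m \<Rightarrow> \<phi> (s m (d m x))) \<oplus>\<^bsub>N\<^esub> \<phi> (e n x)"
proof -
  note P' = projective_resolution_module[OF P]
  note dc = mod_hom_closed[OF P'(3)] and sc = mod_hom_closed[OF s(1)]
  interpret N: left_module R N by fact
  interpret Pn: abelian_group "P n" by (rule left_module_abelian_group[OF P'(2)])
  note c = mod_hom_closed[OF \<phi>(1)] and add = mod_hom_add[OF \<phi>(1)]
  show ?thesis
  proof (cases n)
    case 0
    then have "\<phi> x = \<phi> (d n (s n x)) \<oplus>\<^bsub>N\<^esub> \<phi> (e n x)"
      using s(2)[of x] x add[of "d n (s n x)" "e n x"] e[OF x] by (simp add: dc sc)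
    then show ?thesis using \<phi>(2)[OF sc[OF x]] 0 by simp
  next
    case (Suc m)
    then have "\<phi> x = \<phi> (d n (s n x)) \<oplus>\<^bsub>N\<^esub> \<phi> (s m (d m x)) \<oplus>\<^bsub>N\<^esub> \<phi> (e n x)"
      using s(3)[of x m] x add[of "d n (s n x) \<oplus>\<^bsub>P n\<^esub> s m (d m x)" "e n x"] e[OF x]
        add[of "d n (s n x)" "s m (d m x)"] Pn.a_closed[of "d n (s n x)" "s m (d m x)"]
      by (simp add: dc sc)
    then show ?thesis using \<phi>(2)[OF sc[OF x]] Suc c[of "s m (d m x)"] x by (simp add: dc sc)
  qed
qed

context central_ring_hom
begin

lemma Ext_resolution_independent:
  fixes N :: "('s, 'n) module" and P :: "nat \<Rightarrow> ('s, 'p) module" and Q :: "nat \<Rightarrow> ('s, 'q) module"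
  assumes P: "projective_resolution S M P d \<epsilon>" and Q: "projective_resolution S M Q d' \<epsilon>'"
    and M: "left_module S M" and N: "left_module S N"
  shows "mod_isomorphic k (Ext \<iota> S P d N n) (Ext \<iota> S Q d' N n)"
proof -
  note P' = projective_resolution_module[OF P] and Q' = projective_resolution_module[OF Q]
  note Pg = left_module_abelian_group[OF P'(2)] and Qg = left_module_abelian_group[OF Q'(2)]
  note dc = mod_hom_closed[OF P'(3)] and dc' = mod_hom_closed[OF Q'(3)]
  interpret N: left_module S N by fact
  obtain f where f: "\<And>n. f n \<in> mod_hom S (P n) (Q n)" "\<And>x. x \<in> carrier (P 0) \<Longrightarrow> \<epsilon>' (f 0 x) = \<epsilon> x"
      "\<And>n x. x \<in> carrier (P (Suc n)) \<Longrightarrow> d' n (f (Suc n) x) = f n (d n x)"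
    using chain_map_exists[OF P Q M] by blast
  obtain g where g: "\<And>n. g n \<in> mod_hom S (Q n) (P n)" "\<And>x. x \<in> carrier (Q 0) \<Longrightarrow> \<epsilon> (g 0 x) = \<epsilon>' x"
      "\<And>n x. x \<in> carrier (Q (Suc n)) \<Longrightarrow> d n (g (Suc n) x) = g n (d' n x)"
    using chain_map_exists[OF Q P M] by blast
  note fc = mod_hom_closed[OF f(1)] and gc = mod_hom_closed[OF g(1)]
  have "\<exists>s. (\<forall>n. s n \<in> mod_hom S (P n) (P (Suc n))) \<and>
      (\<forall>x\<in>carrier (P 0). x = d 0 (s 0 x) \<oplus>\<^bsub>P 0\<^esub> g 0 (f 0 x)) \<and>
      (\<forall>n. \<forall>x\<in>carrier (P (Suc n)). x = d (Suc n) (s (Suc n) x) \<oplus>\<^bsub>P (Suc n)\<^esub>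
        s n (d n x) \<oplus>\<^bsub>P (Suc n)\<^esub> g (Suc n) (f (Suc n) x))"
    using chain_endomorphism_homotopy[OF P M, of "\<lambda>n. compose (carrier (P n)) (g n) (f n)"]
      mod_hom_compose[OF P'(2) f(1) g(1)]
    by (simp add: compose_def f(2,3) g(2,3) fc gc dc)
  then obtain s where "\<forall>n. s n \<in> mod_hom S (P n) (P (Suc n))"
    "\<forall>x\<in>carrier (P 0). x = d 0 (s 0 x) \<oplus>\<^bsub>P 0\<^esub> g 0 (f 0 x)"
    "\<forall>n. \<forall>x\<in>carrier (P (Suc n)). x = d (Suc n) (s (Suc n) x) \<oplus>\<^bsub>P (Suc n)\<^esub>
        s n (d n x) \<oplus>\<^bsub>P (Suc n)\<^esub> g (Suc n) (f (Suc n) x)"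
    by (elim exE conjE)
  note s = this[rule_format]
  have "\<exists>t. (\<forall>n. t n \<in> mod_hom S (Q n) (Q (Suc n))) \<and>
      (\<forall>x\<in>carrier (Q 0). x = d' 0 (t 0 x) \<oplus>\<^bsub>Q 0\<^esub> f 0 (g 0 x)) \<and>
      (\<forall>n. \<forall>x\<in>carrier (Q (Suc n)). x = d' (Suc n) (t (Suc n) x) \<oplus>\<^bsub>Q (Suc n)\<^esub>
        t n (d' n x) \<oplus>\<^bsub>Q (Suc n)\<^esub> f (Suc n) (g (Suc n) x))"
    using chain_endomorphism_homotopy[OF Q M, of "\<lambda>n. compose (carrier (Q n)) (f n) (g n)"]
      mod_hom_compose[OF Q'(2) g(1) f(1)]
    by (simp add: compose_def f(2,3) g(2,3) fc gc dc')
  then obtain t where "\<forall>n. t n \<in> mod_hom S (Q n) (Q (Suc n))"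
    "\<forall>x\<in>carrier (Q 0). x = d' 0 (t 0 x) \<oplus>\<^bsub>Q 0\<^esub> f 0 (g 0 x)"
    "\<forall>n. \<forall>x\<in>carrier (Q (Suc n)). x = d' (Suc n) (t (Suc n) x) \<oplus>\<^bsub>Q (Suc n)\<^esub>
        t n (d' n x) \<oplus>\<^bsub>Q (Suc n)\<^esub> f (Suc n) (g (Suc n) x)"
    by (elim exE conjE)
  note t = this[rule_format]
  note sc = mod_hom_closed[OF s(1)] and tc = mod_hom_closed[OF t(1)]
  let ?C = "\<lambda>n. hom_module \<iota> S (P n) N" and ?D = "\<lambda>n. hom_module \<iota> S (Q n) N"
  let ?\<delta> = "\<lambda>n f. \<lambda>x\<in>carrier (P (Suc n)). f (d n x)" and ?\<delta>' = "\<lambda>n f. \<lambda>x\<in>carrier (Q (Suc n)). f (d' n x)"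
  let ?F = "\<lambda>\<phi>\<in>mod_hom S (P n) N. \<lambda>x\<in>carrier (Q n). \<phi> (g n x)"
  have C: "cochain_complex k ?C ?\<delta>" and D: "cochain_complex k ?D ?\<delta>'"
    by (rule hom_cochain_complex[OF P N] hom_cochain_complex[OF Q N])+
  have carrier: "carrier (?C n) = mod_hom S (P n) N" "carrier (?D n) = mod_hom S (Q n) N" for n
    by (simp_all add: hom_module_def)
  have zero: "?\<delta> n \<phi> = \<zero>\<^bsub>?C (Suc n)\<^esub> \<longleftrightarrow> (\<forall>x\<in>carrier (P (Suc n)). \<phi> (d n x) = \<zero>\<^bsub>N\<^esub>)"
    "?\<delta>' n \<psi> = \<zero>\<^bsub>?D (Suc n)\<^esub> \<longleftrightarrow> (\<forall>x\<in>carrier (Q (Suc n)). \<psi> (d' n x) = \<zero>\<^bsub>N\<^esub>)" for n \<phi> \<psi>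
    by (auto simp: hom_module_def restrict_def fun_eq_iff)
  have cocycle_P: "\<phi> x = (case n of 0 \<Rightarrow> \<zero>\<^bsub>N\<^esub> | Suc m \<Rightarrow> \<phi> (s m (d m x))) \<oplus>\<^bsub>N\<^esub> \<phi> (g n (f n x))"
    if "\<phi> \<in> mod_hom S (P n) N" "\<And>x. x \<in> carrier (P (Suc n)) \<Longrightarrow> \<phi> (d n x) = \<zero>\<^bsub>N\<^esub>" "x \<in> carrier (P n)" for \<phi> x
    by (rule cocycle_homotopic[where e = "\<lambda>n x. g n (f n x)", OF P N s _ that]) (assumption | rule gc fc)+
  have cocycle_Q: "\<psi> x = (case n of 0 \<Rightarrow> \<zero>\<^bsub>N\<^esub> | Suc m \<Rightarrow> \<psi> (t m (d' m x))) \<oplus>\<^bsub>N\<^esub> \<psi> (f n (g n x))"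
    if "\<psi> \<in> mod_hom S (Q n) N" "\<And>x. x \<in> carrier (Q (Suc n)) \<Longrightarrow> \<psi> (d' n x) = \<zero>\<^bsub>N\<^esub>" "x \<in> carrier (Q n)" for \<psi> x
    by (rule cocycle_homotopic[where e = "\<lambda>n x. f n (g n x)", OF Q N t _ that]) (assumption | rule gc fc)+
  show ?thesis
    unfolding Ext_def
  proof (rule cohomology_isomorphic[OF C D, where F = ?F], unfold carrier zero)
    show "?F \<in> mod_hom k (?C n) (?D n)"
      by (rule hom_module_precompose[OF Q'(2) P'(2) N g(1)])
  next
    fix \<phi> assume \<phi>: "\<phi> \<in> mod_hom S (P n) N" "\<forall>x\<in>carrier (P (Suc n)). \<phi> (d n x) = \<zero>\<^bsub>N\<^esub>"
    then show "\<forall>x\<in>carrier (Q (Suc n)). ?F \<phi> (d' n x) = \<zero>\<^bsub>N\<^esub>"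
      by (simp add: dc' g(3)[symmetric] gc)
  next
    show "?F ` coboundaries ?C ?\<delta> n \<subseteq> coboundaries ?D ?\<delta>' n"
    proof (cases n)
      case 0
      have "(\<lambda>x\<in>carrier (P 0). \<zero>\<^bsub>N\<^esub>) \<in> mod_hom S (P 0) N"
        using abelian_monoid.zero_closed[of "?C 0"] hom_module_left_module[OF P'(2)[of 0] N]
        by (simp add: hom_module_def left_module_def abelian_group_def)
      then show ?thesis unfolding 0
        by (auto simp: coboundaries_def hom_module_def gc)
    next
      case (Suc m)
      have step: "?F (?\<delta> m \<phi>) \<in> coboundaries ?D ?\<delta>' n" if \<phi>: "\<phi> \<in> mod_hom S (P m) N" for \<phi>
      proof -
        have "?\<delta> m \<phi> \<in> mod_hom S (P n) N"
          using cochain_complex_closed[OF C, of \<phi> m] \<phi> unfolding carrier Suc .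
        then have "?F (?\<delta> m \<phi>) = ?\<delta>' m (\<lambda>x\<in>carrier (Q m). \<phi> (g m x))"
          using Suc by (auto simp: gc dc' g(3))
        moreover have "(\<lambda>x\<in>carrier (Q m). \<phi> (g m x)) \<in> mod_hom S (Q m) N"
          using mod_hom_compose[OF Q'(2) g(1) \<phi>] by (simp add: compose_def)
        ultimately show ?thesis
          by (intro coboundariesI[OF Suc, of "\<lambda>x\<in>carrier (Q m). \<phi> (g m x)" ?D]) (simp_all only: carrier)
      qed
      have cob: "coboundaries ?C ?\<delta> n = ?\<delta> m ` mod_hom S (P m) N"
        by (simp only: Suc coboundaries_def nat.case carrier)
      show ?thesis
      proof (rule image_subsetI)
        fix x assume "x \<in> coboundaries ?C ?\<delta> n"
        then obtain \<phi> where \<phi>: "x = ?\<delta> m \<phi>" "\<phi> \<in> mod_hom S (P m) N" unfolding cob by (rule imageE)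
        show "?F x \<in> coboundaries ?D ?\<delta>' n" unfolding \<phi>(1) by (rule step[OF \<phi>(2)])
      qed
    qed
  next
    fix \<phi> assume \<phi>: "\<phi> \<in> mod_hom S (P n) N" "\<forall>x\<in>carrier (P (Suc n)). \<phi> (d n x) = \<zero>\<^bsub>N\<^esub>"
      and F\<phi>: "?F \<phi> \<in> coboundaries ?D ?\<delta>' n"
    note c = mod_hom_closed[OF \<phi>(1)]
    show "\<phi> \<in> coboundaries ?C ?\<delta> n"
    proof (cases n)
      case 0
      have "\<phi> x = \<zero>\<^bsub>N\<^esub>" if x: "x \<in> carrier (P n)" for x
      proof -
        have "\<phi> (g n (f n x)) = ?F \<phi> (f n x)" using \<phi>(1) x by (simp add: fc)
        also have "\<dots> = \<zero>\<^bsub>N\<^esub>" using F\<phi> fc[OF x] by (simp add: 0 coboundaries_def hom_module_def)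
        finally show ?thesis using cocycle_P[OF \<phi>(1) _ x] \<phi>(2) 0 by simp
      qed
      then have "\<phi> = \<zero>\<^bsub>?C n\<^esub>" using mod_hom_undefined[OF \<phi>(1)] by (auto simp: hom_module_def restrict_def)
      then show ?thesis by (simp add: 0 coboundaries_def)
    next
      case (Suc m)
      obtain \<psi> where \<psi>: "\<psi> \<in> mod_hom S (Q m) N" "?F \<phi> = ?\<delta>' m \<psi>"
        using F\<phi> by (auto simp: Suc coboundaries_def carrier)
      note \<psi>c = mod_hom_closed[OF \<psi>(1)]
      have A: "(\<lambda>x\<in>carrier (P m). \<phi> (s m x)) \<in> mod_hom S (P m) N" (is "?a \<in> _")
        using mod_hom_compose[OF P'(2) s(1) \<phi>(1)[unfolded Suc]] by (simp add: compose_def)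
      have B: "(\<lambda>x\<in>carrier (P m). \<psi> (f m x)) \<in> mod_hom S (P m) N" (is "?b \<in> _")
        using mod_hom_compose[OF P'(2) f(1) \<psi>(1)] by (simp add: compose_def)
      interpret H: left_module k "?C m" by (rule hom_module_left_module[OF P'(2) N])
      have AB: "?a \<oplus>\<^bsub>?C m\<^esub> ?b \<in> mod_hom S (P m) N" using H.M.a_closed[unfolded carrier, OF A B] .
      have "\<phi> x = ?\<delta> m (?a \<oplus>\<^bsub>?C m\<^esub> ?b) x" if x: "x \<in> carrier (P n)" for x
      proof -
        have "\<phi> (g n (f n x)) = ?F \<phi> (f n x)" using \<phi>(1) x by (simp add: fc)
        also have "\<dots> = \<psi> (d' m (f n x))" using fc[OF x] by (simp only: \<psi>(2)) (simp add: Suc)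
        also have "\<dots> = \<psi> (f m (d m x))" using x f(3)[of x m] by (simp add: Suc)
        finally show ?thesis using cocycle_P[OF \<phi>(1) _ x] \<phi>(2) x dc[of x m] by (simp add: Suc hom_module_def)
      qed
      then have "\<phi> = ?\<delta> m (?a \<oplus>\<^bsub>?C m\<^esub> ?b)" using mod_hom_undefined[OF \<phi>(1)] Suc by (auto simp: restrict_def)
      with AB show ?thesis
        by (intro coboundariesI[OF Suc, of "?a \<oplus>\<^bsub>?C m\<^esub> ?b" ?C]) (simp_all only: carrier)
    qed
  next
    fix \<psi> assume \<psi>: "\<psi> \<in> mod_hom S (Q n) N" "\<forall>x\<in>carrier (Q (Suc n)). \<psi> (d' n x) = \<zero>\<^bsub>N\<^esub>"
    define \<phi> where "\<phi> = (\<lambda>x\<in>carrier (P n). \<psi> (f n x))"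
    define b where "b = (\<lambda>x\<in>carrier (Q n). case n of 0 \<Rightarrow> \<zero>\<^bsub>N\<^esub> | Suc m \<Rightarrow> \<psi> (t m (d' m x)))"
    have \<phi>: "\<phi> \<in> mod_hom S (P n) N"
      using mod_hom_compose[OF P'(2) f(1) \<psi>(1)] by (simp add: compose_def \<phi>_def)
    have "\<forall>x\<in>carrier (P (Suc n)). \<phi> (d n x) = \<zero>\<^bsub>N\<^esub>"
      using \<psi>(2) by (simp add: \<phi>_def dc f(3)[symmetric] fc)
    moreover have "b \<in> coboundaries ?D ?\<delta>' n"
    proof (cases n)
      case 0 then show ?thesis by (simp add: b_def coboundaries_def hom_module_def)
    next
      case (Suc m)
      have "(\<lambda>x\<in>carrier (Q m). \<psi> (t m x)) \<in> mod_hom S (Q m) N"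
        using mod_hom_compose[OF Q'(2) t(1) \<psi>(1)[unfolded Suc]] by (simp add: compose_def)
      moreover have "b = ?\<delta>' m (\<lambda>x\<in>carrier (Q m). \<psi> (t m x))"
        using Suc dc' by (auto simp: b_def)
      ultimately show ?thesis
        by (intro coboundariesI[OF Suc, of "\<lambda>x\<in>carrier (Q m). \<psi> (t m x)" ?D]) (simp_all only: carrier)
    qed
    moreover have "\<psi> = b \<oplus>\<^bsub>?D n\<^esub> ?F \<phi>"
    proof (rule mod_hom_eqI[OF \<psi>(1)])
      interpret H: left_module k "?D n" by (rule hom_module_left_module[OF Q'(2) N])
      have "b \<in> carrier (?D n)" using \<open>b \<in> coboundaries ?D ?\<delta>' n\<close> coboundaries_cocycles[OF D, of n] by auto
      moreover have "?F \<phi> \<in> carrier (?D n)"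
        using mod_hom_closed[OF hom_module_precompose[OF Q'(2) P'(2) N g(1)]] \<phi> carrier by metis
      ultimately show "b \<oplus>\<^bsub>?D n\<^esub> ?F \<phi> \<in> mod_hom S (Q n) N" using H.M.a_closed carrier by metis
      fix x assume x: "x \<in> carrier (Q n)"
      then show "\<psi> x = (b \<oplus>\<^bsub>?D n\<^esub> ?F \<phi>) x"
        using cocycle_Q[OF \<psi>(1) _ x] \<psi>(2) \<phi> by (simp add: b_def hom_module_def) (simp add: \<phi>_def gc)
    qed
    ultimately show "\<exists>x\<in>mod_hom S (P n) N. (\<forall>xa\<in>carrier (P (Suc n)). x (d n xa) = \<zero>\<^bsub>N\<^esub>) \<and>
        (\<exists>b\<in>coboundaries ?D ?\<delta>' n. \<psi> = b \<oplus>\<^bsub>?D n\<^esub> ?F x)"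
      using \<phi> by blast
  qed
qed

end

section \<open>Modules over the algebra of a finite monoid\<close>

definition monoid_monomial ::
  "('k, 'y) ring_scheme \<Rightarrow> ('b, 'z) monoid_scheme \<Rightarrow> 'k \<Rightarrow> 'b \<Rightarrow> 'b \<Rightarrow> 'k" where
  "monoid_monomial k B r b = (\<lambda>c\<in>carrier B. if c = b then r else \<zero>\<^bsub>k\<^esub>)"

text \<open>The ring axioms of the monoid algebra come with every module over it, so they are assumed.\<close>

locale finite_monoid_algebra = B: monoid B + k: cring k + A: ring "monoid_algebra k B"
  for k :: "('k, 'y) ring_scheme" and B :: "('b, 'z) monoid_scheme" +
  assumes finite_B: "finite (carrier B)"
begin

abbreviation A where "A \<equiv> monoid_algebra k B"
abbreviation el where "el \<equiv> monoid_monomial k B"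

lemma monoid_scalar_eq: "monoid_scalar k B r = el r \<one>\<^bsub>B\<^esub>"
  by (simp add: monoid_scalar_def monoid_monomial_def)

lemma A_carrier: "carrier A = carrier B \<rightarrow>\<^sub>E carrier k"
  by (simp add: monoid_algebra_def)

lemma A_mem: "a \<in> carrier A \<Longrightarrow> b \<in> carrier B \<Longrightarrow> a b \<in> carrier k"
  by (auto simp: A_carrier)

lemma el_closed: "r \<in> carrier k \<Longrightarrow> el r b \<in> carrier A"
  by (auto simp: A_carrier monoid_monomial_def)

lemma A_one: "\<one>\<^bsub>A\<^esub> = el \<one>\<^bsub>k\<^esub> \<one>\<^bsub>B\<^esub>"
  by (simp add: monoid_scalar_eq monoid_algebra_def)

lemma A_add: "b \<in> carrier B \<Longrightarrow> (a \<oplus>\<^bsub>A\<^esub> a') b = a b \<oplus>\<^bsub>k\<^esub> a' b"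
  and A_zero: "b \<in> carrier B \<Longrightarrow> \<zero>\<^bsub>A\<^esub> b = \<zero>\<^bsub>k\<^esub>"
  by (simp_all add: monoid_algebra_def)

lemma A_mult: "b \<in> carrier B \<Longrightarrow> (a \<otimes>\<^bsub>A\<^esub> a') b =
    (\<Oplus>\<^bsub>k\<^esub>p\<in>{p \<in> carrier B \<times> carrier B. fst p \<otimes>\<^bsub>B\<^esub> snd p = b}. a (fst p) \<otimes>\<^bsub>k\<^esub> a' (snd p))"
  by (simp add: monoid_algebra_def)

lemma el_add:
  assumes "r \<in> carrier k" "s \<in> carrier k"
  shows "el (r \<oplus>\<^bsub>k\<^esub> s) b = el r b \<oplus>\<^bsub>A\<^esub> el s b"
  using assms by (auto simp: monoid_algebra_def monoid_monomial_def fun_eq_iff)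

lemma el_mult:
  assumes "r \<in> carrier k" "s \<in> carrier k" "b \<in> carrier B" "c \<in> carrier B"
  shows "el r b \<otimes>\<^bsub>A\<^esub> el s c = el (r \<otimes>\<^bsub>k\<^esub> s) (b \<otimes>\<^bsub>B\<^esub> c)"
proof
  fix g
  show "(el r b \<otimes>\<^bsub>A\<^esub> el s c) g = el (r \<otimes>\<^bsub>k\<^esub> s) (b \<otimes>\<^bsub>B\<^esub> c) g"
  proof (cases "g \<in> carrier B")
    case True
    let ?I = "{p \<in> carrier B \<times> carrier B. fst p \<otimes>\<^bsub>B\<^esub> snd p = g}"
    let ?f = "\<lambda>p. el r b (fst p) \<otimes>\<^bsub>k\<^esub> el s c (snd p)"
    have z: "?f p = \<zero>\<^bsub>k\<^esub>" if "p \<in> ?I" "p \<noteq> (b, c)" for p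
      using that assms by (auto simp: monoid_monomial_def prod_eq_iff)
    show ?thesis
    proof (cases "g = b \<otimes>\<^bsub>B\<^esub> c")
      case eq: True
      have "(\<Oplus>\<^bsub>k\<^esub>p\<in>?I. ?f p) = ?f (b, c)"
        using assms finite_B z by (intro k.finsum_single) (auto simp: eq monoid_monomial_def)
      then show ?thesis using True assms eq by (simp add: A_mult) (simp add: monoid_monomial_def)
    next
      case False
      then have "p \<noteq> (b, c)" if "p \<in> ?I" for p using that by auto
      then have "(\<Oplus>\<^bsub>k\<^esub>p\<in>?I. ?f p) = \<zero>\<^bsub>k\<^esub>"
        by (intro k.add.finprod_one_eqI z)
      then show ?thesis using True False by (simp add: A_mult) (simp add: monoid_monomial_def)
    qed
  qed (simp add: monoid_algebra_def monoid_monomial_def)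
qed

lemma A_expand:
  assumes "a \<in> carrier A" shows "(\<Oplus>\<^bsub>A\<^esub>b\<in>carrier B. el (a b) b) = a"
proof
  have cl: "(\<lambda>b. el (a b) b) \<in> carrier B \<rightarrow> carrier A" using assms el_closed A_mem by auto
  fix c show "(\<Oplus>\<^bsub>A\<^esub>b\<in>carrier B. el (a b) b) c = a c"
  proof (cases "c \<in> carrier B")
    case True
    have "(\<Oplus>\<^bsub>A\<^esub>b\<in>carrier B. el (a b) b) c = (\<Oplus>\<^bsub>k\<^esub>b\<in>carrier B. el (a b) b c)"
      by (rule additive_finsum[where e = "\<lambda>f. f c", OF A.abelian_monoid_axioms k.abelian_monoid_axioms
            _ _ _ cl]) (simp_all add: True A_mem A_zero A_add)
    also have "\<dots> = a c"
    proof -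
      have "(\<Oplus>\<^bsub>k\<^esub>b\<in>carrier B. el (a b) b c) = el (a c) c c"
        by (rule k.finsum_single[OF finite_B True]) (simp_all add: True monoid_monomial_def A_mem[OF assms])
      then show ?thesis by (simp add: True monoid_monomial_def)
    qed
    finally show ?thesis .
  next
    case False
    have "(\<Oplus>\<^bsub>A\<^esub>b\<in>carrier B. el (a b) b) \<in> carrier A" using cl by (rule A.finsum_closed)
    then have "(\<Oplus>\<^bsub>A\<^esub>b\<in>carrier B. el (a b) b) c = undefined" "a c = undefined"
      using assms False unfolding A_carrier by (blast intro: PiE_arb)+
    then show ?thesis by simp
  qed
qed

lemma mod_hom_monomialI:
  assumes M: "left_module A M" and N: "left_module A N"
    and F: "F \<in> carrier M \<rightarrow>\<^sub>E carrier N"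
    and add: "\<And>x y. x \<in> carrier M \<Longrightarrow> y \<in> carrier M \<Longrightarrow> F (x \<oplus>\<^bsub>M\<^esub> y) = F x \<oplus>\<^bsub>N\<^esub> F y"
    and el: "\<And>r b x. r \<in> carrier k \<Longrightarrow> b \<in> carrier B \<Longrightarrow> x \<in> carrier M \<Longrightarrow> F (el r b \<odot>\<^bsub>M\<^esub> x) = el r b \<odot>\<^bsub>N\<^esub> F x"
  shows "F \<in> mod_hom A M N"
proof (rule mod_homI)
  interpret M: left_module A M by fact
  interpret N: left_module A N by fact
  have F_closed: "F x \<in> carrier N" if "x \<in> carrier M" for x using F that by auto
  have zero: "F \<zero>\<^bsub>M\<^esub> = \<zero>\<^bsub>N\<^esub>"
    using add[of "\<zero>\<^bsub>M\<^esub>" "\<zero>\<^bsub>M\<^esub>"] N.M.add.l_cancel_one'[of "F \<zero>\<^bsub>M\<^esub>" "F \<zero>\<^bsub>M\<^esub>"] F_closed by simp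
  fix a x assume a: "a \<in> carrier A" and x: "x \<in> carrier M"
  have cl: "(\<lambda>b. el (a b) b) \<in> carrier B \<rightarrow> carrier A" using a el_closed A_mem by auto
  have "F (a \<odot>\<^bsub>M\<^esub> x) = F (\<Oplus>\<^bsub>M\<^esub>b\<in>carrier B. el (a b) b \<odot>\<^bsub>M\<^esub> x)"
    by (subst A_expand[OF a, symmetric], subst M.finsum_smult[OF x cl]) simp
  also have "\<dots> = (\<Oplus>\<^bsub>N\<^esub>b\<in>carrier B. F (el (a b) b \<odot>\<^bsub>M\<^esub> x))"
    using cl x by (intro additive_finsum F_closed zero add) (auto intro!: M.smult_closed M.M.abelian_monoid_axioms N.M.abelian_monoid_axioms)
  also have "\<dots> = (\<Oplus>\<^bsub>N\<^esub>b\<in>carrier B. el (a b) b \<odot>\<^bsub>N\<^esub> F x)"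
    using cl x a A_mem by (intro N.M.finsum_cong' refl) (auto simp: el intro!: N.smult_closed F_closed)
  also have "\<dots> = a \<odot>\<^bsub>N\<^esub> F x"
    by (subst (2) A_expand[OF a, symmetric], subst N.finsum_smult[OF F_closed[OF x] cl]) simp
  finally show "F (a \<odot>\<^bsub>M\<^esub> x) = a \<odot>\<^bsub>N\<^esub> F x" .
qed (use F add in auto)

lemma left_module_of_action:
  fixes M :: "('b \<Rightarrow> 'k, 'm) module" and T :: "'k \<Rightarrow> 'b \<Rightarrow> 'm \<Rightarrow> 'm"
  assumes M: "abelian_group M"
    and closed: "\<And>r b x. r \<in> carrier k \<Longrightarrow> b \<in> carrier B \<Longrightarrow> x \<in> carrier M \<Longrightarrow> T r b x \<in> carrier M"
    and add: "\<And>r b x y. r \<in> carrier k \<Longrightarrow> b \<in> carrier B \<Longrightarrow> x \<in> carrier M \<Longrightarrow> y \<in> carrier M \<Longrightarrow>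
      T r b (x \<oplus>\<^bsub>M\<^esub> y) = T r b x \<oplus>\<^bsub>M\<^esub> T r b y"
    and scalar_add: "\<And>r s b x. r \<in> carrier k \<Longrightarrow> s \<in> carrier k \<Longrightarrow> b \<in> carrier B \<Longrightarrow> x \<in> carrier M \<Longrightarrow>
      T (r \<oplus>\<^bsub>k\<^esub> s) b x = T r b x \<oplus>\<^bsub>M\<^esub> T s b x"
    and mult: "\<And>r s b c x. r \<in> carrier k \<Longrightarrow> s \<in> carrier k \<Longrightarrow> b \<in> carrier B \<Longrightarrow> c \<in> carrier B \<Longrightarrow>
      x \<in> carrier M \<Longrightarrow> T r b (T s c x) = T (r \<otimes>\<^bsub>k\<^esub> s) (b \<otimes>\<^bsub>B\<^esub> c) x"
    and one: "\<And>x. x \<in> carrier M \<Longrightarrow> T \<one>\<^bsub>k\<^esub> \<one>\<^bsub>B\<^esub> x = x"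
    and smult: "\<And>a x. a \<in> carrier A \<Longrightarrow> x \<in> carrier M \<Longrightarrow> a \<odot>\<^bsub>M\<^esub> x = (\<Oplus>\<^bsub>M\<^esub>b\<in>carrier B. T (a b) b x)"
  shows "left_module A M"
    and "\<And>r b x. r \<in> carrier k \<Longrightarrow> b \<in> carrier B \<Longrightarrow> x \<in> carrier M \<Longrightarrow> el r b \<odot>\<^bsub>M\<^esub> x = T r b x"
proof -
  interpret M: abelian_group M by fact
  have zero: "T \<zero>\<^bsub>k\<^esub> b x = \<zero>\<^bsub>M\<^esub>" if "b \<in> carrier B" "x \<in> carrier M" for b x
    using scalar_add[of "\<zero>\<^bsub>k\<^esub>" "\<zero>\<^bsub>k\<^esub>" b x] that closed[of "\<zero>\<^bsub>k\<^esub>" b x]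
      M.add.l_cancel_one'[of "T \<zero>\<^bsub>k\<^esub> b x" "T \<zero>\<^bsub>k\<^esub> b x"] by simp
  have zero': "T r b \<zero>\<^bsub>M\<^esub> = \<zero>\<^bsub>M\<^esub>" if "r \<in> carrier k" "b \<in> carrier B" for r b
    using add[of r b "\<zero>\<^bsub>M\<^esub>" "\<zero>\<^bsub>M\<^esub>"] that closed[of r b "\<zero>\<^bsub>M\<^esub>"]
      M.add.l_cancel_one'[of "T r b \<zero>\<^bsub>M\<^esub>" "T r b \<zero>\<^bsub>M\<^esub>"] by simp
  have T_closed: "T (a b) b x \<in> carrier M" if "a \<in> carrier A" "b \<in> carrier B" "x \<in> carrier M" for a b x
    using that closed A_mem by simp
  have el: "el r b \<odot>\<^bsub>M\<^esub> x = T r b x" if "r \<in> carrier k" "b \<in> carrier B" "x \<in> carrier M" for r b x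
    using that finite_B zero closed
      M.finsum_single[of "carrier B" b "\<lambda>c. T (el r b c) c x"]
    by (simp add: smult el_closed) (simp add: monoid_monomial_def)
  then show "\<And>r b x. r \<in> carrier k \<Longrightarrow> b \<in> carrier B \<Longrightarrow> x \<in> carrier M \<Longrightarrow> el r b \<odot>\<^bsub>M\<^esub> x = T r b x" .
  have smult_closed: "a \<odot>\<^bsub>M\<^esub> x \<in> carrier M" if "a \<in> carrier A" "x \<in> carrier M" for a x
    unfolding smult[OF that] using that T_closed by (intro M.finsum_closed) auto
  have "left_module_axioms A M"
  proof (unfold_locales, goal_cases)
    case (1 a x) then show ?case by (rule smult_closed)
  next
    case (2 a b x)
    have "(a \<oplus>\<^bsub>A\<^esub> b) \<odot>\<^bsub>M\<^esub> x = (\<Oplus>\<^bsub>M\<^esub>c\<in>carrier B. T (a c) c x \<oplus>\<^bsub>M\<^esub> T (b c) c x)"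
      unfolding smult[OF A.a_closed[OF 2(1,2)] 2(3)] using 2 T_closed A_mem
      by (intro M.finsum_cong' refl) (auto simp: A_add scalar_add)
    then show ?case using 2 T_closed by (simp add: M.finsum_addf smult Pi_def)
  next
    case (3 a x y)
    have "a \<odot>\<^bsub>M\<^esub> (x \<oplus>\<^bsub>M\<^esub> y) = (\<Oplus>\<^bsub>M\<^esub>c\<in>carrier B. T (a c) c x \<oplus>\<^bsub>M\<^esub> T (a c) c y)"
      unfolding smult[OF 3(1) M.a_closed[OF 3(2,3)]] using 3 T_closed A_mem
      by (intro M.finsum_cong' refl) (auto simp: add)
    then show ?case using 3 T_closed by (simp add: M.finsum_addf smult Pi_def)
  next
    case (4 a b x)
    let ?B2 = "carrier B \<times> carrier B"
    let ?f = "\<lambda>p. T (a (fst p) \<otimes>\<^bsub>k\<^esub> b (snd p)) (fst p \<otimes>\<^bsub>B\<^esub> snd p) x"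
    have f_closed: "?f p \<in> carrier M" if "p \<in> ?B2" for p
      using that 4 A_mem by (intro closed) auto
    have "(a \<otimes>\<^bsub>A\<^esub> b) \<odot>\<^bsub>M\<^esub> x = (\<Oplus>\<^bsub>M\<^esub>c\<in>carrier B. \<Oplus>\<^bsub>M\<^esub>p\<in>{p \<in> ?B2. fst p \<otimes>\<^bsub>B\<^esub> snd p = c}. ?f p)"
      unfolding smult[OF A.m_closed[OF 4(1,2)] 4(3)]
    proof (intro M.finsum_cong' refl)
      fix c assume c: "c \<in> carrier B"
      have "T ((a \<otimes>\<^bsub>A\<^esub> b) c) c x =
          (\<Oplus>\<^bsub>M\<^esub>p\<in>{p \<in> ?B2. fst p \<otimes>\<^bsub>B\<^esub> snd p = c}. T (a (fst p) \<otimes>\<^bsub>k\<^esub> b (snd p)) c x)"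
        unfolding A_mult[OF c] using 4 c A_mem
        by (intro additive_finsum[where e = "\<lambda>r. T r c x"] k.abelian_monoid_axioms M.abelian_monoid_axioms)
          (auto intro!: closed zero scalar_add)
      also have "\<dots> = (\<Oplus>\<^bsub>M\<^esub>p\<in>{p \<in> ?B2. fst p \<otimes>\<^bsub>B\<^esub> snd p = c}. ?f p)"
        using f_closed by (intro M.finsum_cong' refl) auto
      finally show "T ((a \<otimes>\<^bsub>A\<^esub> b) c) c x = (\<Oplus>\<^bsub>M\<^esub>p\<in>{p \<in> ?B2. fst p \<otimes>\<^bsub>B\<^esub> snd p = c}. ?f p)" .
    qed (use f_closed in \<open>auto intro!: M.finsum_closed\<close>)
    also have "\<dots> = (\<Oplus>\<^bsub>M\<^esub>p\<in>?B2. ?f p)"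
      using finite_B f_closed by (intro M.finsum_group) auto
    also have "\<dots> = (\<Oplus>\<^bsub>M\<^esub>c\<in>carrier B. \<Oplus>\<^bsub>M\<^esub>c'\<in>carrier B. T (a c \<otimes>\<^bsub>k\<^esub> b c') (c \<otimes>\<^bsub>B\<^esub> c') x)"
      using finite_B 4 A_mem by (intro M.finsum_cartesian closed) auto
    also have "\<dots> = (\<Oplus>\<^bsub>M\<^esub>c\<in>carrier B. T (a c) c (b \<odot>\<^bsub>M\<^esub> x))"
    proof (intro M.finsum_cong' refl)
      fix c assume c: "c \<in> carrier B"
      have "T (a c) c (b \<odot>\<^bsub>M\<^esub> x) = (\<Oplus>\<^bsub>M\<^esub>c'\<in>carrier B. T (a c) c (T (b c') c' x))"
        unfolding smult[OF 4(2,3)] using 4 c A_mem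
        by (intro additive_finsum[where e = "T (a c) c"] M.abelian_monoid_axioms)
          (auto intro!: closed zero' add)
      also have "\<dots> = (\<Oplus>\<^bsub>M\<^esub>c'\<in>carrier B. T (a c \<otimes>\<^bsub>k\<^esub> b c') (c \<otimes>\<^bsub>B\<^esub> c') x)"
        using 4 c A_mem by (intro M.finsum_cong' refl mult) (auto intro!: closed)
      finally show "(\<Oplus>\<^bsub>M\<^esub>c'\<in>carrier B. T (a c \<otimes>\<^bsub>k\<^esub> b c') (c \<otimes>\<^bsub>B\<^esub> c') x) = T (a c) c (b \<odot>\<^bsub>M\<^esub> x)" ..
    qed (use 4 smult_closed T_closed in auto)
    also have "\<dots> = a \<odot>\<^bsub>M\<^esub> (b \<odot>\<^bsub>M\<^esub> x)" by (rule smult[symmetric]) (use 4 smult_closed in auto)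
    finally show ?case .
  next
    case (5 x) then show ?case by (simp add: A_one el one)
  qed
  then show "left_module A M"
    by (simp add: left_module_def A.ring_axioms M)
qed

lemma central_ring_hom_scalar: "central_ring_hom k A (monoid_scalar k B)"
proof (intro central_ring_hom.intro central_ring_hom_axioms.intro k.ring_axioms A.ring_axioms)
  show "monoid_scalar k B \<in> ring_hom k A"
    by (rule ring_hom_memI)
      (simp_all add: monoid_scalar_eq el_closed el_add el_mult A_one)
next
  fix r s assume r: "r \<in> carrier k" and s: "s \<in> carrier A"
  have cl: "(\<lambda>b. el (s b) b) \<in> carrier B \<rightarrow> carrier A" using s el_closed A_mem by auto
  have "el r \<one>\<^bsub>B\<^esub> \<otimes>\<^bsub>A\<^esub> (\<Oplus>\<^bsub>A\<^esub>b\<in>carrier B. el (s b) b) =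
      (\<Oplus>\<^bsub>A\<^esub>b\<in>carrier B. el (s b) b) \<otimes>\<^bsub>A\<^esub> el r \<one>\<^bsub>B\<^esub>"
    unfolding A.finsum_rdistr[OF finite_B el_closed[OF r] cl] A.finsum_ldistr[OF finite_B el_closed[OF r] cl]
    using r s cl A_mem el_closed
    by (intro A.finsum_cong' refl) (auto simp: el_mult k.m_comm intro!: A.m_closed)
  then show "monoid_scalar k B r \<otimes>\<^bsub>A\<^esub> s = s \<otimes>\<^bsub>A\<^esub> monoid_scalar k B r"
    by (simp add: monoid_scalar_eq A_expand[OF s])
qed

end

section \<open>Chains in a left regular band\<close>

locale lrb_algebra = finite_monoid_algebra k B + LRB: left_regular_band_monoid B
  for k :: "('k, 'y) ring_scheme" and B :: "('b, 'z) monoid_scheme" +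
  fixes base :: 'b
  assumes base: "base \<in> carrier B"
begin

abbreviation mul :: "'b \<Rightarrow> 'b \<Rightarrow> 'b" (infixl \<open>\<cdot>\<close> 70) where "a \<cdot> b \<equiv> a \<otimes>\<^bsub>B\<^esub> b"
abbreviation unit :: 'b where "unit \<equiv> \<one>\<^bsub>B\<^esub>"

lemma regular: "a \<in> carrier B \<Longrightarrow> b \<in> carrier B \<Longrightarrow> a \<cdot> (b \<cdot> a) = a \<cdot> b"
  using LRB.left_regular[of a b] by (simp add: B.m_assoc)

lemma fixes_mult_iff:
  assumes "a \<in> carrier B" "b \<in> carrier B" "c \<in> carrier B"
  shows "a \<cdot> (b \<cdot> c) = a \<longleftrightarrow> a \<cdot> b = a \<and> a \<cdot> c = a"
proof
  assume *: "a \<cdot> (b \<cdot> c) = a"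
  have "a \<cdot> b = a \<cdot> (b \<cdot> c) \<cdot> b" using * by simp
  also have "\<dots> = a \<cdot> (b \<cdot> c)" using assms regular[of b c] by (simp add: B.m_assoc)
  finally have "a \<cdot> b = a" using * by simp
  moreover from this have "a \<cdot> c = a" using * assms by (metis B.m_assoc)
  ultimately show "a \<cdot> b = a \<and> a \<cdot> c = a" ..
next
  assume "a \<cdot> b = a \<and> a \<cdot> c = a"
  then show "a \<cdot> (b \<cdot> c) = a" using assms by (metis B.m_assoc)
qed

lemma supp_subset_iff:
  assumes "a \<in> carrier B" "b \<in> carrier B"
  shows "supp B a \<subseteq> supp B b \<longleftrightarrow> a \<cdot> b = a"
proof
  assume "supp B a \<subseteq> supp B b"
  moreover have "a \<in> supp B a" using assms LRB.idem[of a] by (auto simp: supp_def image_iff intro!: bexI[of _ a])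
  ultimately obtain c where "c \<in> carrier B" "a = c \<cdot> b" by (auto simp: supp_def)
  then show "a \<cdot> b = a" using assms LRB.idem[of b] by (simp add: B.m_assoc)
next
  assume *: "a \<cdot> b = a"
  show "supp B a \<subseteq> supp B b"
  proof
    fix c assume "c \<in> supp B a"
    then obtain e where "e \<in> carrier B" "c = e \<cdot> a" by (auto simp: supp_def)
    then have "c = (e \<cdot> a) \<cdot> b" "e \<cdot> a \<in> carrier B" using assms * by (simp_all add: B.m_assoc)
    then show "c \<in> supp B b" by (auto simp: supp_def)
  qed
qed

lemma R_le_iff: "R_le B a b \<longleftrightarrow> b \<cdot> a = a"
  by (simp add: R_le_def)

lemma R_le_antisym:
  assumes "a \<in> carrier B" "b \<in> carrier B" "R_le B a b" "R_le B b a"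
  shows "a = b"
  using assms LRB.left_regular[of a b] by (simp add: R_le_iff)

lemma R_le_trans:
  assumes "a \<in> carrier B" "b \<in> carrier B" "c \<in> carrier B" "R_le B a b" "R_le B b c"
  shows "R_le B a c"
  using assms by (metis B.m_assoc R_le_iff)

lemma R_le_refl: "a \<in> carrier B \<Longrightarrow> R_le B a a"
  by (simp add: R_le_iff LRB.idem)

lemma R_le_mult:
  assumes "a \<in> carrier B" "b \<in> carrier B" "c \<in> carrier B" "R_le B b c"
  shows "R_le B (a \<cdot> b) (a \<cdot> c)"
proof -
  have "a \<cdot> c \<cdot> (a \<cdot> b) = a \<cdot> (c \<cdot> a) \<cdot> b" using assms by (simp add: B.m_assoc)
  also have "\<dots> = a \<cdot> b" using assms by (simp add: regular B.m_assoc R_le_iff)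
  finally show ?thesis by (simp add: R_le_iff)
qed

definition flags :: "nat \<Rightarrow> 'b set set" where
  "flags n = {s. s \<subseteq> {z \<in> carrier B. base \<cdot> z = base} \<and> (\<forall>v\<in>s. \<forall>w\<in>s. R_le B v w \<or> R_le B w v) \<and>
     card s = Suc n}"

abbreviation act :: "'b \<Rightarrow> 'b set \<Rightarrow> 'b set" where "act b s \<equiv> (\<lambda>z. b \<cdot> z) ` s"

lemma flagsD:
  assumes "s \<in> flags n"
  shows "s \<subseteq> carrier B" "finite s" "card s = Suc n" "v \<in> s \<Longrightarrow> v \<in> carrier B" "v \<in> s \<Longrightarrow> base \<cdot> v = base"
    "v \<in> s \<Longrightarrow> w \<in> s \<Longrightarrow> R_le B v w \<or> R_le B w v"
  using assms finite_B by (auto simp: flags_def intro: card_ge_0_finite)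

lemma finite_flags: "finite (flags n)"
  by (rule finite_subset[of _ "Pow (carrier B)"]) (auto simp: flags_def finite_B)

lemma flags_faceI:
  assumes "s \<in> flags (Suc n)" "v \<in> s"
  shows "s - {v} \<in> flags n"
  using assms flagsD(2)[OF assms(1)] by (auto simp: flags_def)

lemma act_flags_iff:
  assumes "s \<in> flags n" "b \<in> carrier B"
  shows "act b s \<in> flags n \<longleftrightarrow> base \<cdot> b = base \<and> inj_on (\<lambda>z. b \<cdot> z) s"
proof -
  note s = flagsD[OF assms(1)]
  have "R_le B (b \<cdot> v) (b \<cdot> w) \<or> R_le B (b \<cdot> w) (b \<cdot> v)" if "v \<in> s" "w \<in> s" for v w
    using s(6)[OF that] R_le_mult[OF assms(2)] s(4) that by blast
  moreover have "base \<cdot> (b \<cdot> v) = base \<longleftrightarrow> base \<cdot> b = base" if "v \<in> s" for v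
    using fixes_mult_iff[OF base assms(2) s(4)[OF that]] s(5)[OF that] by simp
  moreover have "s \<noteq> {}" using s(3) by auto
  moreover have "card (act b s) = Suc n \<longleftrightarrow> inj_on (\<lambda>z. b \<cdot> z) s"
    using inj_on_iff_eq_card[OF s(2)] s(3) by metis
  ultimately show ?thesis
    using s(1) assms(2) unfolding flags_def by (auto simp: image_subset_iff)
qed

lemma act_mult:
  assumes "s \<subseteq> carrier B" "b \<in> carrier B" "c \<in> carrier B"
  shows "act b (act c s) = act (b \<cdot> c) s"
  unfolding image_image by (rule image_cong[OF refl]) (use assms in \<open>auto simp: B.m_assoc\<close>)

lemma act_unit: "s \<subseteq> carrier B \<Longrightarrow> act unit s = s"
  by (simp add: subset_eq)

lemma act_flags_factor:
  assumes "s \<in> flags n" "b \<in> carrier B" "c \<in> carrier B" "act b (act c s) \<in> flags n"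
  shows "act c s \<in> flags n"
proof -
  have "act (b \<cdot> c) s \<in> flags n" using assms act_mult[of s b c] flagsD(1)[OF assms(1)] by simp
  then have *: "base \<cdot> (b \<cdot> c) = base" "inj_on (\<lambda>z. b \<cdot> c \<cdot> z) s"
    using assms act_flags_iff[OF assms(1), of "b \<cdot> c"] by auto
  then have "inj_on (\<lambda>z. b \<cdot> (c \<cdot> z)) s"
    using assms flagsD(4)[OF assms(1)] by (simp add: B.m_assoc inj_on_def)
  then have "inj_on (\<lambda>z. c \<cdot> z) s" by (auto simp: inj_on_def)
  with * show ?thesis using assms act_flags_iff[OF assms(1), of c] fixes_mult_iff[OF base, of b c] by auto
qed

section \<open>The module of chains\<close>

text \<open>The basis element \<open>s\<close> is sent by \<open>b\<close> to \<open>b s\<close> if \<open>b s\<close> is again in \<^term>\<open>flags n\<close>, and to \<open>0\<close> if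
  two elements of \<open>s\<close> are identified or \<open>X \<subseteq> supp b\<close> fails.\<close>

definition chain_action :: "nat \<Rightarrow> 'k \<Rightarrow> 'b \<Rightarrow> ('b set \<Rightarrow> 'k) \<Rightarrow> 'b set \<Rightarrow> 'k" where
  "chain_action n r b f = (\<lambda>s\<in>flags n. r \<otimes>\<^bsub>k\<^esub> (\<Oplus>\<^bsub>k\<^esub>t\<in>{t \<in> flags n. act b t = s}. f t))"

definition chain_module :: "nat \<Rightarrow> ('b \<Rightarrow> 'k, 'b set \<Rightarrow> 'k) module" where
  "chain_module n = \<lparr>carrier = flags n \<rightarrow>\<^sub>E carrier k, mult = undefined, one = undefined,
     zero = (\<lambda>s\<in>flags n. \<zero>\<^bsub>k\<^esub>), add = (\<lambda>f g. \<lambda>s\<in>flags n. f s \<oplus>\<^bsub>k\<^esub> g s),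
     smult = (\<lambda>a f. \<lambda>s\<in>flags n. \<Oplus>\<^bsub>k\<^esub>b\<in>carrier B. chain_action n (a b) b f s)\<rparr>"

definition chain_basis :: "nat \<Rightarrow> 'b set \<Rightarrow> 'b set \<Rightarrow> 'k" where
  "chain_basis n s = (\<lambda>t\<in>flags n. if t = s then \<one>\<^bsub>k\<^esub> else \<zero>\<^bsub>k\<^esub>)"

lemma chain_module_carrier: "carrier (chain_module n) = flags n \<rightarrow>\<^sub>E carrier k"
  and chain_module_zero: "\<zero>\<^bsub>chain_module n\<^esub> = (\<lambda>s\<in>flags n. \<zero>\<^bsub>k\<^esub>)"
  and chain_module_add: "f \<oplus>\<^bsub>chain_module n\<^esub> g = (\<lambda>s\<in>flags n. f s \<oplus>\<^bsub>k\<^esub> g s)"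
  and chain_module_smult: "a \<odot>\<^bsub>chain_module n\<^esub> f = (\<lambda>s\<in>flags n. \<Oplus>\<^bsub>k\<^esub>b\<in>carrier B. chain_action n (a b) b f s)"
  by (simp_all add: chain_module_def)

lemma chain_module_mem: "f \<in> carrier (chain_module n) \<Longrightarrow> s \<in> flags n \<Longrightarrow> f s \<in> carrier k"
  by (auto simp: chain_module_carrier)

lemma chain_module_eqI:
  assumes "f \<in> carrier (chain_module n)" "g \<in> carrier (chain_module n)" "\<And>s. s \<in> flags n \<Longrightarrow> f s = g s"
  shows "f = g"
  using assms unfolding chain_module_carrier by (blast intro: PiE_ext)

lemma chain_basis_closed: "chain_basis n s \<in> carrier (chain_module n)"
  by (auto simp: chain_basis_def chain_module_carrier)

lemma chain_basis_eq_zero: "s \<notin> flags n \<Longrightarrow> chain_basis n s = \<zero>\<^bsub>chain_module n\<^esub>"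
  by (auto simp: chain_basis_def chain_module_zero)

lemma chain_module_group: "abelian_group (chain_module n)"
proof (rule abelian_groupI)
  let ?Q = "chain_module n"
  have cl: "f \<oplus>\<^bsub>?Q\<^esub> g \<in> carrier ?Q" if "f \<in> carrier ?Q" "g \<in> carrier ?Q" for f g
    using chain_module_mem[OF that(1)] chain_module_mem[OF that(2)]
    unfolding chain_module_add chain_module_carrier by simp
  show cl0: "\<zero>\<^bsub>?Q\<^esub> \<in> carrier ?Q" unfolding chain_module_zero chain_module_carrier by simp
  fix f assume f: "f \<in> carrier ?Q"
  note fm = chain_module_mem[OF f]
  have "(\<lambda>s\<in>flags n. \<ominus>\<^bsub>k\<^esub> f s) \<in> carrier ?Q" using fm unfolding chain_module_carrier by simp
  moreover have "(\<lambda>s\<in>flags n. \<ominus>\<^bsub>k\<^esub> f s) \<oplus>\<^bsub>?Q\<^esub> f = \<zero>\<^bsub>?Q\<^esub>"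
    unfolding chain_module_add chain_module_zero using fm by (intro restrict_ext) (simp add: k.l_neg)
  ultimately show "\<exists>g\<in>carrier ?Q. g \<oplus>\<^bsub>?Q\<^esub> f = \<zero>\<^bsub>?Q\<^esub>" by (intro bexI)
  show "\<zero>\<^bsub>?Q\<^esub> \<oplus>\<^bsub>?Q\<^esub> f = f"
    by (rule chain_module_eqI[OF cl[OF cl0 f] f]) (simp add: chain_module_add chain_module_zero fm)
  fix g assume g: "g \<in> carrier ?Q"
  note gm = chain_module_mem[OF g]
  show "f \<oplus>\<^bsub>?Q\<^esub> g \<in> carrier ?Q" by (rule cl[OF f g])
  show "f \<oplus>\<^bsub>?Q\<^esub> g = g \<oplus>\<^bsub>?Q\<^esub> f"
    unfolding chain_module_add using fm gm by (intro restrict_ext) (simp add: k.a_comm)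
  fix h assume h: "h \<in> carrier ?Q"
  show "f \<oplus>\<^bsub>?Q\<^esub> g \<oplus>\<^bsub>?Q\<^esub> h = f \<oplus>\<^bsub>?Q\<^esub> (g \<oplus>\<^bsub>?Q\<^esub> h)"
    unfolding chain_module_add using fm gm chain_module_mem[OF h]
    by (intro restrict_ext) (simp add: k.a_assoc)
qed

lemma chain_module_finsum:
  assumes "F \<in> I \<rightarrow> carrier (chain_module n)" "s \<in> flags n"
  shows "(\<Oplus>\<^bsub>chain_module n\<^esub>i\<in>I. F i) s = (\<Oplus>\<^bsub>k\<^esub>i\<in>I. F i s)"
proof -
  interpret Q: abelian_group "chain_module n" by (rule chain_module_group)
  show ?thesis
    by (rule additive_finsum[where e = "\<lambda>f. f s", OF Q.abelian_monoid_axioms k.abelian_monoid_axioms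
          _ _ _ assms(1)])
      (simp_all add: assms(2) chain_module_mem chain_module_add chain_module_zero)
qed

lemma finite_flags_Collect: "finite {t \<in> flags n. P t}"
  using finite_flags by simp

lemma chain_sum_closed:
  "f \<in> carrier (chain_module n) \<Longrightarrow> (\<Oplus>\<^bsub>k\<^esub>t\<in>{t \<in> flags n. P t}. f t) \<in> carrier k"
  by (rule k.finsum_closed) (auto intro: chain_module_mem)

lemma chain_action_closed:
  assumes "r \<in> carrier k" "f \<in> carrier (chain_module n)"
  shows "chain_action n r b f \<in> carrier (chain_module n)"
  unfolding chain_action_def chain_module_carrier using assms chain_sum_closed by simp

lemma chain_action_unit:
  assumes "r \<in> carrier k" "f \<in> carrier (chain_module n)"
  shows "chain_action n r unit f = (\<lambda>s\<in>flags n. r \<otimes>\<^bsub>k\<^esub> f s)"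
  unfolding chain_action_def
proof (rule restrict_ext)
  fix s assume s: "s \<in> flags n"
  have "{t \<in> flags n. act unit t = s} = {s}" using s act_unit flagsD(1) by auto
  then show "r \<otimes>\<^bsub>k\<^esub> (\<Oplus>\<^bsub>k\<^esub>t\<in>{t \<in> flags n. act unit t = s}. f t) = r \<otimes>\<^bsub>k\<^esub> f s"
    using chain_module_mem[OF assms(2) s] by simp
qed

lemma chain_action_basis:
  assumes "r \<in> carrier k" "b \<in> carrier B" "s \<in> flags n"
  shows "chain_action n r b (chain_basis n s) = chain_action n r unit (chain_basis n (act b s))"
  unfolding chain_action_unit[OF assms(1) chain_basis_closed]
  unfolding chain_action_def
proof (rule restrict_ext)
  fix u assume u: "u \<in> flags n"
  have "(\<Oplus>\<^bsub>k\<^esub>t\<in>{t \<in> flags n. act b t = u}. chain_basis n s t) = chain_basis n (act b s) u"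
  proof (cases "act b s = u")
    case True
    have "(\<Oplus>\<^bsub>k\<^esub>t\<in>{t \<in> flags n. act b t = u}. chain_basis n s t) = chain_basis n s s"
      by (rule k.finsum_single[OF finite_flags_Collect]) (use True assms in \<open>auto simp: chain_basis_def\<close>)
    then show ?thesis using True u assms by (simp add: chain_basis_def)
  next
    case False
    have "(\<Oplus>\<^bsub>k\<^esub>t\<in>{t \<in> flags n. act b t = u}. chain_basis n s t) = \<zero>\<^bsub>k\<^esub>"
      by (rule k.add.finprod_one_eqI) (use False in \<open>auto simp: chain_basis_def\<close>)
    then show ?thesis using False[symmetric] u by (simp add: chain_basis_def)
  qed
  then show "r \<otimes>\<^bsub>k\<^esub> (\<Oplus>\<^bsub>k\<^esub>t\<in>{t \<in> flags n. act b t = u}. chain_basis n s t) = r \<otimes>\<^bsub>k\<^esub> chain_basis n (act b s) u"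
    by simp
qed

lemma chain_module_left_module: "left_module A (chain_module n)"
  and chain_module_el:
    "r \<in> carrier k \<Longrightarrow> b \<in> carrier B \<Longrightarrow> f \<in> carrier (chain_module n) \<Longrightarrow>
      el r b \<odot>\<^bsub>chain_module n\<^esub> f = chain_action n r b f"
proof -
  let ?Q = "chain_module n"
  have add: "chain_action n r b (f \<oplus>\<^bsub>?Q\<^esub> g) = chain_action n r b f \<oplus>\<^bsub>?Q\<^esub> chain_action n r b g"
    if "r \<in> carrier k" "b \<in> carrier B" "f \<in> carrier ?Q" "g \<in> carrier ?Q" for r b f g
    unfolding chain_action_def chain_module_add
  proof (rule restrict_ext)
    fix s assume s: "s \<in> flags n"
    let ?I = "{t \<in> flags n. act b t = s}"
    have "(\<Oplus>\<^bsub>k\<^esub>t\<in>?I. (\<lambda>s\<in>flags n. f s \<oplus>\<^bsub>k\<^esub> g s) t) = (\<Oplus>\<^bsub>k\<^esub>t\<in>?I. f t \<oplus>\<^bsub>k\<^esub> g t)"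
      using that chain_module_mem by (intro k.finsum_cong' refl) auto
    also have "\<dots> = (\<Oplus>\<^bsub>k\<^esub>t\<in>?I. f t) \<oplus>\<^bsub>k\<^esub> (\<Oplus>\<^bsub>k\<^esub>t\<in>?I. g t)"
      using that chain_module_mem by (intro k.finsum_addf) auto
    finally have "r \<otimes>\<^bsub>k\<^esub> (\<Oplus>\<^bsub>k\<^esub>t\<in>?I. (\<lambda>s\<in>flags n. f s \<oplus>\<^bsub>k\<^esub> g s) t) =
        r \<otimes>\<^bsub>k\<^esub> (\<Oplus>\<^bsub>k\<^esub>t\<in>?I. f t) \<oplus>\<^bsub>k\<^esub> r \<otimes>\<^bsub>k\<^esub> (\<Oplus>\<^bsub>k\<^esub>t\<in>?I. g t)"
      using that chain_sum_closed by (simp add: k.r_distr)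
    then show "r \<otimes>\<^bsub>k\<^esub> (\<Oplus>\<^bsub>k\<^esub>t\<in>?I. (\<lambda>s\<in>flags n. f s \<oplus>\<^bsub>k\<^esub> g s) t) =
        (\<lambda>s\<in>flags n. r \<otimes>\<^bsub>k\<^esub> (\<Oplus>\<^bsub>k\<^esub>t\<in>{t \<in> flags n. act b t = s}. f t)) s \<oplus>\<^bsub>k\<^esub>
        (\<lambda>s\<in>flags n. r \<otimes>\<^bsub>k\<^esub> (\<Oplus>\<^bsub>k\<^esub>t\<in>{t \<in> flags n. act b t = s}. g t)) s"
      using s by simp
  qed
  have scalar_add: "chain_action n (r \<oplus>\<^bsub>k\<^esub> r') b f = chain_action n r b f \<oplus>\<^bsub>?Q\<^esub> chain_action n r' b f"
    if "r \<in> carrier k" "r' \<in> carrier k" "b \<in> carrier B" "f \<in> carrier ?Q" for r r' b f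
    unfolding chain_action_def chain_module_add
    using that chain_sum_closed by (intro restrict_ext) (simp add: k.l_distr)
  have mult: "chain_action n r b (chain_action n r' c f) = chain_action n (r \<otimes>\<^bsub>k\<^esub> r') (b \<cdot> c) f"
    if r: "r \<in> carrier k" "r' \<in> carrier k" and bc: "b \<in> carrier B" "c \<in> carrier B" and f: "f \<in> carrier ?Q" for r r' b c f
    unfolding chain_action_def[of n r b] chain_action_def[of n _ "b \<cdot> c"]
  proof (rule restrict_ext)
    fix u assume u: "u \<in> flags n"
    let ?J = "{t \<in> flags n. act b t = u}" and ?I = "{v \<in> flags n. act (b \<cdot> c) v = u}"
    have I: "act c v \<in> ?J" if "v \<in> ?I" for v
      using that u act_flags_factor[of v n b c] act_mult[OF flagsD(1), of v n b c] bc by auto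
    have "(\<Oplus>\<^bsub>k\<^esub>t\<in>?J. chain_action n r' c f t) = (\<Oplus>\<^bsub>k\<^esub>t\<in>?J. r' \<otimes>\<^bsub>k\<^esub> (\<Oplus>\<^bsub>k\<^esub>v\<in>{v \<in> ?I. act c v = t}. f v))"
    proof (intro k.finsum_cong' refl)
      fix t assume t: "t \<in> ?J"
      have "act (b \<cdot> c) v = u" if "v \<in> flags n" "act c v = t" for v
        using act_mult[OF flagsD(1)[OF that(1)] bc] t unfolding that(2) by simp
      then have "{v \<in> flags n. act c v = t} = {v \<in> ?I. act c v = t}" by blast
      then show "chain_action n r' c f t = r' \<otimes>\<^bsub>k\<^esub> (\<Oplus>\<^bsub>k\<^esub>v\<in>{v \<in> ?I. act c v = t}. f v)"
        using t by (simp add: chain_action_def)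
    qed (use r f chain_module_mem in \<open>auto intro!: k.m_closed k.finsum_closed\<close>)
    also have "\<dots> = r' \<otimes>\<^bsub>k\<^esub> (\<Oplus>\<^bsub>k\<^esub>t\<in>?J. \<Oplus>\<^bsub>k\<^esub>v\<in>{v \<in> ?I. act c v = t}. f v)"
      by (rule k.finsum_rdistr[symmetric, OF finite_flags_Collect r(2)])
        (use f chain_module_mem in \<open>auto intro!: k.finsum_closed\<close>)
    also have "(\<Oplus>\<^bsub>k\<^esub>t\<in>?J. \<Oplus>\<^bsub>k\<^esub>v\<in>{v \<in> ?I. act c v = t}. f v) = (\<Oplus>\<^bsub>k\<^esub>v\<in>?I. f v)"
      by (rule k.finsum_group[OF finite_flags_Collect finite_flags_Collect I])
        (use f chain_module_mem in auto)
    finally show "r \<otimes>\<^bsub>k\<^esub> (\<Oplus>\<^bsub>k\<^esub>t\<in>?J. chain_action n r' c f t) = r \<otimes>\<^bsub>k\<^esub> r' \<otimes>\<^bsub>k\<^esub> (\<Oplus>\<^bsub>k\<^esub>v\<in>?I. f v)"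
      using r chain_sum_closed[OF f] by (simp add: k.m_assoc)
  qed
  have one: "chain_action n \<one>\<^bsub>k\<^esub> unit f = f" if f: "f \<in> carrier ?Q" for f
    by (rule chain_module_eqI[OF chain_action_closed[OF k.one_closed f] f])
      (simp add: chain_action_unit[OF k.one_closed f] chain_module_mem[OF f])
  have smult: "a \<odot>\<^bsub>?Q\<^esub> f = (\<Oplus>\<^bsub>?Q\<^esub>b\<in>carrier B. chain_action n (a b) b f)"
    if a: "a \<in> carrier A" and f: "f \<in> carrier ?Q" for a f
  proof -
    interpret Q: abelian_group ?Q by (rule chain_module_group)
    have cl: "(\<lambda>b. chain_action n (a b) b f) \<in> carrier B \<rightarrow> carrier ?Q"
      using chain_action_closed A_mem[OF a] f by auto
    show ?thesis
    proof (rule chain_module_eqI)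
      show "a \<odot>\<^bsub>?Q\<^esub> f \<in> carrier ?Q"
        unfolding chain_module_smult chain_module_carrier[of n]
        using cl chain_module_mem by (auto intro!: k.finsum_closed)
      show "(\<Oplus>\<^bsub>?Q\<^esub>b\<in>carrier B. chain_action n (a b) b f) \<in> carrier ?Q" by (rule Q.finsum_closed[OF cl])
    qed (simp add: chain_module_smult chain_module_finsum[OF cl])
  qed
  note T = left_module_of_action[where T = "chain_action n", OF chain_module_group chain_action_closed
      add scalar_add mult one smult]
  show "left_module A ?Q" by (rule T(1))
  show "r \<in> carrier k \<Longrightarrow> b \<in> carrier B \<Longrightarrow> f \<in> carrier ?Q \<Longrightarrow> el r b \<odot>\<^bsub>?Q\<^esub> f = chain_action n r b f"
    by (rule T(2))
qed

section \<open>The resolution by chains\<close>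

lemma el_smult_el:
  assumes "left_module A M" "r \<in> carrier k" "s \<in> carrier k" "b \<in> carrier B" "c \<in> carrier B" "m \<in> carrier M"
  shows "el r b \<odot>\<^bsub>M\<^esub> (el s c \<odot>\<^bsub>M\<^esub> m) = el (r \<otimes>\<^bsub>k\<^esub> s) (b \<cdot> c) \<odot>\<^bsub>M\<^esub> m"
  using left_module.smult_assoc[OF assms(1) el_closed[OF assms(2)] el_closed[OF assms(3)] assms(6)]
    el_mult[OF assms(2-5)] by metis

lemma el_one_smult: "left_module A M \<Longrightarrow> m \<in> carrier M \<Longrightarrow> el \<one>\<^bsub>k\<^esub> unit \<odot>\<^bsub>M\<^esub> m = m"
  using left_module.smult_one A_one by metis

lemma el_zero_smult:
  assumes "left_module A M" "m \<in> carrier M" shows "el \<zero>\<^bsub>k\<^esub> b \<odot>\<^bsub>M\<^esub> m = \<zero>\<^bsub>M\<^esub>"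
proof -
  have "el \<zero>\<^bsub>k\<^esub> b = \<zero>\<^bsub>A\<^esub>" by (auto simp: monoid_monomial_def monoid_algebra_def)
  then show ?thesis using left_module.zero_smult[OF assms] by simp
qed

lemma el_smult_closed:
  "left_module A M \<Longrightarrow> r \<in> carrier k \<Longrightarrow> m \<in> carrier M \<Longrightarrow> el r b \<odot>\<^bsub>M\<^esub> m \<in> carrier M"
  by (rule left_module.smult_closed) (auto intro: el_closed)

lemma el_add_smult:
  assumes "left_module A M" "r \<in> carrier k" "s \<in> carrier k" "m \<in> carrier M"
  shows "el (r \<oplus>\<^bsub>k\<^esub> s) b \<odot>\<^bsub>M\<^esub> m = el r b \<odot>\<^bsub>M\<^esub> m \<oplus>\<^bsub>M\<^esub> el s b \<odot>\<^bsub>M\<^esub> m"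
  using left_module.smult_l_distr[OF assms(1) el_closed[OF assms(2)] el_closed[OF assms(3)] assms(4)]
    el_add[OF assms(2,3)] by metis

lemma el_minus_smult:
  assumes M: "left_module A M" and r: "r \<in> carrier k" and m: "m \<in> carrier M"
  shows "el (\<ominus>\<^bsub>k\<^esub> r) b \<odot>\<^bsub>M\<^esub> m = \<ominus>\<^bsub>M\<^esub> (el r b \<odot>\<^bsub>M\<^esub> m)"
proof -
  interpret M: left_module A M by fact
  have "el (\<ominus>\<^bsub>k\<^esub> r) b \<odot>\<^bsub>M\<^esub> m \<oplus>\<^bsub>M\<^esub> el r b \<odot>\<^bsub>M\<^esub> m = \<zero>\<^bsub>M\<^esub>"
    using el_add_smult[OF M k.a_inv_closed[OF r] r m, of b] r m by (simp add: k.l_neg el_zero_smult[OF M])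
  then show ?thesis
    using el_smult_closed[OF M _ m] r by (intro M.M.minus_equality[symmetric]) auto
qed

definition scalar_linear :: "('b \<Rightarrow> 'k, 'm) module \<Rightarrow> ('b \<Rightarrow> 'k, 'n) module \<Rightarrow> ('m \<Rightarrow> 'n) \<Rightarrow> bool" where
  "scalar_linear M N F \<longleftrightarrow> (\<forall>x\<in>carrier M. F x \<in> carrier N) \<and>
     (\<forall>x\<in>carrier M. \<forall>y\<in>carrier M. F (x \<oplus>\<^bsub>M\<^esub> y) = F x \<oplus>\<^bsub>N\<^esub> F y) \<and>
     (\<forall>r\<in>carrier k. \<forall>x\<in>carrier M. F (el r unit \<odot>\<^bsub>M\<^esub> x) = el r unit \<odot>\<^bsub>N\<^esub> F x)"

lemma scalar_linearD:
  assumes "scalar_linear M N F" "x \<in> carrier M"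
  shows "F x \<in> carrier N" "y \<in> carrier M \<Longrightarrow> F (x \<oplus>\<^bsub>M\<^esub> y) = F x \<oplus>\<^bsub>N\<^esub> F y"
    "r \<in> carrier k \<Longrightarrow> F (el r unit \<odot>\<^bsub>M\<^esub> x) = el r unit \<odot>\<^bsub>N\<^esub> F x"
  using assms by (auto simp: scalar_linear_def)

lemma scalar_linear_hom: "F \<in> mod_hom A M N \<Longrightarrow> scalar_linear M N F"
  using el_closed by (auto simp: scalar_linear_def mod_hom_closed mod_hom_add mod_hom_smult)

lemma scalar_linear_compose:
  "scalar_linear L M F \<Longrightarrow> scalar_linear M N G \<Longrightarrow> scalar_linear L N (\<lambda>x. G (F x))"
  by (simp add: scalar_linear_def)

lemma scalar_linear_add:
  assumes N: "left_module A N" and F: "scalar_linear M N F" "scalar_linear M N G"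
  shows "scalar_linear M N (\<lambda>x. F x \<oplus>\<^bsub>N\<^esub> G x)"
proof -
  interpret N: left_module A N by fact
  show ?thesis using F el_closed
    unfolding scalar_linear_def by (simp add: N.M.a_ac N.smult_r_distr)
qed

lemma scalar_linear_id: "scalar_linear M M (\<lambda>x. x)"
  by (simp add: scalar_linear_def)

lemma scalar_linear_zero:
  assumes M: "left_module A M" and N: "left_module A N" and F: "scalar_linear M N F"
  shows "F \<zero>\<^bsub>M\<^esub> = \<zero>\<^bsub>N\<^esub>"
proof -
  interpret M: left_module A M by fact
  interpret N: left_module A N by fact
  show ?thesis
    using scalar_linearD(3)[OF F M.M.zero_closed k.zero_closed] scalar_linearD(1)[OF F M.M.zero_closed]
    by (simp add: el_zero_smult[OF M] el_zero_smult[OF N])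
qed

lemma scalar_linear_finsum:
  assumes M: "left_module A M" and N: "left_module A N" and F: "scalar_linear M N F"
    and g: "g \<in> I \<rightarrow> carrier M"
  shows "F (\<Oplus>\<^bsub>M\<^esub>i\<in>I. g i) = (\<Oplus>\<^bsub>N\<^esub>i\<in>I. F (g i))"
proof -
  interpret M: left_module A M by fact
  interpret N: left_module A N by fact
  show ?thesis
    by (rule additive_finsum[OF M.M.abelian_monoid_axioms N.M.abelian_monoid_axioms _ _ _ g])
      (use scalar_linearD[OF F] scalar_linear_zero[OF M N F] in auto)
qed

lemma chain_el_unit_apply:
  "r \<in> carrier k \<Longrightarrow> f \<in> carrier (chain_module n) \<Longrightarrow> s \<in> flags n \<Longrightarrow>
    (el r unit \<odot>\<^bsub>chain_module n\<^esub> f) s = r \<otimes>\<^bsub>k\<^esub> f s"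
  by (simp add: chain_module_el chain_action_unit)

lemma chain_expand:
  assumes f: "f \<in> carrier (chain_module n)"
  shows "(\<Oplus>\<^bsub>chain_module n\<^esub>s\<in>flags n. el (f s) unit \<odot>\<^bsub>chain_module n\<^esub> chain_basis n s) = f"
proof (rule chain_module_eqI[OF _ f])
  let ?Q = "chain_module n"
  interpret Q: left_module A ?Q by (rule chain_module_left_module)
  have cl: "(\<lambda>s. el (f s) unit \<odot>\<^bsub>?Q\<^esub> chain_basis n s) \<in> flags n \<rightarrow> carrier ?Q"
    using el_smult_closed[OF chain_module_left_module _ chain_basis_closed] chain_module_mem[OF f] by auto
  then show "(\<Oplus>\<^bsub>?Q\<^esub>s\<in>flags n. el (f s) unit \<odot>\<^bsub>?Q\<^esub> chain_basis n s) \<in> carrier ?Q"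
    by (rule Q.M.finsum_closed)
  fix t assume t: "t \<in> flags n"
  have "(\<Oplus>\<^bsub>?Q\<^esub>s\<in>flags n. el (f s) unit \<odot>\<^bsub>?Q\<^esub> chain_basis n s) t =
      (\<Oplus>\<^bsub>k\<^esub>s\<in>flags n. (el (f s) unit \<odot>\<^bsub>?Q\<^esub> chain_basis n s) t)"
    by (rule chain_module_finsum[OF cl t])
  also have "\<dots> = (el (f t) unit \<odot>\<^bsub>?Q\<^esub> chain_basis n t) t"
    by (rule k.finsum_single[OF finite_flags t])
      (simp_all add: t chain_el_unit_apply chain_module_mem[OF f] chain_basis_closed,
        simp_all add: t chain_basis_def chain_module_mem[OF f])
  also have "\<dots> = f t"
    by (simp add: t chain_el_unit_apply chain_module_mem[OF f] chain_basis_closed)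
      (simp add: t chain_basis_def chain_module_mem[OF f])
  finally show "(\<Oplus>\<^bsub>?Q\<^esub>s\<in>flags n. el (f s) unit \<odot>\<^bsub>?Q\<^esub> chain_basis n s) t = f t" .
qed

lemma scalar_linear_expand:
  assumes N: "left_module A N" and F: "scalar_linear (chain_module n) N F" and f: "f \<in> carrier (chain_module n)"
  shows "F f = (\<Oplus>\<^bsub>N\<^esub>s\<in>flags n. el (f s) unit \<odot>\<^bsub>N\<^esub> F (chain_basis n s))"
proof -
  let ?Q = "chain_module n"
  interpret N: left_module A N by fact
  have cl: "(\<lambda>s. el (f s) unit \<odot>\<^bsub>?Q\<^esub> chain_basis n s) \<in> flags n \<rightarrow> carrier ?Q"
    using el_smult_closed[OF chain_module_left_module _ chain_basis_closed] chain_module_mem[OF f] by auto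
  have "F f = F (\<Oplus>\<^bsub>?Q\<^esub>s\<in>flags n. el (f s) unit \<odot>\<^bsub>?Q\<^esub> chain_basis n s)"
    by (simp only: chain_expand[OF f])
  also have "\<dots> = (\<Oplus>\<^bsub>N\<^esub>s\<in>flags n. F (el (f s) unit \<odot>\<^bsub>?Q\<^esub> chain_basis n s))"
    by (rule scalar_linear_finsum[OF chain_module_left_module N F cl])
  also have "\<dots> = (\<Oplus>\<^bsub>N\<^esub>s\<in>flags n. el (f s) unit \<odot>\<^bsub>N\<^esub> F (chain_basis n s))"
    using scalar_linearD[OF F chain_basis_closed] chain_module_mem[OF f]
    by (intro N.M.finsum_cong' refl) (auto intro: el_smult_closed[OF N])
  finally show ?thesis .
qed

lemma scalar_linear_eqI:
  assumes N: "left_module A N" and F: "scalar_linear (chain_module n) N F" and G: "scalar_linear (chain_module n) N G"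
    and eq: "\<And>s. s \<in> flags n \<Longrightarrow> F (chain_basis n s) = G (chain_basis n s)"
    and f: "f \<in> carrier (chain_module n)"
  shows "F f = G f"
proof -
  interpret N: left_module A N by fact
  show ?thesis
    unfolding scalar_linear_expand[OF N F f] scalar_linear_expand[OF N G f]
    using eq scalar_linearD(1)[OF G chain_basis_closed] chain_module_mem[OF f]
    by (intro N.M.finsum_cong' refl) (auto intro: el_smult_closed[OF N])
qed

lemma el_chain_basis:
  assumes "b \<in> carrier B" "s \<in> flags n"
  shows "el \<one>\<^bsub>k\<^esub> b \<odot>\<^bsub>chain_module n\<^esub> chain_basis n s = chain_basis n (act b s)"
proof -
  have "el \<one>\<^bsub>k\<^esub> b \<odot>\<^bsub>chain_module n\<^esub> chain_basis n s = el \<one>\<^bsub>k\<^esub> unit \<odot>\<^bsub>chain_module n\<^esub> chain_basis n (act b s)"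
    using assms by (simp add: chain_module_el chain_basis_closed chain_action_basis)
  then show ?thesis using el_one_smult[OF chain_module_left_module chain_basis_closed] by simp
qed

definition chain_lin :: "('b \<Rightarrow> 'k, 'm) module \<Rightarrow> nat \<Rightarrow> ('b set \<Rightarrow> 'm) \<Rightarrow> ('b set \<Rightarrow> 'k) \<Rightarrow> 'm" where
  "chain_lin M n h = (\<lambda>f\<in>carrier (chain_module n). \<Oplus>\<^bsub>M\<^esub>s\<in>flags n. el (f s) unit \<odot>\<^bsub>M\<^esub> h s)"

context
  fixes M :: "('b \<Rightarrow> 'k, 'm) module" and n :: nat and h :: "'b set \<Rightarrow> 'm"
  assumes M: "left_module A M" and h: "\<And>s. s \<in> flags n \<Longrightarrow> h s \<in> carrier M"
begin

interpretation M: left_module A M by (rule M)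

lemma chain_lin_term_closed:
  "f \<in> carrier (chain_module n) \<Longrightarrow> s \<in> flags n \<Longrightarrow> el (f s) b \<odot>\<^bsub>M\<^esub> h s \<in> carrier M"
  by (simp add: el_smult_closed[OF M] chain_module_mem h)

lemma chain_lin_basis:
  assumes s: "s \<in> flags n" shows "chain_lin M n h (chain_basis n s) = h s"
proof -
  have "(\<Oplus>\<^bsub>M\<^esub>t\<in>flags n. el (chain_basis n s t) unit \<odot>\<^bsub>M\<^esub> h t) = el (chain_basis n s s) unit \<odot>\<^bsub>M\<^esub> h s"
    by (rule M.M.finsum_single[OF finite_flags s])
      (auto simp: chain_basis_def s el_zero_smult[OF M] h intro!: el_smult_closed[OF M])
  then show ?thesis by (simp add: chain_lin_def chain_basis_closed) (simp add: chain_basis_def s el_one_smult[OF M] h)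
qed

lemma chain_lin_scalar_linear: "scalar_linear (chain_module n) M (chain_lin M n h)"
  unfolding scalar_linear_def
proof (intro conjI ballI)
  let ?Q = "chain_module n"
  interpret Q: left_module A ?Q by (rule chain_module_left_module)
  fix f assume f: "f \<in> carrier ?Q"
  show "chain_lin M n h f \<in> carrier M"
    using f chain_lin_term_closed by (auto simp: chain_lin_def intro!: M.M.finsum_closed)
  {
    fix g assume g: "g \<in> carrier ?Q"
    have "(\<Oplus>\<^bsub>M\<^esub>s\<in>flags n. el ((f \<oplus>\<^bsub>?Q\<^esub> g) s) unit \<odot>\<^bsub>M\<^esub> h s) =
        (\<Oplus>\<^bsub>M\<^esub>s\<in>flags n. el (f s) unit \<odot>\<^bsub>M\<^esub> h s \<oplus>\<^bsub>M\<^esub> el (g s) unit \<odot>\<^bsub>M\<^esub> h s)"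
      using f g chain_lin_term_closed
      by (intro M.M.finsum_cong' refl) (auto simp: chain_module_add el_add_smult[OF M] chain_module_mem h)
    also have "\<dots> = (\<Oplus>\<^bsub>M\<^esub>s\<in>flags n. el (f s) unit \<odot>\<^bsub>M\<^esub> h s) \<oplus>\<^bsub>M\<^esub> (\<Oplus>\<^bsub>M\<^esub>s\<in>flags n. el (g s) unit \<odot>\<^bsub>M\<^esub> h s)"
      using f g chain_lin_term_closed by (intro M.M.finsum_addf) auto
    finally show "chain_lin M n h (f \<oplus>\<^bsub>?Q\<^esub> g) = chain_lin M n h f \<oplus>\<^bsub>M\<^esub> chain_lin M n h g"
      using f g by (simp add: chain_lin_def)
  }
  fix r assume r: "r \<in> carrier k"
  have rf: "el r unit \<odot>\<^bsub>?Q\<^esub> f \<in> carrier ?Q" by (rule el_smult_closed[OF chain_module_left_module r f])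
  have "(\<Oplus>\<^bsub>M\<^esub>s\<in>flags n. el ((el r unit \<odot>\<^bsub>?Q\<^esub> f) s) unit \<odot>\<^bsub>M\<^esub> h s) =
      (\<Oplus>\<^bsub>M\<^esub>s\<in>flags n. el r unit \<odot>\<^bsub>M\<^esub> (el (f s) unit \<odot>\<^bsub>M\<^esub> h s))"
    using r f chain_lin_term_closed
    by (intro M.M.finsum_cong' refl)
      (auto simp: chain_el_unit_apply el_smult_el[OF M] chain_module_mem h intro: el_smult_closed[OF M])
  also have "\<dots> = el r unit \<odot>\<^bsub>M\<^esub> (\<Oplus>\<^bsub>M\<^esub>s\<in>flags n. el (f s) unit \<odot>\<^bsub>M\<^esub> h s)"
    using f chain_lin_term_closed by (intro M.smult_finsum[symmetric] el_closed r) auto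
  finally show "chain_lin M n h (el r unit \<odot>\<^bsub>?Q\<^esub> f) = el r unit \<odot>\<^bsub>M\<^esub> chain_lin M n h f"
    using f rf by (simp add: chain_lin_def)
qed

lemma chain_lin_hom:
  assumes eqv: "\<And>b s. b \<in> carrier B \<Longrightarrow> s \<in> flags n \<Longrightarrow>
    el \<one>\<^bsub>k\<^esub> b \<odot>\<^bsub>M\<^esub> h s = (if act b s \<in> flags n then h (act b s) else \<zero>\<^bsub>M\<^esub>)"
  shows "chain_lin M n h \<in> mod_hom A (chain_module n) M"
proof (rule mod_hom_monomialI[OF chain_module_left_module M])
  let ?Q = "chain_module n" and ?F = "chain_lin M n h"
  note F = chain_lin_scalar_linear
  show "?F \<in> carrier ?Q \<rightarrow>\<^sub>E carrier M"
    using scalar_linearD(1)[OF F] by (auto simp: chain_lin_def)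
  show "?F (f \<oplus>\<^bsub>?Q\<^esub> g) = ?F f \<oplus>\<^bsub>M\<^esub> ?F g" if "f \<in> carrier ?Q" "g \<in> carrier ?Q" for f g
    using scalar_linearD(2)[OF F that] .
  fix r b f assume r: "r \<in> carrier k" and b: "b \<in> carrier B" and f: "f \<in> carrier ?Q"
  have L: "scalar_linear ?Q M (\<lambda>f. ?F (el \<one>\<^bsub>k\<^esub> b \<odot>\<^bsub>?Q\<^esub> f))"
  proof -
    interpret Q: left_module A ?Q by (rule chain_module_left_module)
    have "scalar_linear ?Q ?Q (\<lambda>f. el \<one>\<^bsub>k\<^esub> b \<odot>\<^bsub>?Q\<^esub> f)"
      unfolding scalar_linear_def using b
      by (auto simp: Q.smult_r_distr el_closed el_smult_el[OF chain_module_left_module]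
          intro: el_smult_closed[OF chain_module_left_module])
    from scalar_linear_compose[OF this F] show ?thesis .
  qed
  have R: "scalar_linear ?Q M (\<lambda>f. el \<one>\<^bsub>k\<^esub> b \<odot>\<^bsub>M\<^esub> ?F f)"
  proof -
    have "scalar_linear M M (\<lambda>f. el \<one>\<^bsub>k\<^esub> b \<odot>\<^bsub>M\<^esub> f)"
      unfolding scalar_linear_def using b
      by (auto simp: M.smult_r_distr el_closed el_smult_el[OF M] intro: el_smult_closed[OF M])
    from scalar_linear_compose[OF F this] show ?thesis .
  qed
  have "?F (el \<one>\<^bsub>k\<^esub> b \<odot>\<^bsub>?Q\<^esub> f) = el \<one>\<^bsub>k\<^esub> b \<odot>\<^bsub>M\<^esub> ?F f"
  proof (rule scalar_linear_eqI[OF M L R _ f])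
    fix s assume s: "s \<in> flags n"
    show "?F (el \<one>\<^bsub>k\<^esub> b \<odot>\<^bsub>?Q\<^esub> chain_basis n s) = el \<one>\<^bsub>k\<^esub> b \<odot>\<^bsub>M\<^esub> ?F (chain_basis n s)"
      using scalar_linear_zero[OF chain_module_left_module M F]
      by (simp add: el_chain_basis[OF b s] chain_lin_basis s eqv[OF b s] chain_basis_eq_zero)
  qed
  then have "el r unit \<odot>\<^bsub>M\<^esub> ?F (el \<one>\<^bsub>k\<^esub> b \<odot>\<^bsub>?Q\<^esub> f) = el r unit \<odot>\<^bsub>M\<^esub> (el \<one>\<^bsub>k\<^esub> b \<odot>\<^bsub>M\<^esub> ?F f)" by simp
  moreover have "?F (el r unit \<odot>\<^bsub>?Q\<^esub> (el \<one>\<^bsub>k\<^esub> b \<odot>\<^bsub>?Q\<^esub> f)) = el r unit \<odot>\<^bsub>M\<^esub> ?F (el \<one>\<^bsub>k\<^esub> b \<odot>\<^bsub>?Q\<^esub> f)"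
    by (rule scalar_linearD(3)[OF F el_smult_closed[OF chain_module_left_module k.one_closed f] r])
  ultimately show "?F (el r b \<odot>\<^bsub>?Q\<^esub> f) = el r b \<odot>\<^bsub>M\<^esub> ?F f"
    using r b f scalar_linearD(1)[OF F f] by (simp add: el_smult_el[OF M] el_smult_el[OF chain_module_left_module])
qed

end

definition eps :: "nat \<Rightarrow> 'k" where "eps m = (\<ominus>\<^bsub>k\<^esub> \<one>\<^bsub>k\<^esub>) [^]\<^bsub>k\<^esub> m"

definition face_sign :: "'b set \<Rightarrow> 'b \<Rightarrow> 'k" where
  "face_sign s v = eps (card {w \<in> s. R_le B w v \<and> w \<noteq> v})"

lemma eps_closed: "eps m \<in> carrier k"
  by (simp add: eps_def)

lemma eps_0: "eps 0 = \<one>\<^bsub>k\<^esub>"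
  by (simp add: eps_def)

lemma eps_Suc: "eps (Suc m) = \<ominus>\<^bsub>k\<^esub> eps m"
  by (simp add: eps_def k.r_minus)

lemma eps_square: "eps m \<otimes>\<^bsub>k\<^esub> eps m = \<one>\<^bsub>k\<^esub>"
  by (induction m) (simp_all add: eps_0 eps_Suc eps_closed k.l_minus k.r_minus)

lemma face_sign_closed: "face_sign s v \<in> carrier k"
  by (simp add: face_sign_def eps_closed)

definition boundary :: "nat \<Rightarrow> 'b set \<Rightarrow> 'b set \<Rightarrow> 'k" where
  "boundary n s = (\<Oplus>\<^bsub>chain_module n\<^esub>v\<in>s. el (face_sign s v) unit \<odot>\<^bsub>chain_module n\<^esub> chain_basis n (s - {v}))"

lemma signed_basis_closed:
  "r \<in> carrier k \<Longrightarrow> el r b \<odot>\<^bsub>chain_module n\<^esub> chain_basis n s \<in> carrier (chain_module n)"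
  by (rule el_smult_closed[OF chain_module_left_module _ chain_basis_closed])

lemma boundary_closed: "boundary n s \<in> carrier (chain_module n)"
proof -
  interpret Q: left_module A "chain_module n" by (rule chain_module_left_module)
  show ?thesis unfolding boundary_def
    by (rule Q.M.finsum_closed) (simp add: signed_basis_closed face_sign_closed)
qed

lemma el_boundary:
  assumes b: "b \<in> carrier B" and s: "s \<in> flags (Suc n)"
  shows "el \<one>\<^bsub>k\<^esub> b \<odot>\<^bsub>chain_module n\<^esub> boundary n s =
    (\<Oplus>\<^bsub>chain_module n\<^esub>v\<in>s. el (face_sign s v) unit \<odot>\<^bsub>chain_module n\<^esub> chain_basis n (act b (s - {v})))"
proof -
  let ?Q = "chain_module n"
  interpret Q: left_module A ?Q by (rule chain_module_left_module)
  have "el \<one>\<^bsub>k\<^esub> b \<odot>\<^bsub>?Q\<^esub> (el (face_sign s v) unit \<odot>\<^bsub>?Q\<^esub> chain_basis n (s - {v})) =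
      el (face_sign s v) unit \<odot>\<^bsub>?Q\<^esub> chain_basis n (act b (s - {v}))" if "v \<in> s" for v
  proof -
    have "el \<one>\<^bsub>k\<^esub> b \<odot>\<^bsub>?Q\<^esub> (el (face_sign s v) unit \<odot>\<^bsub>?Q\<^esub> chain_basis n (s - {v})) =
        el (face_sign s v) unit \<odot>\<^bsub>?Q\<^esub> (el \<one>\<^bsub>k\<^esub> b \<odot>\<^bsub>?Q\<^esub> chain_basis n (s - {v}))"
      using b by (simp add: el_smult_el[OF chain_module_left_module] face_sign_closed chain_basis_closed)
    then show ?thesis by (simp only: el_chain_basis[OF b flags_faceI[OF s that]])
  qed
  then show ?thesis unfolding boundary_def
    by (subst Q.smult_finsum[OF el_closed[OF k.one_closed]])
      (auto simp: signed_basis_closed face_sign_closed intro!: Q.M.finsum_cong')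
qed

lemma chain_zero: "r \<in> carrier k \<Longrightarrow> s \<notin> flags n \<Longrightarrow>
    el r b \<odot>\<^bsub>chain_module n\<^esub> chain_basis n s = \<zero>\<^bsub>chain_module n\<^esub>"
  using left_module.smult_zero[OF chain_module_left_module el_closed] by (simp add: chain_basis_eq_zero)

lemma act_strict_iff:
  assumes s: "s \<in> flags m" and b: "b \<in> carrier B" and inj: "inj_on (\<lambda>z. b \<cdot> z) s" and vw: "v \<in> s" "w \<in> s"
  shows "R_le B (b \<cdot> w) (b \<cdot> v) \<and> b \<cdot> w \<noteq> b \<cdot> v \<longleftrightarrow> R_le B w v \<and> w \<noteq> v"
proof -
  have c: "v \<in> carrier B" "w \<in> carrier B" using flagsD(4)[OF s] vw by auto
  have eq: "b \<cdot> w = b \<cdot> v \<longleftrightarrow> w = v" using inj_on_eq_iff[OF inj vw(2,1)] .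
  have "R_le B w v" if "R_le B (b \<cdot> w) (b \<cdot> v)" "w \<noteq> v"
  proof (rule ccontr)
    assume "\<not> R_le B w v"
    then have "R_le B v w" using flagsD(6)[OF s vw] by auto
    then have "R_le B (b \<cdot> v) (b \<cdot> w)" using R_le_mult[OF b c(1) c(2)] by simp
    then have "b \<cdot> v = b \<cdot> w" using R_le_antisym that(1) b c by simp
    then show False using eq that(2) by simp
  qed
  then show ?thesis using eq R_le_mult[OF b c(2) c(1)] by auto
qed

lemma face_sign_act:
  assumes s: "s \<in> flags m" and b: "b \<in> carrier B" and inj: "inj_on (\<lambda>z. b \<cdot> z) s" and v: "v \<in> s"
  shows "face_sign (act b s) (b \<cdot> v) = face_sign s v"
proof -
  have "{w \<in> s. R_le B (b \<cdot> w) (b \<cdot> v) \<and> b \<cdot> w \<noteq> b \<cdot> v} = {w \<in> s. R_le B w v \<and> w \<noteq> v}"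
    by (intro Collect_cong conj_cong refl act_strict_iff[OF s b inj v])
  moreover have "{w \<in> act b s. R_le B w (b \<cdot> v) \<and> w \<noteq> b \<cdot> v} =
      act b {w \<in> s. R_le B (b \<cdot> w) (b \<cdot> v) \<and> b \<cdot> w \<noteq> b \<cdot> v}" by auto
  moreover have "card (act b {w \<in> s. R_le B w v \<and> w \<noteq> v}) = card {w \<in> s. R_le B w v \<and> w \<noteq> v}"
    by (rule card_image) (rule inj_on_subset[OF inj], auto)
  ultimately show ?thesis by (simp add: face_sign_def)
qed

text \<open>If multiplication by \<open>b\<close> identifies two vertices of \<open>s\<close>, then at most the two faces omitting one
  of them survive; these two vertices are then adjacent in \<open>s\<close> and the terms cancel.\<close>

lemma degenerate_boundary:
  assumes b: "b \<in> carrier B" and s: "s \<in> flags (Suc n)"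
    and vw: "v \<in> s" "w \<in> s" "v \<noteq> w" "b \<cdot> v = b \<cdot> w"
  shows "el \<one>\<^bsub>k\<^esub> b \<odot>\<^bsub>chain_module n\<^esub> boundary n s = \<zero>\<^bsub>chain_module n\<^esub>"
proof -
  let ?Q = "chain_module n"
  interpret Q: left_module A ?Q by (rule chain_module_left_module)
  define g where "g u = el (face_sign s u) unit \<odot>\<^bsub>?Q\<^esub> chain_basis n (act b (s - {u}))" for u
  have g_closed: "g u \<in> carrier ?Q" for u by (simp add: g_def signed_basis_closed face_sign_closed)
  have g_zero: "g u = \<zero>\<^bsub>?Q\<^esub>" if u: "u \<in> s" and n: "\<not> inj_on (\<lambda>z. b \<cdot> z) (s - {u})" for u
    using act_flags_iff[OF flags_faceI[OF s u] b] n by (simp add: g_def chain_zero face_sign_closed)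
  have main: "g v \<oplus>\<^bsub>?Q\<^esub> g w = \<zero>\<^bsub>?Q\<^esub>"
    if vw: "v \<in> s" "w \<in> s" "v \<noteq> w" "b \<cdot> v = b \<cdot> w" "R_le B v w" for v w
  proof -
    have "act b s = act b (insert v (s - {v}))" "act b s = act b (insert w (s - {w}))"
      using vw by (simp_all add: insert_absorb)
    moreover have "b \<cdot> v \<in> act b (s - {v})" unfolding vw(4) by (rule imageI) (use vw in auto)
    moreover have "b \<cdot> w \<in> act b (s - {w})" unfolding vw(4)[symmetric] by (rule imageI) (use vw in auto)
    ultimately have eq: "act b (s - {v}) = act b (s - {w})" by (metis image_insert insert_absorb)
    show ?thesis
    proof (cases "inj_on (\<lambda>z. b \<cdot> z) (s - {v})")
      case False
      then have "act b (s - {v}) \<notin> flags n" using act_flags_iff[OF flags_faceI[OF s vw(1)] b] by simp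
      then show ?thesis using eq by (simp add: g_def chain_zero face_sign_closed)
    next
      case inj: True
      have c: "v \<in> carrier B" "w \<in> carrier B" using flagsD(4)[OF s] vw by auto
      have "R_le B u w \<and> u \<noteq> w \<longleftrightarrow> R_le B u v" if u: "u \<in> s" for u
      proof
        have uc: "u \<in> carrier B" using flagsD(4)[OF s u] .
        {
          assume uw: "R_le B u w \<and> u \<noteq> w"
          show "R_le B u v"
          proof (rule ccontr)
            assume n: "\<not> R_le B u v"
            then have "R_le B v u" "u \<noteq> v" using flagsD(6)[OF s u vw(1)] R_le_refl uc by auto
            then have "R_le B (b \<cdot> w) (b \<cdot> u)" using R_le_mult[OF b c(1) uc] vw(4) by simp
            moreover have "R_le B (b \<cdot> u) (b \<cdot> w)" using R_le_mult[OF b uc c(2)] uw by simp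
            ultimately have "b \<cdot> u = b \<cdot> w" using R_le_antisym b uc c by simp
            then show False using inj_onD[OF inj, of u w] u vw uw \<open>u \<noteq> v\<close> by auto
          qed
        }
        assume uv: "R_le B u v"
        then have "R_le B u w" using R_le_trans[OF uc c] vw(5) by simp
        moreover have "u \<noteq> w" using uv vw(3,5) R_le_antisym c by auto
        ultimately show "R_le B u w \<and> u \<noteq> w" ..
      qed
      then have "{u \<in> s. R_le B u w \<and> u \<noteq> w} = insert v {u \<in> s. R_le B u v \<and> u \<noteq> v}"
        using vw(1) R_le_refl[OF c(1)] by blast
      then have "face_sign s w = \<ominus>\<^bsub>k\<^esub> face_sign s v"
        using flagsD(2)[OF s] by (simp add: face_sign_def eps_Suc)
      then have "g w = \<ominus>\<^bsub>?Q\<^esub> g v"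
        unfolding g_def eq
        by (simp add: el_minus_smult[OF chain_module_left_module] face_sign_closed chain_basis_closed)
      then show ?thesis using g_closed by (simp add: Q.M.r_neg)
    qed
  qed
  have "g v \<oplus>\<^bsub>?Q\<^esub> g w = \<zero>\<^bsub>?Q\<^esub>"
  proof (cases "R_le B v w")
    case True then show ?thesis by (rule main[OF vw])
  next
    case False
    then have "R_le B w v" using flagsD(6)[OF s vw(1,2)] by simp
    from main[OF vw(2,1) vw(3)[symmetric] vw(4)[symmetric] this] show ?thesis
      using Q.M.a_comm[OF g_closed g_closed] by simp
  qed
  moreover have "(\<Oplus>\<^bsub>?Q\<^esub>u\<in>s. g u) = g v \<oplus>\<^bsub>?Q\<^esub> (g w \<oplus>\<^bsub>?Q\<^esub> (\<Oplus>\<^bsub>?Q\<^esub>u\<in>s - {v, w}. g u))"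
  proof -
    have "s = insert v (insert w (s - {v, w}))" using vw by auto
    then have "(\<Oplus>\<^bsub>?Q\<^esub>u\<in>s. g u) = (\<Oplus>\<^bsub>?Q\<^esub>u\<in>insert v (insert w (s - {v, w})). g u)" by simp
    then show ?thesis using flagsD(2)[OF s] vw(3) g_closed by simp
  qed
  moreover have "(\<Oplus>\<^bsub>?Q\<^esub>u\<in>s - {v, w}. g u) = \<zero>\<^bsub>?Q\<^esub>"
  proof (rule Q.M.add.finprod_one_eqI)
    fix u assume u: "u \<in> s - {v, w}"
    then have "\<not> inj_on (\<lambda>z. b \<cdot> z) (s - {u})" using vw by (auto simp: inj_on_def)
    then show "g u = \<zero>\<^bsub>?Q\<^esub>" using g_zero u by simp
  qed
  ultimately have "(\<Oplus>\<^bsub>?Q\<^esub>u\<in>s. g u) = \<zero>\<^bsub>?Q\<^esub>" using g_closed by simp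
  then show ?thesis unfolding el_boundary[OF b s] g_def .
qed

lemma boundary_equivariant:
  assumes b: "b \<in> carrier B" and s: "s \<in> flags (Suc n)"
  shows "el \<one>\<^bsub>k\<^esub> b \<odot>\<^bsub>chain_module n\<^esub> boundary n s =
    (if act b s \<in> flags (Suc n) then boundary n (act b s) else \<zero>\<^bsub>chain_module n\<^esub>)"
proof -
  let ?Q = "chain_module n"
  interpret Q: left_module A ?Q by (rule chain_module_left_module)
  consider (inj) "act b s \<in> flags (Suc n)" "base \<cdot> b = base" "inj_on (\<lambda>z. b \<cdot> z) s"
    | (degenerate) "act b s \<notin> flags (Suc n)" "\<not> inj_on (\<lambda>z. b \<cdot> z) s"
    | (support) "act b s \<notin> flags (Suc n)" "base \<cdot> b \<noteq> base"
    using act_flags_iff[OF s b] by blast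
  then show ?thesis
  proof cases
    case inj
    have "boundary n (act b s) = (\<Oplus>\<^bsub>?Q\<^esub>v\<in>s. el (face_sign (act b s) (b \<cdot> v)) unit \<odot>\<^bsub>?Q\<^esub> chain_basis n (act b s - {b \<cdot> v}))"
      unfolding boundary_def
      by (rule Q.M.finsum_reindex[OF _ inj(3)]) (simp add: signed_basis_closed face_sign_closed)
    also have "\<dots> = (\<Oplus>\<^bsub>?Q\<^esub>v\<in>s. el (face_sign s v) unit \<odot>\<^bsub>?Q\<^esub> chain_basis n (act b (s - {v})))"
    proof (intro Q.M.finsum_cong' refl)
      fix v assume v: "v \<in> s"
      have "act b (s - {v}) = act b s - {b \<cdot> v}"
        using inj_on_image_set_diff[OF inj(3), of s "{v}"] v by auto
      then show "el (face_sign (act b s) (b \<cdot> v)) unit \<odot>\<^bsub>?Q\<^esub> chain_basis n (act b s - {b \<cdot> v}) =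
          el (face_sign s v) unit \<odot>\<^bsub>?Q\<^esub> chain_basis n (act b (s - {v}))"
        using face_sign_act[OF s b inj(3) v] by simp
    qed (simp add: signed_basis_closed face_sign_closed)
    finally show ?thesis using inj(1) el_boundary[OF b s] by simp
  next
    case degenerate
    then show ?thesis using degenerate_boundary[OF b s] by (auto simp: inj_on_def)
  next
    case support
    have "(\<Oplus>\<^bsub>?Q\<^esub>v\<in>s. el (face_sign s v) unit \<odot>\<^bsub>?Q\<^esub> chain_basis n (act b (s - {v}))) = \<zero>\<^bsub>?Q\<^esub>"
      using act_flags_iff[OF flags_faceI[OF s] b] support(2)
      by (intro Q.M.add.finprod_one_eqI) (simp add: chain_zero face_sign_closed)
    then show ?thesis using support(1) el_boundary[OF b s] by simp
  qed
qed

definition differential :: "nat \<Rightarrow> ('b set \<Rightarrow> 'k) \<Rightarrow> 'b set \<Rightarrow> 'k" where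
  "differential n = chain_lin (chain_module n) (Suc n) (boundary n)"

lemma differential_hom: "differential n \<in> mod_hom A (chain_module (Suc n)) (chain_module n)"
  unfolding differential_def
  by (rule chain_lin_hom[OF chain_module_left_module boundary_closed boundary_equivariant])

lemma differential_basis: "s \<in> flags (Suc n) \<Longrightarrow> differential n (chain_basis (Suc n) s) = boundary n s"
  unfolding differential_def by (rule chain_lin_basis[OF chain_module_left_module boundary_closed])

lemma unit_R_le: "v \<in> carrier B \<Longrightarrow> R_le B v unit"
  by (simp add: R_le_iff)

lemma R_le_unit_iff: "v \<in> carrier B \<Longrightarrow> R_le B unit v \<longleftrightarrow> v = unit"
  by (auto simp: R_le_iff)

lemma flags_insert_unit:
  assumes "s \<in> flags n" "unit \<notin> s"
  shows "insert unit s \<in> flags (Suc n)"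
proof -
  note f = flagsD[OF assms(1)]
  have "R_le B v w \<or> R_le B w v" if "v \<in> insert unit s" "w \<in> insert unit s" for v w
  proof (cases "v = unit \<or> w = unit")
    case True
    then show ?thesis using that f(4) unit_R_le by auto
  next
    case False
    then show ?thesis using that f(6) by simp
  qed
  then show ?thesis using f(1,2,3,5) assms(2) base by (auto simp: flags_def)
qed

lemma flags_top:
  assumes s: "s \<in> flags n"
  shows "\<exists>z\<in>s. \<forall>w\<in>s. R_le B w z"
proof -
  have "\<exists>z\<in>t. \<forall>w\<in>t. R_le B w z" if "finite t" "t \<noteq> {}" "t \<subseteq> s" for t
    using that
  proof (induction t rule: finite_ne_induct)
    case (singleton v)
    then have "v \<in> carrier B" using flagsD(4)[OF s] by simp
    then show ?case using R_le_refl[of v] by simp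
  next
    case (insert v t)
    then obtain z where z: "z \<in> t" "\<forall>w\<in>t. R_le B w z" by auto
    have vz: "v \<in> s" "z \<in> s" and t: "\<And>w. w \<in> t \<Longrightarrow> w \<in> s" using insert.prems z by auto
    note c = flagsD(4)[OF s]
    show ?case
    proof (cases "R_le B v z")
      case True then show ?thesis using z by (intro bexI[of _ z]) auto
    next
      case False
      then have "R_le B z v" using flagsD(6)[OF s vz] by simp
      then have "R_le B w v" if "w \<in> t" for w
        using R_le_trans[OF c[OF t[OF that]] c[OF vz(2)] c[OF vz(1)]] z(2) that by simp
      then show ?thesis using R_le_refl[OF c[OF vz(1)]] by (intro bexI[of _ v]) auto
    qed
  qed
  moreover have "s \<noteq> {}" using flagsD(3)[OF s] by auto
  ultimately show ?thesis using flagsD(2)[OF s] by blast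
qed

text \<open>Replace the largest element of \<open>s\<close> by \<open>1\<close>.\<close>

lemma flags_translate:
  assumes s: "s \<in> flags n"
  shows "\<exists>z t. z \<in> carrier B \<and> t \<in> flags n \<and> unit \<in> t \<and> act z t = s"
proof (cases "unit \<in> s")
  case True
  then show ?thesis using s act_unit[OF flagsD(1)[OF s]] by blast
next
  case False
  obtain z where z: "z \<in> s" "\<forall>w\<in>s. R_le B w z" using flags_top[OF s] by blast
  note f = flagsD[OF s]
  let ?t = "insert unit (s - {z})"
  have "R_le B v w \<or> R_le B w v" if "v \<in> ?t" "w \<in> ?t" for v w
  proof (cases "v = unit \<or> w = unit")
    case True
    then show ?thesis using that f(4) unit_R_le by auto
  next
    case False
    then show ?thesis using that f(6) by simp
  qed
  moreover have "card ?t = Suc n" using f(2,3) z(1) False by (simp add: card_Suc_Diff1)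
  ultimately have "?t \<in> flags n" using f(1,5) base by (auto simp: flags_def)
  moreover have "act z ?t = s"
  proof -
    have "z \<cdot> w = w" if "w \<in> s" for w using z(2) that by (simp add: R_le_iff)
    then have "act z (s - {z}) = (\<lambda>w. w) ` (s - {z})" by (intro image_cong) auto
    then have "act z (s - {z}) = s - {z}" by simp
    then show ?thesis using z(1) f(4)[OF z(1)] by auto
  qed
  ultimately show ?thesis using f(4)[OF z(1)] by blast
qed

lemma chain_hom_vanishes:
  assumes M: "left_module A M" and F: "F \<in> mod_hom A (chain_module n) M"
    and zero: "\<And>s. s \<in> flags n \<Longrightarrow> unit \<in> s \<Longrightarrow> F (chain_basis n s) = \<zero>\<^bsub>M\<^esub>"
    and f: "f \<in> carrier (chain_module n)"
  shows "F f = \<zero>\<^bsub>M\<^esub>"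
proof -
  interpret M: left_module A M by fact
  have "F (chain_basis n s) = \<zero>\<^bsub>M\<^esub>" if s: "s \<in> flags n" for s
  proof -
    obtain z t where t: "z \<in> carrier B" "t \<in> flags n" "unit \<in> t" "act z t = s"
      using flags_translate[OF s] by blast
    have "chain_basis n s = el \<one>\<^bsub>k\<^esub> z \<odot>\<^bsub>chain_module n\<^esub> chain_basis n t"
      using el_chain_basis[OF t(1,2)] t(4) by simp
    then show ?thesis
      using mod_hom_smult[OF F el_closed[OF k.one_closed] chain_basis_closed] zero[OF t(2,3)]
        M.smult_zero[OF el_closed[OF k.one_closed]] by simp
  qed
  then show ?thesis
    unfolding scalar_linear_expand[OF M scalar_linear_hom[OF F] f]
    using M.smult_zero[OF el_closed] chain_module_mem[OF f]
    by (intro M.M.add.finprod_one_eqI) simp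
qed

definition cone_basis :: "nat \<Rightarrow> 'b set \<Rightarrow> 'b set \<Rightarrow> 'k" where
  "cone_basis n s = (if unit \<in> s then \<zero>\<^bsub>chain_module (Suc n)\<^esub>
     else el (eps (Suc n)) unit \<odot>\<^bsub>chain_module (Suc n)\<^esub> chain_basis (Suc n) (insert unit s))"

definition cone :: "nat \<Rightarrow> ('b set \<Rightarrow> 'k) \<Rightarrow> 'b set \<Rightarrow> 'k" where
  "cone n = chain_lin (chain_module (Suc n)) n (cone_basis n)"

lemma cone_basis_closed: "cone_basis n s \<in> carrier (chain_module (Suc n))"
proof -
  interpret Q: left_module A "chain_module (Suc n)" by (rule chain_module_left_module)
  show ?thesis by (simp add: cone_basis_def signed_basis_closed eps_closed)
qed

lemma cone_scalar_linear: "scalar_linear (chain_module n) (chain_module (Suc n)) (cone n)"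
  unfolding cone_def by (rule chain_lin_scalar_linear[OF chain_module_left_module cone_basis_closed])

lemma cone_eq: "s \<in> flags n \<Longrightarrow> cone n (chain_basis n s) = cone_basis n s"
  unfolding cone_def by (rule chain_lin_basis[OF chain_module_left_module cone_basis_closed])

lemma chain_basis_unit:
  assumes "s \<in> flags (Suc n)" "unit \<in> s"
  shows "chain_basis (Suc n) s =
    el (eps (Suc n)) unit \<odot>\<^bsub>chain_module (Suc n)\<^esub> cone n (chain_basis n (s - {unit}))"
proof -
  have "cone n (chain_basis n (s - {unit})) = el (eps (Suc n)) unit \<odot>\<^bsub>chain_module (Suc n)\<^esub> chain_basis (Suc n) s"
    using assms by (simp add: cone_eq[OF flags_faceI] cone_basis_def insert_absorb)
  then show ?thesis
    by (simp add: el_smult_el[OF chain_module_left_module] eps_closed chain_basis_closed eps_square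
        el_one_smult[OF chain_module_left_module])
qed

text \<open>The apex \<open>1\<close> is the last vertex of the cone, so the other faces keep their signs.\<close>

lemma differential_cone:
  assumes s: "s \<in> flags n" and u: "unit \<notin> s"
  shows "differential n (cone n (chain_basis n s)) = chain_basis n s \<oplus>\<^bsub>chain_module n\<^esub>
    el (eps (Suc n)) unit \<odot>\<^bsub>chain_module n\<^esub>
      (\<Oplus>\<^bsub>chain_module n\<^esub>v\<in>s. el (face_sign s v) unit \<odot>\<^bsub>chain_module n\<^esub> chain_basis n (insert unit (s - {v})))"
proof -
  let ?Q = "chain_module n"
  interpret Q: left_module A ?Q by (rule chain_module_left_module)
  note f = flagsD[OF s]
  let ?s = "insert unit s"
  let ?g = "\<lambda>v. el (face_sign ?s v) unit \<odot>\<^bsub>?Q\<^esub> chain_basis n (?s - {v})"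
  let ?g' = "\<lambda>v. el (face_sign s v) unit \<odot>\<^bsub>?Q\<^esub> chain_basis n (insert unit (s - {v}))"
  have s': "?s \<in> flags (Suc n)" by (rule flags_insert_unit[OF s u])
  have cl: "?g v \<in> carrier ?Q" "?g' v \<in> carrier ?Q" for v by (simp_all add: signed_basis_closed face_sign_closed)
  have "{w \<in> ?s. R_le B w unit \<and> w \<noteq> unit} = s" using f(4) u unit_R_le by auto
  then have gu: "?g unit = el (eps (Suc n)) unit \<odot>\<^bsub>?Q\<^esub> chain_basis n s"
    using f(3) u by (simp add: face_sign_def)
  have g: "?g v = ?g' v" if v: "v \<in> s" for v
  proof -
    have "v \<noteq> unit" using v u by auto
    then have "{w \<in> ?s. R_le B w v \<and> w \<noteq> v} = {w \<in> s. R_le B w v \<and> w \<noteq> v}"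
      using R_le_unit_iff[OF f(4)[OF v]] by auto
    moreover have "?s - {v} = insert unit (s - {v})" using \<open>v \<noteq> unit\<close> by auto
    ultimately show ?thesis by (simp add: face_sign_def)
  qed
  have "boundary n ?s = ?g unit \<oplus>\<^bsub>?Q\<^esub> (\<Oplus>\<^bsub>?Q\<^esub>v\<in>s. ?g v)"
    unfolding boundary_def
    by (rule Q.M.finsum_insert[OF f(2) u]) (use cl(1) in blast)+
  also have "(\<Oplus>\<^bsub>?Q\<^esub>v\<in>s. ?g v) = (\<Oplus>\<^bsub>?Q\<^esub>v\<in>s. ?g' v)"
    by (intro Q.M.finsum_cong' refl) (use g cl in auto)
  finally have bd: "boundary n ?s = el (eps (Suc n)) unit \<odot>\<^bsub>?Q\<^esub> chain_basis n s \<oplus>\<^bsub>?Q\<^esub> (\<Oplus>\<^bsub>?Q\<^esub>v\<in>s. ?g' v)"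
    unfolding gu .
  have W: "(\<Oplus>\<^bsub>?Q\<^esub>v\<in>s. ?g' v) \<in> carrier ?Q" by (rule Q.M.finsum_closed) (use cl in auto)
  have "differential n (cone n (chain_basis n s)) = el (eps (Suc n)) unit \<odot>\<^bsub>?Q\<^esub> boundary n ?s"
    using mod_hom_smult[OF differential_hom el_closed[OF eps_closed] chain_basis_closed]
    by (simp add: cone_eq[OF s] cone_basis_def u differential_basis[OF s'])
  also have "\<dots> = el (eps (Suc n)) unit \<odot>\<^bsub>?Q\<^esub> (el (eps (Suc n)) unit \<odot>\<^bsub>?Q\<^esub> chain_basis n s) \<oplus>\<^bsub>?Q\<^esub>
      el (eps (Suc n)) unit \<odot>\<^bsub>?Q\<^esub> (\<Oplus>\<^bsub>?Q\<^esub>v\<in>s. ?g' v)"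
    unfolding bd by (rule Q.smult_r_distr[OF el_closed[OF eps_closed] signed_basis_closed[OF eps_closed] W])
  also have "el (eps (Suc n)) unit \<odot>\<^bsub>?Q\<^esub> (el (eps (Suc n)) unit \<odot>\<^bsub>?Q\<^esub> chain_basis n s) = chain_basis n s"
    by (simp add: el_smult_el[OF chain_module_left_module] eps_closed chain_basis_closed eps_square
        el_one_smult[OF chain_module_left_module])
  finally show ?thesis .
qed

lemma cone_homotopy:
  assumes f: "f \<in> carrier (chain_module (Suc n))"
  shows "differential (Suc n) (cone (Suc n) f) \<oplus>\<^bsub>chain_module (Suc n)\<^esub> cone n (differential n f) = f"
proof -
  let ?Q = "chain_module (Suc n)" and ?P = "chain_module n"
  interpret Q: left_module A ?Q by (rule chain_module_left_module)
  interpret P: left_module A ?P by (rule chain_module_left_module)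
  note cone0 = scalar_linear_zero[OF chain_module_left_module chain_module_left_module cone_scalar_linear]
  have d0: "differential m \<zero>\<^bsub>chain_module (Suc m)\<^esub> = \<zero>\<^bsub>chain_module m\<^esub>" for m
    by (rule scalar_linear_zero[OF chain_module_left_module chain_module_left_module scalar_linear_hom[OF differential_hom]])
  have L: "scalar_linear ?Q ?Q (\<lambda>f. differential (Suc n) (cone (Suc n) f) \<oplus>\<^bsub>?Q\<^esub> cone n (differential n f))"
    by (intro scalar_linear_add[OF chain_module_left_module]
        scalar_linear_compose[OF cone_scalar_linear scalar_linear_hom[OF differential_hom]]
        scalar_linear_compose[OF scalar_linear_hom[OF differential_hom] cone_scalar_linear])
  show ?thesis
  proof (rule scalar_linear_eqI[OF chain_module_left_module L scalar_linear_id _ f])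
    fix s assume s: "s \<in> flags (Suc n)"
    note fs = flagsD[OF s]
    have "cone n (differential n (chain_basis (Suc n) s)) =
        (\<Oplus>\<^bsub>?Q\<^esub>v\<in>s. cone n (el (face_sign s v) unit \<odot>\<^bsub>?P\<^esub> chain_basis n (s - {v})))"
      unfolding differential_basis[OF s] boundary_def
      by (rule scalar_linear_finsum[OF chain_module_left_module chain_module_left_module cone_scalar_linear])
        (simp add: signed_basis_closed face_sign_closed)
    also have "\<dots> = (\<Oplus>\<^bsub>?Q\<^esub>v\<in>s. el (face_sign s v) unit \<odot>\<^bsub>?Q\<^esub> cone_basis n (s - {v}))"
    proof (intro Q.M.finsum_cong' refl)
      fix v assume v: "v \<in> s"
      show "cone n (el (face_sign s v) unit \<odot>\<^bsub>?P\<^esub> chain_basis n (s - {v})) =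
          el (face_sign s v) unit \<odot>\<^bsub>?Q\<^esub> cone_basis n (s - {v})"
        unfolding scalar_linearD(3)[OF cone_scalar_linear chain_basis_closed face_sign_closed]
          cone_eq[OF flags_faceI[OF s v]] ..
    qed (simp add: el_smult_closed[OF chain_module_left_module] cone_basis_closed face_sign_closed)
    finally have cd: "cone n (differential n (chain_basis (Suc n) s)) =
        (\<Oplus>\<^bsub>?Q\<^esub>v\<in>s. el (face_sign s v) unit \<odot>\<^bsub>?Q\<^esub> cone_basis n (s - {v}))" .
    show "differential (Suc n) (cone (Suc n) (chain_basis (Suc n) s)) \<oplus>\<^bsub>?Q\<^esub>
        cone n (differential n (chain_basis (Suc n) s)) = chain_basis (Suc n) s"
    proof (cases "unit \<in> s")
      case True
      have "(\<Oplus>\<^bsub>?Q\<^esub>v\<in>s. el (face_sign s v) unit \<odot>\<^bsub>?Q\<^esub> cone_basis n (s - {v})) =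
          el (face_sign s unit) unit \<odot>\<^bsub>?Q\<^esub> cone_basis n (s - {unit})"
        by (rule Q.M.finsum_single[OF fs(2) True])
          (use True in \<open>auto simp: cone_basis_def Q.smult_zero el_closed face_sign_closed eps_closed
            intro!: el_smult_closed[OF chain_module_left_module] chain_basis_closed\<close>)
      also have "face_sign s unit = eps (Suc n)"
      proof -
        have "{w \<in> s. R_le B w unit \<and> w \<noteq> unit} = s - {unit}" using fs(4) unit_R_le by auto
        then show ?thesis using True fs(2,3) by (simp add: face_sign_def)
      qed
      also have "el (eps (Suc n)) unit \<odot>\<^bsub>?Q\<^esub> cone_basis n (s - {unit}) = chain_basis (Suc n) s"
        using chain_basis_unit[OF s True] cone_eq[OF flags_faceI[OF s True]] by simp
      finally show ?thesis
        unfolding cd cone_eq[OF s] using True by (simp add: cone_basis_def d0 chain_basis_closed)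
    next
      case False
      let ?W = "\<Oplus>\<^bsub>?Q\<^esub>v\<in>s. el (face_sign s v) unit \<odot>\<^bsub>?Q\<^esub> chain_basis (Suc n) (insert unit (s - {v}))"
      have W: "?W \<in> carrier ?Q"
        by (rule Q.M.finsum_closed) (simp add: signed_basis_closed face_sign_closed)
      have "(\<Oplus>\<^bsub>?Q\<^esub>v\<in>s. el (face_sign s v) unit \<odot>\<^bsub>?Q\<^esub> cone_basis n (s - {v})) =
          (\<Oplus>\<^bsub>?Q\<^esub>v\<in>s. el (eps (Suc n)) unit \<odot>\<^bsub>?Q\<^esub>
            (el (face_sign s v) unit \<odot>\<^bsub>?Q\<^esub> chain_basis (Suc n) (insert unit (s - {v}))))"
        using False
        by (intro Q.M.finsum_cong' refl)
          (auto simp: cone_basis_def el_smult_el[OF chain_module_left_module] face_sign_closed eps_closed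
            chain_basis_closed k.m_comm intro!: el_smult_closed[OF chain_module_left_module])
      also have "\<dots> = el (eps (Suc n)) unit \<odot>\<^bsub>?Q\<^esub> ?W"
        by (rule Q.smult_finsum[symmetric, OF el_closed[OF eps_closed]])
          (simp add: signed_basis_closed face_sign_closed)
      finally have "cone n (differential n (chain_basis (Suc n) s)) = el (eps (Suc n)) unit \<odot>\<^bsub>?Q\<^esub> ?W"
        unfolding cd .
      moreover have "el (eps (Suc (Suc n))) unit \<odot>\<^bsub>?Q\<^esub> ?W = \<ominus>\<^bsub>?Q\<^esub> (el (eps (Suc n)) unit \<odot>\<^bsub>?Q\<^esub> ?W)"
        unfolding eps_Suc[of "Suc n"] by (rule el_minus_smult[OF chain_module_left_module eps_closed W])
      ultimately show ?thesis
        unfolding differential_cone[OF s False]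
        using el_smult_closed[OF chain_module_left_module eps_closed W]
        by (simp add: chain_basis_closed Q.M.a_assoc Q.M.l_neg)
    qed
  qed
qed

abbreviation support_mod where "support_mod \<equiv> support_module k B (supp B base)"

lemma support_module_el:
  assumes e: "e \<in> carrier B"
  shows "left_module A (support_module k B (supp B e))"
    and "r \<in> carrier k \<Longrightarrow> b \<in> carrier B \<Longrightarrow> c \<in> carrier k \<Longrightarrow>
      el r b \<odot>\<^bsub>support_module k B (supp B e)\<^esub> c = r \<otimes>\<^bsub>k\<^esub> (if e \<cdot> b = e then c else \<zero>\<^bsub>k\<^esub>)"
proof -
  let ?M = "support_module k B (supp B e)" and ?T = "\<lambda>r b c. r \<otimes>\<^bsub>k\<^esub> (if e \<cdot> b = e then c else \<zero>\<^bsub>k\<^esub>)"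
  have s: "carrier ?M = carrier k" "add ?M = add k" "zero ?M = zero k"
    by (simp_all add: support_module_def)
  have M: "abelian_group ?M"
    by (rule abelian_groupI) (auto simp: s k.a_ac intro: k.l_neg bexI[of _ "\<ominus>\<^bsub>k\<^esub> _"])
  note T = left_module_of_action[where T = ?T and M = ?M, OF M]
  have smult: "a \<odot>\<^bsub>?M\<^esub> c = (\<Oplus>\<^bsub>?M\<^esub>b\<in>carrier B. ?T (a b) b c)" if "a \<in> carrier A" "c \<in> carrier ?M" for a c
  proof -
    have cl: "(\<lambda>b. ?T (a b) b c) \<in> carrier B \<rightarrow> carrier ?M" using that A_mem by (auto simp: s)
    have "(\<Oplus>\<^bsub>?M\<^esub>b\<in>carrier B. ?T (a b) b c) = (\<Oplus>\<^bsub>k\<^esub>b\<in>carrier B. ?T (a b) b c)"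
      using additive_finsum[where e = "\<lambda>c. c", OF abelian_group.axioms(1)[OF M] k.abelian_monoid_axioms _ _ _ cl]
      by (simp add: s)
    moreover have "(\<Oplus>\<^bsub>k\<^esub>b\<in>carrier B. a b \<otimes>\<^bsub>k\<^esub> (if supp B e \<subseteq> supp B b then c else \<zero>\<^bsub>k\<^esub>)) = (\<Oplus>\<^bsub>k\<^esub>b\<in>carrier B. ?T (a b) b c)"
      using that A_mem by (intro k.finsum_cong' refl) (auto simp: supp_subset_iff[OF e] s)
    ultimately show ?thesis by (simp add: support_module_def)
  qed
  have mult: "?T r b (?T r' b' c) = ?T (r \<otimes>\<^bsub>k\<^esub> r') (b \<cdot> b') c"
    if "r \<in> carrier k" "r' \<in> carrier k" "b \<in> carrier B" "b' \<in> carrier B" "c \<in> carrier ?M" for r r' b b' c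
    using that fixes_mult_iff[OF e, of b b'] by (simp add: s k.m_assoc)
  show "left_module A ?M"
    by (rule T(1)[OF _ _ _ mult _ smult]) (auto simp: s k.l_distr k.r_distr e)
  show "r \<in> carrier k \<Longrightarrow> b \<in> carrier B \<Longrightarrow> c \<in> carrier k \<Longrightarrow> el r b \<odot>\<^bsub>?M\<^esub> c = ?T r b c"
    by (rule T(2)[OF _ _ _ mult _ smult]) (auto simp: s k.l_distr k.r_distr e)
qed

definition augmentation :: "('b set \<Rightarrow> 'k) \<Rightarrow> 'k" where
  "augmentation = chain_lin support_mod 0 (\<lambda>s. \<one>\<^bsub>k\<^esub>)"

lemma support_mod_simps: "carrier (support_module k B X) = carrier k" "\<zero>\<^bsub>support_module k B X\<^esub> = \<zero>\<^bsub>k\<^esub>"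
  "c \<oplus>\<^bsub>support_module k B X\<^esub> c' = c \<oplus>\<^bsub>k\<^esub> c'"
  by (simp_all add: support_module_def)

lemma augmentation_hom: "augmentation \<in> mod_hom A (chain_module 0) support_mod"
  unfolding augmentation_def
proof (rule chain_lin_hom[OF support_module_el(1)[OF base]])
  fix b s assume b: "b \<in> carrier B" and s: "s \<in> flags 0"
  obtain v where "s = {v}" using flagsD(3)[OF s] by (auto simp: card_1_singleton_iff)
  then have "act b s \<in> flags 0 \<longleftrightarrow> base \<cdot> b = base" using act_flags_iff[OF s b] by simp
  then show "el \<one>\<^bsub>k\<^esub> b \<odot>\<^bsub>support_mod\<^esub> \<one>\<^bsub>k\<^esub> = (if act b s \<in> flags 0 then \<one>\<^bsub>k\<^esub> else \<zero>\<^bsub>support_mod\<^esub>)"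
    using b by (simp add: support_module_el(2)[OF base] support_mod_simps)
qed (simp add: support_mod_simps)

lemma augmentation_basis: "s \<in> flags 0 \<Longrightarrow> augmentation (chain_basis 0 s) = \<one>\<^bsub>k\<^esub>"
  unfolding augmentation_def by (rule chain_lin_basis[OF support_module_el(1)[OF base]]) (simp_all add: support_mod_simps)

lemma unit_flag: "{unit} \<in> flags 0"
  using base R_le_refl by (auto simp: flags_def)

lemma augmentation_closed: "f \<in> carrier (chain_module 0) \<Longrightarrow> augmentation f \<in> carrier k"
  using mod_hom_closed[OF augmentation_hom] by (simp add: support_mod_simps)

lemma cone_homotopy_0:
  assumes f: "f \<in> carrier (chain_module 0)"
  shows "differential 0 (cone 0 f) \<oplus>\<^bsub>chain_module 0\<^esub> el (augmentation f) unit \<odot>\<^bsub>chain_module 0\<^esub> chain_basis 0 {unit} = f"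
proof -
  let ?Q = "chain_module 0"
  interpret Q: left_module A ?Q by (rule chain_module_left_module)
  have aug: "scalar_linear ?Q ?Q (\<lambda>f. el (augmentation f) unit \<odot>\<^bsub>?Q\<^esub> chain_basis 0 {unit})"
    unfolding scalar_linear_def
  proof (intro conjI ballI)
    fix f assume f: "f \<in> carrier ?Q"
    show "el (augmentation f) unit \<odot>\<^bsub>?Q\<^esub> chain_basis 0 {unit} \<in> carrier ?Q"
      by (rule signed_basis_closed[OF augmentation_closed[OF f]])
    show "el (augmentation (f \<oplus>\<^bsub>?Q\<^esub> g)) unit \<odot>\<^bsub>?Q\<^esub> chain_basis 0 {unit} =
        el (augmentation f) unit \<odot>\<^bsub>?Q\<^esub> chain_basis 0 {unit} \<oplus>\<^bsub>?Q\<^esub> el (augmentation g) unit \<odot>\<^bsub>?Q\<^esub> chain_basis 0 {unit}"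
      if "g \<in> carrier ?Q" for g
      using mod_hom_add[OF augmentation_hom f that] augmentation_closed[OF f] augmentation_closed[OF that]
      by (simp add: support_mod_simps el_add_smult[OF chain_module_left_module] chain_basis_closed)
    show "el (augmentation (el r unit \<odot>\<^bsub>?Q\<^esub> f)) unit \<odot>\<^bsub>?Q\<^esub> chain_basis 0 {unit} =
        el r unit \<odot>\<^bsub>?Q\<^esub> (el (augmentation f) unit \<odot>\<^bsub>?Q\<^esub> chain_basis 0 {unit})" if r: "r \<in> carrier k" for r
      using mod_hom_smult[OF augmentation_hom el_closed[OF r] f, of unit] augmentation_closed[OF f] r base
      by (simp add: support_module_el(2)[OF base] el_smult_el[OF chain_module_left_module] chain_basis_closed)
  qed
  have L: "scalar_linear ?Q ?Q (\<lambda>f. differential 0 (cone 0 f) \<oplus>\<^bsub>?Q\<^esub>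
      el (augmentation f) unit \<odot>\<^bsub>?Q\<^esub> chain_basis 0 {unit})"
    by (intro scalar_linear_add[OF chain_module_left_module] aug
        scalar_linear_compose[OF cone_scalar_linear scalar_linear_hom[OF differential_hom]])
  show ?thesis
  proof (rule scalar_linear_eqI[OF chain_module_left_module L scalar_linear_id _ f])
    fix s assume s: "s \<in> flags 0"
    then obtain v where v: "s = {v}" using flagsD(3)[OF s] by (auto simp: card_1_singleton_iff)
    have aug: "el (augmentation (chain_basis 0 s)) unit \<odot>\<^bsub>?Q\<^esub> chain_basis 0 {unit} = chain_basis 0 {unit}"
      by (simp add: augmentation_basis[OF s] el_one_smult[OF chain_module_left_module] chain_basis_closed)
    show "differential 0 (cone 0 (chain_basis 0 s)) \<oplus>\<^bsub>?Q\<^esub>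
        el (augmentation (chain_basis 0 s)) unit \<odot>\<^bsub>?Q\<^esub> chain_basis 0 {unit} = chain_basis 0 s"
    proof (cases "unit \<in> s")
      case True
      then show ?thesis unfolding aug unfolding cone_eq[OF s]
        using scalar_linear_zero[OF chain_module_left_module chain_module_left_module
            scalar_linear_hom[OF differential_hom], of 0]
        by (simp add: cone_basis_def v chain_basis_closed)
    next
      case False
      have "face_sign s v = \<one>\<^bsub>k\<^esub>" by (simp add: face_sign_def v eps_0 Collect_conv_if2 cong: conj_cong)
      then have "(\<Oplus>\<^bsub>?Q\<^esub>w\<in>s. el (face_sign s w) unit \<odot>\<^bsub>?Q\<^esub> chain_basis 0 (insert unit (s - {w}))) = chain_basis 0 {unit}"
        by (simp add: v Q.M.finsum_insert el_one_smult[OF chain_module_left_module] chain_basis_closed)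
      moreover have "el (eps (Suc 0)) unit \<odot>\<^bsub>?Q\<^esub> chain_basis 0 {unit} = \<ominus>\<^bsub>?Q\<^esub> chain_basis 0 {unit}"
        unfolding eps_Suc eps_0
        by (simp add: el_minus_smult[OF chain_module_left_module] chain_basis_closed el_one_smult[OF chain_module_left_module])
      ultimately show ?thesis unfolding aug unfolding differential_cone[OF s False]
        by (simp add: chain_basis_closed Q.M.a_assoc Q.M.l_neg)
    qed
  qed
qed

lemma chain_hom_vanishes_cone:
  assumes M: "left_module A M" and F: "F \<in> mod_hom A (chain_module (Suc n)) M"
    and zero: "\<And>t. t \<in> flags n \<Longrightarrow> F (cone n (chain_basis n t)) = \<zero>\<^bsub>M\<^esub>"
    and f: "f \<in> carrier (chain_module (Suc n))"
  shows "F f = \<zero>\<^bsub>M\<^esub>"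
proof (rule chain_hom_vanishes[OF M F _ f])
  fix s assume s: "s \<in> flags (Suc n)" "unit \<in> s"
  have "F (chain_basis (Suc n) s) = el (eps (Suc n)) unit \<odot>\<^bsub>M\<^esub> F (cone n (chain_basis n (s - {unit})))"
    using mod_hom_smult[OF F el_closed[OF eps_closed] scalar_linearD(1)[OF cone_scalar_linear chain_basis_closed]]
    by (simp add: chain_basis_unit[OF s])
  then show "F (chain_basis (Suc n) s) = \<zero>\<^bsub>M\<^esub>"
    using zero[OF flags_faceI[OF s]] left_module.smult_zero[OF M el_closed[OF eps_closed]] by simp
qed

lemma augmentation_differential:
  assumes f: "f \<in> carrier (chain_module (Suc 0))"
  shows "augmentation (differential 0 f) = \<zero>\<^bsub>k\<^esub>"
proof -
  let ?F = "compose (carrier (chain_module (Suc 0))) augmentation (differential 0)"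
  have F: "?F \<in> mod_hom A (chain_module (Suc 0)) support_mod"
    by (rule mod_hom_compose[OF chain_module_left_module differential_hom augmentation_hom])
  have "?F f = \<zero>\<^bsub>support_mod\<^esub>"
  proof (rule chain_hom_vanishes_cone[OF support_module_el(1)[OF base] F _ f])
    fix t assume t: "t \<in> flags 0"
    let ?c = "cone 0 (chain_basis 0 t)"
    have c: "?c \<in> carrier (chain_module (Suc 0))" by (rule scalar_linearD(1)[OF cone_scalar_linear chain_basis_closed])
    have dc: "differential 0 ?c \<in> carrier (chain_module 0)" by (rule mod_hom_closed[OF differential_hom c])
    have "augmentation (differential 0 ?c) \<oplus>\<^bsub>k\<^esub>
        augmentation (el (augmentation (chain_basis 0 t)) unit \<odot>\<^bsub>chain_module 0\<^esub> chain_basis 0 {unit}) =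
        augmentation (chain_basis 0 t)"
      using mod_hom_add[OF augmentation_hom dc signed_basis_closed[OF augmentation_closed[OF chain_basis_closed]]]
      by (metis cone_homotopy_0[OF chain_basis_closed] support_mod_simps(3))
    then have "augmentation (differential 0 ?c) \<oplus>\<^bsub>k\<^esub> \<one>\<^bsub>k\<^esub> = \<one>\<^bsub>k\<^esub>"
      by (simp add: augmentation_basis[OF t] augmentation_basis[OF unit_flag]
          el_one_smult[OF chain_module_left_module] chain_basis_closed)
    then have "augmentation (differential 0 ?c) = \<zero>\<^bsub>k\<^esub>"
      using k.add.r_cancel_one[of "\<one>\<^bsub>k\<^esub>"] augmentation_closed[OF dc] by simp
    then show "?F ?c = \<zero>\<^bsub>support_mod\<^esub>" using c by (simp add: compose_def support_mod_simps)
  qed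
  then show ?thesis using f by (simp add: compose_def support_mod_simps)
qed

lemma cone_zero: "cone n \<zero>\<^bsub>chain_module n\<^esub> = \<zero>\<^bsub>chain_module (Suc n)\<^esub>"
  by (rule scalar_linear_zero[OF chain_module_left_module chain_module_left_module cone_scalar_linear])

lemma differential_cone_cycle:
  assumes u: "u \<in> carrier (chain_module n)"
    and cycle: "case n of 0 \<Rightarrow> augmentation u = \<zero>\<^bsub>k\<^esub> | Suc m \<Rightarrow> differential m u = \<zero>\<^bsub>chain_module m\<^esub>"
  shows "differential n (cone n u) = u"
proof (cases n)
  case 0
  interpret Q: left_module A "chain_module 0" by (rule chain_module_left_module)
  have "differential 0 (cone 0 u) \<in> carrier (chain_module 0)"
    using mod_hom_closed[OF differential_hom] scalar_linearD(1)[OF cone_scalar_linear] u 0 by simp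
  then show ?thesis using cone_homotopy_0[of u] u cycle 0
    by (simp add: el_zero_smult[OF chain_module_left_module] chain_basis_closed)
next
  case (Suc m)
  interpret Q: left_module A "chain_module (Suc m)" by (rule chain_module_left_module)
  have "differential (Suc m) (cone (Suc m) u) \<in> carrier (chain_module (Suc m))"
    using mod_hom_closed[OF differential_hom] scalar_linearD(1)[OF cone_scalar_linear] u Suc by simp
  then show ?thesis using cone_homotopy[of u m] u cycle Suc by (simp add: cone_zero)
qed

lemma differential_differential:
  assumes "f \<in> carrier (chain_module (Suc (Suc n)))"
  shows "differential n (differential (Suc n) f) = \<zero>\<^bsub>chain_module n\<^esub>"
  using assms
proof (induction n arbitrary: f rule: less_induct)
  case (less n)
  note f = less.prems
  let ?F = "compose (carrier (chain_module (Suc (Suc n)))) (differential n) (differential (Suc n))"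
  interpret P: left_module A "chain_module n" by (rule chain_module_left_module)
  have F: "?F \<in> mod_hom A (chain_module (Suc (Suc n))) (chain_module n)"
    by (rule mod_hom_compose[OF chain_module_left_module differential_hom differential_hom])
  have "?F f = \<zero>\<^bsub>chain_module n\<^esub>"
  proof (rule chain_hom_vanishes_cone[OF chain_module_left_module F _ f])
    fix t assume t: "t \<in> flags (Suc n)"
    let ?c = "cone (Suc n) (chain_basis (Suc n) t)" and ?u = "differential n (chain_basis (Suc n) t)"
    have c: "?c \<in> carrier (chain_module (Suc (Suc n)))"
      by (rule scalar_linearD(1)[OF cone_scalar_linear chain_basis_closed])
    have u: "?u \<in> carrier (chain_module n)" by (rule mod_hom_closed[OF differential_hom chain_basis_closed])
    have dc: "differential (Suc n) ?c \<in> carrier (chain_module (Suc n))" by (rule mod_hom_closed[OF differential_hom c])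
    have cu: "cone n ?u \<in> carrier (chain_module (Suc n))" by (rule scalar_linearD(1)[OF cone_scalar_linear u])
    have "case n of 0 \<Rightarrow> augmentation ?u = \<zero>\<^bsub>k\<^esub> | Suc m \<Rightarrow> differential m ?u = \<zero>\<^bsub>chain_module m\<^esub>"
    proof (cases n)
      case 0 then show ?thesis using augmentation_differential[OF chain_basis_closed] by simp
    next
      case (Suc m) then show ?thesis using less.IH[of m, OF _ chain_basis_closed] by simp
    qed
    from differential_cone_cycle[OF u this] have "differential n (differential (Suc n) ?c) \<oplus>\<^bsub>chain_module n\<^esub> ?u = ?u"
      using mod_hom_add[OF differential_hom dc cu] cone_homotopy[OF chain_basis_closed, of n t] by simp
    then have "differential n (differential (Suc n) ?c) = \<zero>\<^bsub>chain_module n\<^esub>"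
      using P.M.add.r_cancel_one[OF u mod_hom_closed[OF differential_hom dc]] by simp
    then show "?F ?c = \<zero>\<^bsub>chain_module n\<^esub>" using c by (simp add: compose_def)
  qed
  then show ?case using f by (simp add: compose_def)
qed

lemma augmentation_surj: "augmentation ` carrier (chain_module 0) = carrier support_mod"
proof
  show "carrier support_mod \<subseteq> augmentation ` carrier (chain_module 0)"
  proof
    fix r assume "r \<in> carrier support_mod"
    then have r: "r \<in> carrier k" by (simp add: support_mod_simps)
    have "augmentation (el r unit \<odot>\<^bsub>chain_module 0\<^esub> chain_basis 0 {unit}) = r"
      using mod_hom_smult[OF augmentation_hom el_closed[OF r] chain_basis_closed] r base
      by (simp add: augmentation_basis[OF unit_flag] support_module_el(2)[OF base])
    then show "r \<in> augmentation ` carrier (chain_module 0)"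
      using signed_basis_closed[OF r] by (metis imageI)
  qed
qed (use augmentation_closed in \<open>auto simp: support_mod_simps\<close>)

lemma chain_resolution:
  assumes "\<And>n. projective A (chain_module n)"
  shows "projective_resolution A support_mod chain_module differential augmentation"
  unfolding projective_resolution_def
proof (intro conjI allI)
  have cc: "cone n f \<in> carrier (chain_module (Suc n))" if "f \<in> carrier (chain_module n)" for n f
    by (rule scalar_linearD(1)[OF cone_scalar_linear that])
  show "differential 0 ` carrier (chain_module 1) = {x \<in> carrier (chain_module 0). augmentation x = \<zero>\<^bsub>support_mod\<^esub>}"
  proof (intro equalityI subsetI)
    fix f assume "f \<in> {x \<in> carrier (chain_module 0). augmentation x = \<zero>\<^bsub>support_mod\<^esub>}"
    then have f: "f \<in> carrier (chain_module 0)" "augmentation f = \<zero>\<^bsub>k\<^esub>" by (auto simp: support_mod_simps)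
    then have "f = differential 0 (cone 0 f)" using differential_cone_cycle[of f 0] by simp
    then show "f \<in> differential 0 ` carrier (chain_module 1)" using cc[OF f(1)] by (intro image_eqI) auto
  next
    fix f assume "f \<in> differential 0 ` carrier (chain_module 1)"
    then show "f \<in> {x \<in> carrier (chain_module 0). augmentation x = \<zero>\<^bsub>support_mod\<^esub>}"
      using augmentation_differential mod_hom_closed[OF differential_hom[of 0]] by (auto simp: support_mod_simps)
  qed
  fix n
  show "differential (Suc n) ` carrier (chain_module (Suc (Suc n))) =
      {x \<in> carrier (chain_module (Suc n)). differential n x = \<zero>\<^bsub>chain_module n\<^esub>}"
  proof (intro equalityI subsetI)
    fix f assume "f \<in> {x \<in> carrier (chain_module (Suc n)). differential n x = \<zero>\<^bsub>chain_module n\<^esub>}"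
    then have f: "f \<in> carrier (chain_module (Suc n))" "differential n f = \<zero>\<^bsub>chain_module n\<^esub>" by auto
    then have "f = differential (Suc n) (cone (Suc n) f)" using differential_cone_cycle[of f "Suc n"] by simp
    then show "f \<in> differential (Suc n) ` carrier (chain_module (Suc (Suc n)))" using cc[OF f(1)] by (intro image_eqI) auto
  next
    fix f assume "f \<in> differential (Suc n) ` carrier (chain_module (Suc (Suc n)))"
    then show "f \<in> {x \<in> carrier (chain_module (Suc n)). differential n x = \<zero>\<^bsub>chain_module n\<^esub>}"
      using differential_differential mod_hom_closed[OF differential_hom[of "Suc n"]] by auto
  qed
qed (fact assms differential_hom augmentation_hom augmentation_surj)+

section \<open>Projectivity of the chain modules\<close>

definition top_vertex :: "'b set \<Rightarrow> 'b" where
  "top_vertex s = (SOME z. z \<in> s \<and> (\<forall>w\<in>s. R_le B w z))"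

definition support_rep :: "'b \<Rightarrow> 'b" where
  "support_rep z = (SOME y. y \<in> carrier B \<and> supp B y = supp B z)"

lemma top_vertex:
  assumes "s \<in> flags n"
  shows "top_vertex s \<in> s" "w \<in> s \<Longrightarrow> top_vertex s \<cdot> w = w" "top_vertex s \<in> carrier B"
proof -
  have "top_vertex s \<in> s \<and> (\<forall>w\<in>s. R_le B w (top_vertex s))"
    unfolding top_vertex_def by (rule someI_ex) (use flags_top[OF assms] in blast)
  then show "top_vertex s \<in> s" "w \<in> s \<Longrightarrow> top_vertex s \<cdot> w = w" by (auto simp: R_le_iff)
  then show "top_vertex s \<in> carrier B" using flagsD(4)[OF assms] by auto
qed

lemma act_top_vertex:
  assumes "s \<in> flags n" shows "act (top_vertex s) s = s"
  using image_cong[of s s "\<lambda>w. top_vertex s \<cdot> w" "\<lambda>w. w"] top_vertex(2)[OF assms] by simp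

lemma top_vertex_act:
  assumes s: "s \<in> flags n" and b: "b \<in> carrier B" and bs: "act b s \<in> flags n"
  shows "top_vertex (act b s) = b \<cdot> top_vertex s"
proof (rule R_le_antisym)
  note z = top_vertex[OF s] and z' = top_vertex[OF bs]
  show c: "top_vertex (act b s) \<in> carrier B" "b \<cdot> top_vertex s \<in> carrier B" using z'(3) z(3) b by auto
  obtain w where w: "w \<in> s" "top_vertex (act b s) = b \<cdot> w" using z'(1) by auto
  have "R_le B w (top_vertex s)" using z(2)[OF w(1)] by (simp add: R_le_iff)
  then show "R_le B (top_vertex (act b s)) (b \<cdot> top_vertex s)"
    unfolding w(2) using R_le_mult b flagsD(4)[OF s w(1)] z(3) by simp
  show "R_le B (b \<cdot> top_vertex s) (top_vertex (act b s))"
    using z'(2)[of "b \<cdot> top_vertex s"] z(1) by (simp add: R_le_iff)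
qed

lemma support_rep:
  assumes "z \<in> carrier B"
  shows "support_rep z \<in> carrier B" "z \<cdot> support_rep z = z" "support_rep z \<cdot> z = support_rep z"
proof -
  have "support_rep z \<in> carrier B \<and> supp B (support_rep z) = supp B z"
    unfolding support_rep_def by (rule someI_ex) (use assms in blast)
  then show "support_rep z \<in> carrier B" "z \<cdot> support_rep z = z" "support_rep z \<cdot> z = support_rep z"
    using supp_subset_iff[of z "support_rep z"] supp_subset_iff[of "support_rep z" z] assms by auto
qed

lemma supp_mult_subset:
  assumes "b \<in> carrier B" "z \<in> carrier B"
  shows "supp B (b \<cdot> z) \<subseteq> supp B z"
  using assms supp_subset_iff[of "b \<cdot> z" z] LRB.idem[of z] by (simp add: B.m_assoc)

lemma supp_mult_eq_iff:
  assumes b: "b \<in> carrier B" and z: "z \<in> carrier B"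
  shows "supp B (b \<cdot> z) = supp B z \<longleftrightarrow> z \<cdot> b = z"
proof
  assume "supp B (b \<cdot> z) = supp B z"
  then have "z \<cdot> (b \<cdot> z) = z" using supp_subset_iff[of z "b \<cdot> z"] b z by simp
  then show "z \<cdot> b = z" using fixes_mult_iff[OF z b z] by simp
next
  assume "z \<cdot> b = z"
  then have "supp B z \<subseteq> supp B (b \<cdot> z)" using supp_subset_iff[of z "b \<cdot> z"] b z regular[OF z b] by simp
  then show "supp B (b \<cdot> z) = supp B z" using supp_mult_subset[OF b z] by simp
qed

lemma finite_supp: "finite (supp B z)"
  unfolding supp_def using finite_B by simp

context
  fixes M :: "('b \<Rightarrow> 'k, 'm) module" and \<pi> and n :: nat
  assumes M: "left_module A M" and \<pi>: "\<pi> \<in> mod_hom A M (chain_module n)"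
    and surj: "\<pi> ` carrier M = carrier (chain_module n)"
begin

interpretation M: left_module A M by (rule M)
interpretation Q: left_module A "chain_module n" by (rule chain_module_left_module)

abbreviation translate :: "'b \<Rightarrow> 'm \<Rightarrow> 'm" (infixr \<open>\<star>\<close> 75) where
  "b \<star> m \<equiv> el \<one>\<^bsub>k\<^esub> b \<odot>\<^bsub>M\<^esub> m"

lemma translate_closed: "m \<in> carrier M \<Longrightarrow> b \<star> m \<in> carrier M"
  by (rule el_smult_closed[OF M k.one_closed])

lemma translate_translate:
  "b \<in> carrier B \<Longrightarrow> c \<in> carrier B \<Longrightarrow> m \<in> carrier M \<Longrightarrow> b \<star> c \<star> m = (b \<cdot> c) \<star> m"
  by (simp add: el_smult_el[OF M])

lemma translate_zero: "b \<star> \<zero>\<^bsub>M\<^esub> = \<zero>\<^bsub>M\<^esub>"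
  by (rule M.smult_zero[OF el_closed[OF k.one_closed]])

lemma translate_correction:
  assumes "b \<in> carrier B" "u \<in> carrier M" "v \<in> carrier M" "w \<in> carrier M"
  shows "b \<star> (u \<ominus>\<^bsub>M\<^esub> v \<oplus>\<^bsub>M\<^esub> w) = b \<star> u \<ominus>\<^bsub>M\<^esub> b \<star> v \<oplus>\<^bsub>M\<^esub> b \<star> w"
  using assms el_closed[OF k.one_closed]
  by (simp add: M.smult_r_distr M.smult_minus a_minus_def)

lemma \<pi>_translate:
  "s \<in> flags n \<Longrightarrow> b \<in> carrier B \<Longrightarrow> m \<in> carrier M \<Longrightarrow> \<pi> m = chain_basis n s \<Longrightarrow> \<pi> (b \<star> m) = chain_basis n (act b s)"
  using mod_hom_smult[OF \<pi> el_closed[OF k.one_closed]] el_chain_basis by simp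

lemma \<pi>_zero: "\<pi> \<zero>\<^bsub>M\<^esub> = \<zero>\<^bsub>chain_module n\<^esub>"
  by (rule mod_hom_zero[OF \<pi> M.abelian_group_axioms Q.abelian_group_axioms])

text \<open>The section is constructed by induction on the size \<open>N\<close> of the support of the largest element;
  this set of chains is closed under multiplication by elements of \<open>B\<close>.\<close>

definition partial_section :: "nat \<Rightarrow> ('b set \<Rightarrow> 'm) \<Rightarrow> bool" where
  "partial_section N h \<longleftrightarrow> (\<forall>s. s \<notin> flags n \<longrightarrow> h s = \<zero>\<^bsub>M\<^esub>) \<and>
     (\<forall>s\<in>flags n. card (supp B (top_vertex s)) < N \<longrightarrow>
        h s \<in> carrier M \<and> \<pi> (h s) = chain_basis n s \<and> (\<forall>b\<in>carrier B. b \<star> h s = h (act b s)))"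

context
  fixes N :: nat and h :: "'b set \<Rightarrow> 'm" and s :: "'b set"
  assumes h: "partial_section N h" and s: "s \<in> flags n" and N: "card (supp B (top_vertex s)) = N"
begin

lemma partial_section_lower:
  assumes c: "c \<in> carrier B" "top_vertex s \<cdot> c \<noteq> top_vertex s"
  shows "h (act c s) \<in> carrier M" "\<pi> (h (act c s)) = chain_basis n (act c s)"
    "b \<in> carrier B \<Longrightarrow> b \<star> h (act c s) = h (act (b \<cdot> c) s)"
proof -
  have eq: "act b (act c s) = act (b \<cdot> c) s" if "b \<in> carrier B" for b
    by (rule act_mult[OF flagsD(1)[OF s] that c(1)])
  have "h (act c s) \<in> carrier M \<and> \<pi> (h (act c s)) = chain_basis n (act c s) \<and>
      (\<forall>b\<in>carrier B. b \<star> h (act c s) = h (act (b \<cdot> c) s))"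
  proof (cases "act c s \<in> flags n")
    case True
    have "supp B (top_vertex (act c s)) \<subset> supp B (top_vertex s)"
      unfolding top_vertex_act[OF s c(1) True]
      using supp_mult_subset[OF c(1) top_vertex(3)[OF s]] supp_mult_eq_iff[OF c(1) top_vertex(3)[OF s]] c(2)
      by blast
    then have "card (supp B (top_vertex (act c s))) < N" using psubset_card_mono[OF finite_supp] N by blast
    then show ?thesis using h True eq by (simp add: partial_section_def)
  next
    case False
    then have "act (b \<cdot> c) s \<notin> flags n" if "b \<in> carrier B" for b
      using act_flags_factor[OF s that c(1)] eq[OF that] by auto
    then show ?thesis
      using h False by (simp add: partial_section_def \<pi>_zero chain_basis_eq_zero translate_zero)
  qed
  then show "h (act c s) \<in> carrier M" "\<pi> (h (act c s)) = chain_basis n (act c s)"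
    "b \<in> carrier B \<Longrightarrow> b \<star> h (act c s) = h (act (b \<cdot> c) s)" by blast+
qed

text \<open>With \<open>y\<close> the largest element of \<open>s\<close>, a lift \<open>u\<close> of \<open>s\<close> is made compatible with \<open>b\<close> by passing
  to \<open>u - (y b) u + h (y b s)\<close>. By the identity \<open>c a c = c a\<close>, the compatibilities
  achieved before persist.\<close>

lemma equivariant_lift:
  assumes "finite F" "F \<subseteq> {b \<in> carrier B. top_vertex s \<cdot> b \<noteq> top_vertex s}"
  shows "\<exists>u\<in>carrier M. \<pi> u = chain_basis n s \<and> top_vertex s \<star> u = u \<and> (\<forall>b\<in>F. b \<star> u = h (act b s))"
  using assms
proof (induction F)
  case empty
  let ?y = "top_vertex s"
  note ys = act_top_vertex[OF s]
  have "chain_basis n s \<in> \<pi> ` carrier M" using surj chain_basis_closed by simp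
  then obtain m where m: "m \<in> carrier M" "\<pi> m = chain_basis n s" by auto
  show ?case
  proof (intro bexI[of _ "?y \<star> m"] conjI)
    show "\<pi> (?y \<star> m) = chain_basis n s" using \<pi>_translate[OF s top_vertex(3)[OF s] m] ys by simp
    show "?y \<star> ?y \<star> m = ?y \<star> m"
      using m top_vertex(3)[OF s] LRB.idem by (simp add: translate_translate)
  qed (simp_all add: translate_closed m)
next
  case (insert b F)
  let ?y = "top_vertex s"
  have y: "?y \<in> carrier B" by (rule top_vertex(3)[OF s])
  note ys = act_top_vertex[OF s]
  have b: "b \<in> carrier B" "?y \<cdot> b \<noteq> ?y" and F: "\<And>c. c \<in> F \<Longrightarrow> c \<in> carrier B" "\<And>c. c \<in> F \<Longrightarrow> ?y \<cdot> c \<noteq> ?y"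
    using insert.prems by auto
  obtain u where u: "u \<in> carrier M" "\<pi> u = chain_basis n s" "?y \<star> u = u" "\<And>c. c \<in> F \<Longrightarrow> c \<star> u = h (act c s)"
    using insert.IH insert.prems by auto
  define a where "a = ?y \<cdot> b"
  have ya: "?y \<cdot> a = a" using y b LRB.idem[of ?y] by (simp add: a_def flip: B.m_assoc)
  have a: "a \<in> carrier B" "?y \<cdot> a \<noteq> ?y" using ya y b by (auto simp: a_def)
  note low = partial_section_lower
  define u' where "u' = u \<ominus>\<^bsub>M\<^esub> a \<star> u \<oplus>\<^bsub>M\<^esub> h (act a s)"
  have au: "a \<star> u \<in> carrier M" by (rule translate_closed[OF u(1)])
  have expand: "c \<star> u' = c \<star> u \<ominus>\<^bsub>M\<^esub> (c \<cdot> a) \<star> u \<oplus>\<^bsub>M\<^esub> h (act (c \<cdot> a) s)" if "c \<in> carrier B" for c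
    unfolding u'_def translate_correction[OF that u(1) au low(1)[OF a]]
    using that a u by (simp add: translate_translate low(3))
  have cancel: "v \<ominus>\<^bsub>M\<^esub> w \<oplus>\<^bsub>M\<^esub> w = v" if "v \<in> carrier M" "w \<in> carrier M" for v w
    using that by (simp add: a_minus_def M.M.a_assoc M.M.l_neg)
  have cancel_Q: "v \<ominus>\<^bsub>chain_module n\<^esub> w \<oplus>\<^bsub>chain_module n\<^esub> w = v"
    if "v \<in> carrier (chain_module n)" "w \<in> carrier (chain_module n)" for v w
    using that by (simp add: a_minus_def Q.M.a_assoc Q.M.l_neg)
  show ?case
  proof (intro bexI[of _ u'] conjI ballI)
    show u'_closed: "u' \<in> carrier M" using u au low(1)[OF a] by (simp add: u'_def)
    have "\<pi> u' = \<pi> u \<ominus>\<^bsub>chain_module n\<^esub> \<pi> (a \<star> u) \<oplus>\<^bsub>chain_module n\<^esub> \<pi> (h (act a s))"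
      unfolding u'_def using u au low(1)[OF a]
        mod_hom_minus[OF \<pi> M.abelian_group_axioms Q.abelian_group_axioms u(1) au]
      by (simp add: mod_hom_add[OF \<pi>])
    also have "\<dots> = chain_basis n s"
      unfolding \<pi>_translate[OF s a(1) u(1,2)] low(2)[OF a] u(2)
      by (rule cancel_Q[OF chain_basis_closed chain_basis_closed])
    finally show "\<pi> u' = chain_basis n s" .
    show "?y \<star> u' = u'" unfolding expand[OF y] ya u(3) by (simp add: u'_def)
    fix c assume "c \<in> insert b F"
    then consider "c = b" | "c \<in> F" by auto
    then show "c \<star> u' = h (act c s)"
    proof cases
      case 1
      have ba: "b \<cdot> a = b \<cdot> ?y"
        using LRB.left_regular[OF b(1) y] y b by (simp add: a_def B.m_assoc)
      have bu: "(b \<cdot> ?y) \<star> u = b \<star> u"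
        using translate_translate[OF b(1) y u(1)] u(3) by simp
      have "act (b \<cdot> ?y) s = act b s" using act_mult[OF flagsD(1)[OF s] b(1) y] ys by simp
      then show ?thesis
        unfolding 1 expand[OF b(1)] ba bu
        using translate_closed[OF u(1), of b] low(1)[OF b] by (simp add: a_minus_def M.M.r_neg)
    next
      case 2
      note c = F[OF 2]
      have cac: "c \<cdot> a \<cdot> c = c \<cdot> a" using LRB.left_regular[OF c(1) a(1)] .
      have "(c \<cdot> a) \<star> u = (c \<cdot> a) \<star> c \<star> u"
        using translate_translate[of "c \<cdot> a" c u] cac c a u by simp
      also have "\<dots> = h (act (c \<cdot> a) s)" unfolding u(4)[OF 2]
        using low(3)[OF c, of "c \<cdot> a"] cac c a by simp
      finally have cau: "(c \<cdot> a) \<star> u = h (act (c \<cdot> a) s)" .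
      have "h (act (c \<cdot> a) s) \<in> carrier M" unfolding cau[symmetric] by (rule translate_closed[OF u(1)])
      then show ?thesis
        unfolding expand[OF c(1)] cau u(4)[OF 2] by (rule cancel[OF low(1)[OF c]])
    qed
  qed
qed

end

lemma partial_section_Suc:
  assumes h: "partial_section N h"
  shows "\<exists>h'. partial_section (Suc N) h'"
proof -
  define lower where "lower s = {b \<in> carrier B. top_vertex s \<cdot> b \<noteq> top_vertex s}" for s
  define U where "U s = (SOME u. u \<in> carrier M \<and> \<pi> u = chain_basis n s \<and> top_vertex s \<star> u = u \<and>
    (\<forall>b\<in>lower s. b \<star> u = h (act b s)))" for s
  have U: "U s \<in> carrier M \<and> \<pi> (U s) = chain_basis n s \<and> top_vertex s \<star> U s = U s \<and>
      (\<forall>b\<in>lower s. b \<star> U s = h (act b s))"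
    if "s \<in> flags n" "card (supp B (top_vertex s)) = N" for s
  proof -
    have "finite (lower s)" using finite_B by (simp add: lower_def)
    from equivariant_lift[OF h that this] have "\<exists>u. u \<in> carrier M \<and> \<pi> u = chain_basis n s \<and> top_vertex s \<star> u = u \<and>
      (\<forall>b\<in>lower s. b \<star> u = h (act b s))" by (auto simp: lower_def)
    then show ?thesis unfolding U_def by (rule someI_ex)
  qed
  define h' where "h' s = (if s \<in> flags n \<and> card (supp B (top_vertex s)) = N
    then top_vertex s \<star> U (act (support_rep (top_vertex s)) s) else h s)" for s
  have "h' s \<in> carrier M \<and> \<pi> (h' s) = chain_basis n s \<and> (\<forall>b\<in>carrier B. b \<star> h' s = h' (act b s))"
    if s: "s \<in> flags n" and N: "card (supp B (top_vertex s)) < Suc N" for s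
  proof (cases "card (supp B (top_vertex s)) < N")
    case True
    have "h' (act b s) = h (act b s)" if b: "b \<in> carrier B" for b
    proof (cases "act b s \<in> flags n")
      case bs: True
      have "card (supp B (top_vertex (act b s))) \<le> card (supp B (top_vertex s))"
        unfolding top_vertex_act[OF s b bs]
        by (rule card_mono[OF finite_supp supp_mult_subset[OF b top_vertex(3)[OF s]]])
      then show ?thesis using True by (simp add: h'_def)
    qed (simp add: h'_def)
    then show ?thesis using h s True by (simp add: partial_section_def h'_def)
  next
    case False
    then have N: "card (supp B (top_vertex s)) = N" using N by simp
    define z where "z = top_vertex s"
    define y where "y = support_rep z"
    define t where "t = act y s"
    have z: "z \<in> s" "\<And>w. w \<in> s \<Longrightarrow> z \<cdot> w = w" "z \<in> carrier B" using top_vertex[OF s] by (auto simp: z_def)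
    have y: "y \<in> carrier B" "z \<cdot> y = z" "y \<cdot> z = y" using support_rep[OF z(3)] by (auto simp: y_def)
    have sB: "\<And>w. w \<in> s \<Longrightarrow> w \<in> carrier B" by (rule flagsD(4)[OF s])
    have bz: "base \<cdot> z = base" by (rule flagsD(5)[OF s z(1)])
    have flag: "act b s \<in> flags n" if "b \<in> carrier B" "z \<cdot> b = z" for b
    proof -
      have "base \<cdot> b = base" using bz that z(3) base by (metis B.m_assoc)
      moreover have "inj_on (\<lambda>w. b \<cdot> w) s"
      proof (rule inj_onI)
        fix v w assume vw: "v \<in> s" "w \<in> s" "b \<cdot> v = b \<cdot> w"
        have "z \<cdot> b \<cdot> v = z \<cdot> (b \<cdot> v)" "z \<cdot> b \<cdot> w = z \<cdot> (b \<cdot> w)"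
          by (rule B.m_assoc[OF z(3) that(1) sB[OF vw(1)]] B.m_assoc[OF z(3) that(1) sB[OF vw(2)]])+
        then have "z \<cdot> b \<cdot> v = z \<cdot> b \<cdot> w" using vw(3) by simp
        then show "v = w" using that z(2) vw by simp
      qed
      ultimately show ?thesis using act_flags_iff[OF s that(1)] by simp
    qed
    have t: "t \<in> flags n" unfolding t_def by (rule flag[OF y(1,2)])
    have top_t: "top_vertex t = y"
      using top_vertex_act[OF s y(1)] t y(3) by (simp add: t_def z_def)
    have "supp B y = supp B z"
      using supp_mult_eq_iff[OF y(1) z(3)] y by simp
    then have Nt: "card (supp B (top_vertex t)) = N" using top_t N by (simp add: z_def)
    have zt: "act z t = s"
    proof -
      have "act z t = act z s" unfolding t_def using act_mult[OF flagsD(1)[OF s] z(3) y(1)] y(2) by simp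
      also have "\<dots> = (\<lambda>w. w) ` s" by (rule image_cong[OF refl]) (rule z(2))
      finally show ?thesis by simp
    qed
    note Ut = U[OF t Nt]
    have hs: "h' s = z \<star> U t" using s N by (simp add: h'_def t_def y_def z_def)
    have "b \<star> h' s = h' (act b s)" if b: "b \<in> carrier B" for b
    proof (cases "z \<cdot> b = z")
      case True
      have bs: "act b s \<in> flags n" by (rule flag[OF b True])
      have top: "top_vertex (act b s) = b \<cdot> z" unfolding z_def by (rule top_vertex_act[OF s b bs])
      have supp: "supp B (b \<cdot> z) = supp B z" using supp_mult_eq_iff[OF b z(3)] True by simp
      then have rep: "support_rep (b \<cdot> z) = y" by (simp add: y_def support_rep_def)
      have "y \<cdot> b = y" using True y z(3) b by (metis B.m_assoc)
      then have "act y (act b s) = t" using act_mult[OF flagsD(1)[OF s] y(1) b] by (simp add: t_def)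
      then have "h' (act b s) = (b \<cdot> z) \<star> U t"
        using bs N by (simp add: h'_def top rep supp) (simp add: z_def)
      then show ?thesis unfolding hs using translate_translate[OF b z(3)] Ut by simp
    next
      case False
      have low: "b \<cdot> z \<in> lower t"
      proof -
        have "y \<cdot> (b \<cdot> z) \<noteq> y"
        proof
          assume "y \<cdot> (b \<cdot> z) = y"
          then have "y \<cdot> b = y" using fixes_mult_iff[OF y(1) b z(3)] by simp
          then have "z \<cdot> b = z" using y z(3) b by (metis B.m_assoc)
          then show False using False by simp
        qed
        then show ?thesis using b z(3) by (simp add: lower_def top_t)
      qed
      have "b \<star> h' s = (b \<cdot> z) \<star> U t" unfolding hs using translate_translate[OF b z(3)] Ut by simp
      also have "\<dots> = h (act (b \<cdot> z) t)" using Ut low by simp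
      also have "act (b \<cdot> z) t = act b s" using act_mult[OF flagsD(1)[OF t] b z(3)] zt by simp
      also have "h (act b s) = h' (act b s)"
      proof (cases "act b s \<in> flags n")
        case bs: True
        have "supp B (b \<cdot> z) \<subset> supp B z"
          using supp_mult_subset[OF b z(3)] supp_mult_eq_iff[OF b z(3)] False by blast
        then have "card (supp B (b \<cdot> z)) < N" using psubset_card_mono[OF finite_supp] N z_def by blast
        moreover have "top_vertex (act b s) = b \<cdot> z" unfolding z_def by (rule top_vertex_act[OF s b bs])
        ultimately show ?thesis by (simp add: h'_def)
      qed (simp add: h'_def)
      finally show ?thesis .
    qed
    moreover have "\<pi> (h' s) = chain_basis n s"
      unfolding hs using \<pi>_translate[OF t z(3)] Ut zt by simp
    moreover have "h' s \<in> carrier M" unfolding hs using translate_closed Ut by simp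
    ultimately show ?thesis by simp
  qed
  moreover have "h' s = \<zero>\<^bsub>M\<^esub>" if "s \<notin> flags n" for s
    using h that by (simp add: partial_section_def h'_def)
  ultimately have "partial_section (Suc N) h'" by (simp add: partial_section_def)
  then show ?thesis by blast
qed

lemma chain_module_section: "\<exists>\<sigma>\<in>mod_hom A (chain_module n) M. \<forall>f\<in>carrier (chain_module n). \<pi> (\<sigma> f) = f"
proof -
  have "\<exists>h. partial_section N h" for N
  proof (induction N)
    case 0
    show ?case by (rule exI[of _ "\<lambda>_. \<zero>\<^bsub>M\<^esub>"]) (simp add: partial_section_def)
  next
    case (Suc N) then show ?case using partial_section_Suc by blast
  qed
  then obtain h where h: "partial_section (Suc (card (carrier B))) h" by blast
  have "supp B z \<subseteq> carrier B" if "z \<in> carrier B" for z using that by (auto simp: supp_def)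
  then have "card (supp B (top_vertex s)) < Suc (card (carrier B))" if "s \<in> flags n" for s
    using card_mono[OF finite_B] top_vertex(3)[OF that] by (simp add: less_Suc_eq_le)
  then have hs: "h s \<in> carrier M" "\<pi> (h s) = chain_basis n s" "\<And>b. b \<in> carrier B \<Longrightarrow> b \<star> h s = h (act b s)"
    if "s \<in> flags n" for s using h that by (auto simp: partial_section_def)
  have h0: "h s = \<zero>\<^bsub>M\<^esub>" if "s \<notin> flags n" for s using h that by (simp add: partial_section_def)
  let ?\<sigma> = "chain_lin M n h"
  have \<sigma>: "?\<sigma> \<in> mod_hom A (chain_module n) M"
    by (rule chain_lin_hom[OF M hs(1)]) (auto simp: hs(3) h0)
  have "\<pi> (?\<sigma> f) = f" if "f \<in> carrier (chain_module n)" for f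
    by (rule scalar_linear_eqI[OF chain_module_left_module
          scalar_linear_compose[OF scalar_linear_hom[OF \<sigma>] scalar_linear_hom[OF \<pi>]] scalar_linear_id _ that])
      (simp add: chain_lin_basis[OF M hs(1)] hs(2))
  with \<sigma> show ?thesis by blast
qed

end

lemma chain_module_projective: "projective A (chain_module n)"
  by (rule projectiveI[OF chain_module_left_module]) (rule chain_module_section)

section \<open>Homomorphisms into a simple module\<close>

lemma support_module_zero_hom:
  assumes y: "y \<in> carrier B" "base \<cdot> y \<noteq> base"
    and \<phi>: "\<phi> \<in> mod_hom A (chain_module n) (support_module k B (supp B y))" and f: "f \<in> carrier (chain_module n)"
  shows "\<phi> f = \<zero>\<^bsub>k\<^esub>"
proof -
  let ?N = "support_module k B (supp B y)"
  interpret N: left_module A ?N by (rule support_module_el(1)[OF y(1)])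
  have "\<phi> (chain_basis n s) = \<zero>\<^bsub>?N\<^esub>" if s: "s \<in> flags n" for s
  proof -
    have "act y s \<notin> flags n" using act_flags_iff[OF s y(1)] y(2) by simp
    then have "el \<one>\<^bsub>k\<^esub> y \<odot>\<^bsub>chain_module n\<^esub> chain_basis n s = \<zero>\<^bsub>chain_module n\<^esub>"
      using el_chain_basis[OF y(1) s] by (simp add: chain_basis_eq_zero)
    then have "el \<one>\<^bsub>k\<^esub> y \<odot>\<^bsub>?N\<^esub> \<phi> (chain_basis n s) = \<phi> \<zero>\<^bsub>chain_module n\<^esub>"
      using mod_hom_smult[OF \<phi> el_closed[OF k.one_closed] chain_basis_closed, of y s] by simp
    also have "\<dots> = \<zero>\<^bsub>?N\<^esub>" by (rule mod_hom_zero[OF \<phi> chain_module_group N.abelian_group_axioms])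
    finally show ?thesis
      using mod_hom_closed[OF \<phi> chain_basis_closed] y(1) LRB.idem[of y]
      by (simp add: support_module_el(2)[OF y(1)] support_mod_simps)
  qed
  then have "\<phi> f = \<zero>\<^bsub>?N\<^esub>"
    unfolding scalar_linear_expand[OF N.left_module_axioms scalar_linear_hom[OF \<phi>] f]
    using N.smult_zero[OF el_closed] chain_module_mem[OF f] by (intro N.M.add.finprod_one_eqI) simp
  then show ?thesis by (simp add: support_mod_simps)
qed

context
  fixes y :: 'b
  assumes y: "y \<in> carrier B" and base_y: "base \<cdot> y = base"
begin

abbreviation K where "K \<equiv> Delta B (supp B base) y"
abbreviation N where "N \<equiv> support_module k B (supp B y)"

interpretation N: left_module A N by (rule support_module_el(1)[OF y])

lemma K_iff: "t \<in> K \<longleftrightarrow> finite t \<and> t \<subseteq> {z \<in> carrier B. base \<cdot> z = base \<and> y \<cdot> z = z \<and> z \<noteq> y} \<and>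
    (\<forall>v\<in>t. \<forall>w\<in>t. R_le B v w \<or> R_le B w v)"
  unfolding Delta_def order_complex_def interval_def using base supp_subset_iff[of base]
  by (auto simp: R_le_iff)

lemma KD:
  assumes "t \<in> K"
  shows "finite t" "y \<notin> t" "v \<in> t \<Longrightarrow> v \<in> carrier B" "v \<in> t \<Longrightarrow> y \<cdot> v = v" "t - {v} \<in> K"
  using assms by (auto simp: K_iff)

lemma insert_flag:
  assumes "t \<in> K" "card t = n"
  shows "insert y t \<in> flags n"
proof -
  have "R_le B v w \<or> R_le B w v" if "v \<in> insert y t" "w \<in> insert y t" for v w
  proof (cases "v = y \<or> w = y")
    case True
    then show ?thesis using that KD(4)[OF assms(1)] LRB.idem[OF y] by (auto simp: R_le_iff)
  next
    case False
    then show ?thesis using that assms(1) by (simp add: K_iff)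
  qed
  then show ?thesis using assms KD[OF assms(1)] y base_y by (auto simp: flags_def K_iff)
qed

lemma act_insert: "t \<in> K \<Longrightarrow> act y t = t"
  using image_cong[of t t "\<lambda>z. y \<cdot> z" "\<lambda>z. z"] KD(4) by simp

lemma act_flag_face:
  assumes "s \<in> flags n" "y \<in> act y s" "act y s \<in> flags n"
  shows "act y s - {y} \<in> K" "card (act y s - {y}) = n"
proof -
  note f = flagsD[OF assms(3)]
  have "y \<cdot> z = z" if z: "z \<in> act y s" for z
  proof -
    obtain w where w: "z = y \<cdot> w" "w \<in> s" using z by (rule imageE)
    show ?thesis
      unfolding w(1) using B.m_assoc[OF y y flagsD(4)[OF assms(1) w(2)]] LRB.idem[OF y] by simp
  qed
  moreover have "R_le B v w \<or> R_le B w v" if "v \<in> act y s" "w \<in> act y s" for v w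
    by (rule f(6)[OF that])
  ultimately show "act y s - {y} \<in> K"
    using f(2,4,5) unfolding K_iff by (intro conjI subsetI ballI) blast+
  show "card (act y s - {y}) = n" using f(2,3) assms(2) by simp
qed

definition extend_cochain :: "nat \<Rightarrow> ('b set \<Rightarrow> 'k) \<Rightarrow> 'b set \<Rightarrow> 'k" where
  "extend_cochain n g s = (if y \<in> act y s \<and> act y s \<in> flags n then g (act y s - {y}) else \<zero>\<^bsub>k\<^esub>)"

definition restrict_hom :: "nat \<Rightarrow> (('b set \<Rightarrow> 'k) \<Rightarrow> 'k) \<Rightarrow> 'b set \<Rightarrow> 'k" where
  "restrict_hom n \<phi> = (\<lambda>t\<in>{t \<in> K. card t = n}. \<phi> (chain_basis n (insert y t)))"

lemma hom_chain_basis: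
  assumes \<phi>: "\<phi> \<in> mod_hom A (chain_module n) N" and s: "s \<in> flags n"
  shows "\<phi> (chain_basis n s) = extend_cochain n (restrict_hom n \<phi>) s"
proof -
  let ?z = "top_vertex s"
  note z = top_vertex[OF s]
  have c: "\<phi> (chain_basis n s) \<in> carrier k"
    using mod_hom_closed[OF \<phi> chain_basis_closed] by (simp add: support_mod_simps)
  have act: "\<phi> (chain_basis n (act b s)) = (if y \<cdot> b = y then \<phi> (chain_basis n s) else \<zero>\<^bsub>k\<^esub>)"
    if b: "b \<in> carrier B" for b
    using mod_hom_smult[OF \<phi> el_closed[OF k.one_closed] chain_basis_closed, of b s] b c
    by (simp add: el_chain_basis[OF b s] support_module_el(2)[OF y])
  have "act ?z s = s" by (rule act_top_vertex[OF s])
  then have top: "\<phi> (chain_basis n s) = (if y \<cdot> ?z = y then \<phi> (chain_basis n s) else \<zero>\<^bsub>k\<^esub>)"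
    using act[OF z(3)] by simp
  have mem: "y \<in> act y s \<longleftrightarrow> y \<cdot> ?z = y"
  proof
    assume "y \<in> act y s"
    then obtain w where w: "w \<in> s" "y \<cdot> w = y" by (auto simp: image_iff)
    then have "y \<cdot> (?z \<cdot> w) = y" using z(2) by simp
    then show "y \<cdot> ?z = y" using fixes_mult_iff[OF y z(3) flagsD(4)[OF s w(1)]] by simp
  next
    assume "y \<cdot> ?z = y"
    then have "y = y \<cdot> ?z" by simp
    then show "y \<in> act y s" using z(1) by (rule image_eqI)
  qed
  have ys: "\<phi> (chain_basis n s) = \<phi> (chain_basis n (act y s))" using act[OF y] LRB.idem[OF y] by simp
  show ?thesis
  proof (cases "y \<in> act y s")
    case True
    show ?thesis
    proof (cases "act y s \<in> flags n")
      case f: True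
      then show ?thesis
        using ys act_flag_face[OF s True f] True
        by (simp add: extend_cochain_def restrict_hom_def insert_absorb)
    next
      case False
      then have "\<phi> (chain_basis n s) = \<phi> \<zero>\<^bsub>chain_module n\<^esub>" using ys by (simp add: chain_basis_eq_zero)
      also have "\<dots> = \<zero>\<^bsub>N\<^esub>" by (rule mod_hom_zero[OF \<phi> chain_module_group N.abelian_group_axioms])
      finally show ?thesis using False by (simp add: extend_cochain_def support_mod_simps)
    qed
  next
    case False
    then show ?thesis using top mem by (simp add: extend_cochain_def)
  qed
qed

abbreviation \<iota> where "\<iota> \<equiv> monoid_scalar k B"

lemma cochains_simps:
  "carrier (simplicial_cochains k K n) = {t \<in> K. card t = n} \<rightarrow>\<^sub>E carrier k"
  "\<zero>\<^bsub>simplicial_cochains k K n\<^esub> = (\<lambda>t\<in>{t \<in> K. card t = n}. \<zero>\<^bsub>k\<^esub>)"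
  "f \<oplus>\<^bsub>simplicial_cochains k K n\<^esub> g = (\<lambda>t\<in>{t \<in> K. card t = n}. f t \<oplus>\<^bsub>k\<^esub> g t)"
  "r \<odot>\<^bsub>simplicial_cochains k K n\<^esub> f = (\<lambda>t\<in>{t \<in> K. card t = n}. r \<otimes>\<^bsub>k\<^esub> f t)"
  by (simp_all add: simplicial_cochains_def Let_def)

lemma hom_simps:
  "carrier (hom_module \<iota> A (chain_module n) N) = mod_hom A (chain_module n) N"
  "\<zero>\<^bsub>hom_module \<iota> A (chain_module n) N\<^esub> = (\<lambda>f\<in>carrier (chain_module n). \<zero>\<^bsub>k\<^esub>)"
  "\<phi> \<oplus>\<^bsub>hom_module \<iota> A (chain_module n) N\<^esub> \<psi> = (\<lambda>f\<in>carrier (chain_module n). \<phi> f \<oplus>\<^bsub>k\<^esub> \<psi> f)"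
  "r \<odot>\<^bsub>hom_module \<iota> A (chain_module n) N\<^esub> \<phi> = (\<lambda>f\<in>carrier (chain_module n). el r unit \<odot>\<^bsub>N\<^esub> \<phi> f)"
  by (simp_all add: hom_module_def support_mod_simps monoid_scalar_eq)

lemma restrict_hom_mod_hom:
  "(\<lambda>\<phi>\<in>mod_hom A (chain_module n) N. restrict_hom n \<phi>)
    \<in> mod_hom k (hom_module \<iota> A (chain_module n) N) (simplicial_cochains k K n)"
proof (rule mod_homI, unfold hom_simps(1))
  interpret CR: central_ring_hom k A \<iota> by (rule central_ring_hom_scalar)
  interpret H: left_module k "hom_module \<iota> A (chain_module n) N"
    by (rule CR.hom_module_left_module[OF chain_module_left_module N.left_module_axioms])
  have closed: "\<phi> (chain_basis n s) \<in> carrier k" if "\<phi> \<in> mod_hom A (chain_module n) N" for \<phi> s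
    using mod_hom_closed[OF that chain_basis_closed] by (simp add: support_mod_simps)
  let ?F = "\<lambda>\<phi>\<in>mod_hom A (chain_module n) N. restrict_hom n \<phi>"
  show "?F \<phi> \<in> carrier (simplicial_cochains k K n)" if "\<phi> \<in> mod_hom A (chain_module n) N" for \<phi>
    using that closed by (simp add: restrict_hom_def cochains_simps)
  show "?F (\<phi> \<oplus>\<^bsub>hom_module \<iota> A (chain_module n) N\<^esub> \<psi>) = ?F \<phi> \<oplus>\<^bsub>simplicial_cochains k K n\<^esub> ?F \<psi>"
    if "\<phi> \<in> mod_hom A (chain_module n) N" "\<psi> \<in> mod_hom A (chain_module n) N" for \<phi> \<psi>
  proof -
    have "\<phi> \<oplus>\<^bsub>hom_module \<iota> A (chain_module n) N\<^esub> \<psi> \<in> mod_hom A (chain_module n) N"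
      using H.M.a_closed that unfolding hom_simps(1) by blast
    then have "?F (\<phi> \<oplus>\<^bsub>hom_module \<iota> A (chain_module n) N\<^esub> \<psi>) = restrict_hom n (\<phi> \<oplus>\<^bsub>hom_module \<iota> A (chain_module n) N\<^esub> \<psi>)"
      by simp
    also have "\<dots> = restrict_hom n \<phi> \<oplus>\<^bsub>simplicial_cochains k K n\<^esub> restrict_hom n \<psi>"
      by (auto simp: restrict_hom_def cochains_simps hom_simps chain_basis_closed)
    finally show ?thesis using that by simp
  qed
  show "?F (r \<odot>\<^bsub>hom_module \<iota> A (chain_module n) N\<^esub> \<phi>) = r \<odot>\<^bsub>simplicial_cochains k K n\<^esub> ?F \<phi>"
    if r: "r \<in> carrier k" and \<phi>: "\<phi> \<in> mod_hom A (chain_module n) N" for r \<phi>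
  proof -
    have "r \<odot>\<^bsub>hom_module \<iota> A (chain_module n) N\<^esub> \<phi> \<in> mod_hom A (chain_module n) N"
      using H.smult_closed r \<phi> unfolding hom_simps(1) by blast
    then have "?F (r \<odot>\<^bsub>hom_module \<iota> A (chain_module n) N\<^esub> \<phi>) = restrict_hom n (r \<odot>\<^bsub>hom_module \<iota> A (chain_module n) N\<^esub> \<phi>)"
      by simp
    also have "\<dots> = r \<odot>\<^bsub>simplicial_cochains k K n\<^esub> restrict_hom n \<phi>"
      using r closed[OF \<phi>] y
      by (auto simp: restrict_hom_def cochains_simps hom_simps chain_basis_closed support_module_el(2)[OF y])
    finally show ?thesis using \<phi> by simp
  qed
qed simp

lemma extend_cochain_hom:
  assumes g: "g \<in> carrier (simplicial_cochains k K n)"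
  shows "chain_lin N n (extend_cochain n g) \<in> mod_hom A (chain_module n) N"
    and "s \<in> flags n \<Longrightarrow> chain_lin N n (extend_cochain n g) (chain_basis n s) = extend_cochain n g s"
proof -
  have closed: "extend_cochain n g s \<in> carrier k" if "s \<in> flags n" for s
  proof (cases "y \<in> act y s \<and> act y s \<in> flags n")
    case True
    then have "act y s - {y} \<in> {t \<in> K. card t = n}" using act_flag_face[OF that] by blast
    with g have "g (act y s - {y}) \<in> carrier k" unfolding cochains_simps by (rule PiE_mem)
    then show ?thesis unfolding extend_cochain_def if_P[OF True] .
  next
    case False
    show ?thesis unfolding extend_cochain_def if_not_P[OF False] by (rule k.zero_closed)
  qed
  have closed': "extend_cochain n g s \<in> carrier N" if "s \<in> flags n" for s
    unfolding support_mod_simps by (rule closed[OF that])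
  show "s \<in> flags n \<Longrightarrow> chain_lin N n (extend_cochain n g) (chain_basis n s) = extend_cochain n g s"
    by (rule chain_lin_basis[OF N.left_module_axioms closed'])
  show "chain_lin N n (extend_cochain n g) \<in> mod_hom A (chain_module n) N"
  proof (rule chain_lin_hom[OF N.left_module_axioms closed'])
    fix b s assume b: "b \<in> carrier B" and s: "s \<in> flags n"
    have ybs: "act y (act b s) = act (y \<cdot> b) s" by (rule act_mult[OF flagsD(1)[OF s] y b])
    have l: "el \<one>\<^bsub>k\<^esub> b \<odot>\<^bsub>N\<^esub> extend_cochain n g s = (if y \<cdot> b = y then extend_cochain n g s else \<zero>\<^bsub>k\<^esub>)"
      using b closed[OF s] by (simp add: support_module_el(2)[OF y])
    show "el \<one>\<^bsub>k\<^esub> b \<odot>\<^bsub>N\<^esub> extend_cochain n g s =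
        (if act b s \<in> flags n then extend_cochain n g (act b s) else \<zero>\<^bsub>N\<^esub>)"
    proof (cases "y \<cdot> b = y")
      case True
      then have eq: "act y (act b s) = act y s" using ybs by simp
      show ?thesis
      proof (cases "act b s \<in> flags n")
        case f: True
        have "extend_cochain n g (act b s) = extend_cochain n g s" unfolding extend_cochain_def eq ..
        then show ?thesis unfolding l using True f by simp
      next
        case False
        have "act y s \<notin> flags n" using act_flags_factor[OF s y b] False unfolding eq by blast
        then have "extend_cochain n g s = \<zero>\<^bsub>k\<^esub>" unfolding extend_cochain_def by simp
        then show ?thesis unfolding l using False by (simp only: if_False if_cancel support_mod_simps)
      qed
    next
      case False
      have "y \<notin> act y (act b s)"
      proof
        assume "y \<in> act y (act b s)"
        then obtain v where v: "y = y \<cdot> v" "v \<in> act b s" by (rule imageE)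
        then obtain w where w: "v = b \<cdot> w" "w \<in> s" by (elim imageE)
        then show False
          using fixes_mult_iff[OF y b flagsD(4)[OF s w(2)]] False v(1)[symmetric] by simp
      qed
      then have "extend_cochain n g (act b s) = \<zero>\<^bsub>k\<^esub>" unfolding extend_cochain_def by metis
      then show ?thesis unfolding l using False by (simp only: if_False if_cancel support_mod_simps)
    qed
  qed
qed

lemma restrict_hom_bij:
  "bij_betw (\<lambda>\<phi>\<in>mod_hom A (chain_module n) N. restrict_hom n \<phi>)
     (mod_hom A (chain_module n) N) (carrier (simplicial_cochains k K n))"
proof (rule bij_betw_imageI)
  let ?F = "\<lambda>\<phi>\<in>mod_hom A (chain_module n) N. restrict_hom n \<phi>"
  show "inj_on ?F (mod_hom A (chain_module n) N)"
  proof (rule inj_onI)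
    fix \<phi> \<psi> assume \<phi>: "\<phi> \<in> mod_hom A (chain_module n) N" and \<psi>: "\<psi> \<in> mod_hom A (chain_module n) N"
      and "?F \<phi> = ?F \<psi>"
    then have eq: "restrict_hom n \<phi> = restrict_hom n \<psi>" by simp
    show "\<phi> = \<psi>"
    proof (rule mod_hom_eqI[OF \<phi> \<psi>])
      show "\<phi> f = \<psi> f" if "f \<in> carrier (chain_module n)" for f
      proof (rule scalar_linear_eqI[OF N.left_module_axioms scalar_linear_hom[OF \<phi>] scalar_linear_hom[OF \<psi>] _ that])
        fix s assume s: "s \<in> flags n"
        show "\<phi> (chain_basis n s) = \<psi> (chain_basis n s)"
          unfolding hom_chain_basis[OF \<phi> s] hom_chain_basis[OF \<psi> s] eq ..
      qed
    qed
  qed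
  show "?F ` mod_hom A (chain_module n) N = carrier (simplicial_cochains k K n)"
  proof
    show "?F ` mod_hom A (chain_module n) N \<subseteq> carrier (simplicial_cochains k K n)"
      using mod_hom_closed[OF restrict_hom_mod_hom[of n]] unfolding hom_simps(1) by blast
    show "carrier (simplicial_cochains k K n) \<subseteq> ?F ` mod_hom A (chain_module n) N"
    proof
      fix g assume g: "g \<in> carrier (simplicial_cochains k K n)"
      let ?\<phi> = "chain_lin N n (extend_cochain n g)"
      have "restrict_hom n ?\<phi> t = g t" for t
      proof (cases "t \<in> K \<and> card t = n")
        case True
        then have t: "t \<in> K" "insert y t \<in> flags n" using insert_flag by auto
        have a: "act y (insert y t) = insert y t" using act_insert[OF t(1)] LRB.idem[OF y] by simp
        have "extend_cochain n g (insert y t) = g (insert y t - {y})"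
          unfolding extend_cochain_def a using t(2) by simp
        moreover have "insert y t - {y} = t" using KD(2)[OF t(1)] by simp
        ultimately have "?\<phi> (chain_basis n (insert y t)) = g t" using extend_cochain_hom(2)[OF g t(2)] by simp
        then show ?thesis unfolding restrict_hom_def using True by simp
      next
        case False
        then have t: "t \<notin> {t \<in> K. card t = n}" by blast
        have "g t = undefined" using g t unfolding cochains_simps by (rule PiE_arb)
        moreover have "restrict_hom n ?\<phi> t = undefined"
          unfolding restrict_hom_def restrict_def using t by (rule if_not_P)
        ultimately show ?thesis by simp
      qed
      then have "restrict_hom n ?\<phi> = g" by (rule ext)
      then have "g = ?F ?\<phi>" using extend_cochain_hom(1)[OF g] by simp
      then show "g \<in> ?F ` mod_hom A (chain_module n) N" using extend_cochain_hom(1)[OF g] by (rule image_eqI)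
    qed
  qed
qed

lemma coboundary_restrict_hom:
  assumes \<phi>: "\<phi> \<in> mod_hom A (chain_module n) N"
  shows "simplicial_coboundary k K (R_le B) n (restrict_hom n \<phi>) =
    restrict_hom (Suc n) (\<lambda>f\<in>carrier (chain_module (Suc n)). \<phi> (differential n f))"
  unfolding simplicial_coboundary_def restrict_hom_def[of "Suc n"]
proof (rule restrict_ext)
  fix t assume "t \<in> {t \<in> K. card t = Suc n}"
  then have t: "t \<in> K" "card t = Suc n" by auto
  let ?s = "insert y t"
  let ?g = "\<lambda>v. face_sign ?s v \<otimes>\<^bsub>k\<^esub> \<phi> (chain_basis n (?s - {v}))"
  have s: "?s \<in> flags (Suc n)" by (rule insert_flag[OF t])
  have c: "\<phi> (chain_basis n u) \<in> carrier k" for u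
    using mod_hom_closed[OF \<phi> chain_basis_closed] by (simp add: support_mod_simps)
  have g_closed: "?g v \<in> carrier k" for v by (simp add: c face_sign_closed)
  have "\<phi> (boundary n ?s) = (\<Oplus>\<^bsub>k\<^esub>v\<in>?s. \<phi> (el (face_sign ?s v) unit \<odot>\<^bsub>chain_module n\<^esub> chain_basis n (?s - {v})))"
    unfolding boundary_def
    by (rule additive_finsum[OF abelian_group.axioms(1)[OF chain_module_group] k.abelian_monoid_axioms])
      (use mod_hom_closed[OF \<phi>] mod_hom_add[OF \<phi>] mod_hom_zero[OF \<phi> chain_module_group N.abelian_group_axioms] in
        \<open>auto simp: support_mod_simps signed_basis_closed face_sign_closed\<close>)
  also have "\<dots> = (\<Oplus>\<^bsub>k\<^esub>v\<in>?s. ?g v)"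
  proof -
    have "\<phi> (el (face_sign ?s v) unit \<odot>\<^bsub>chain_module n\<^esub> chain_basis n (?s - {v})) = ?g v" for v
      using mod_hom_smult[OF \<phi> el_closed[OF face_sign_closed] chain_basis_closed] y
      by (simp add: support_module_el(2)[OF y] face_sign_closed c)
    then show ?thesis by simp
  qed
  also have "\<dots> = ?g y \<oplus>\<^bsub>k\<^esub> (\<Oplus>\<^bsub>k\<^esub>v\<in>t. ?g v)"
    by (rule k.finsum_insert[OF KD(1)[OF t(1)] KD(2)[OF t(1)]]) (use g_closed in blast)+
  also have "?g y = \<zero>\<^bsub>k\<^esub>"
  proof -
    have t': "t \<in> flags n" using flags_faceI[OF s, of y] KD(2)[OF t(1)] by simp
    have "\<phi> (chain_basis n t) = \<zero>\<^bsub>k\<^esub>"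
      unfolding hom_chain_basis[OF \<phi> t'] using act_insert[OF t(1)] KD(2)[OF t(1)] by (simp add: extend_cochain_def)
    then show ?thesis using KD(2)[OF t(1)] by (simp add: face_sign_closed)
  qed
  also have "\<zero>\<^bsub>k\<^esub> \<oplus>\<^bsub>k\<^esub> (\<Oplus>\<^bsub>k\<^esub>v\<in>t. ?g v) = (\<Oplus>\<^bsub>k\<^esub>v\<in>t. ?g v)"
    by (rule k.l_zero, rule k.finsum_closed) (use g_closed in blast)
  also have "\<dots> = (\<Oplus>\<^bsub>k\<^esub>v\<in>t. (\<ominus>\<^bsub>k\<^esub> \<one>\<^bsub>k\<^esub>) [^]\<^bsub>k\<^esub> card {w \<in> t. R_le B w v \<and> w \<noteq> v} \<otimes>\<^bsub>k\<^esub>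
      (\<lambda>t\<in>{t \<in> K. card t = n}. \<phi> (chain_basis n (insert y t))) (t - {v}))"
  proof (intro k.finsum_cong' refl)
    fix v assume v: "v \<in> t"
    have vy: "v \<noteq> y" using v KD(2)[OF t(1)] by auto
    have "\<not> R_le B y v"
      using R_le_antisym[OF y KD(3)[OF t(1) v]] KD(4)[OF t(1) v] vy by (auto simp: R_le_iff)
    then have "{w \<in> ?s. R_le B w v \<and> w \<noteq> v} = {w \<in> t. R_le B w v \<and> w \<noteq> v}" by auto
    moreover have "?s - {v} = insert y (t - {v})" using vy by auto
    ultimately show "?g v = (\<ominus>\<^bsub>k\<^esub> \<one>\<^bsub>k\<^esub>) [^]\<^bsub>k\<^esub> card {w \<in> t. R_le B w v \<and> w \<noteq> v} \<otimes>\<^bsub>k\<^esub>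
      (\<lambda>t\<in>{t \<in> K. card t = n}. \<phi> (chain_basis n (insert y t))) (t - {v})"
      using KD(5)[OF t(1), of v] KD(1)[OF t(1)] t(2) v by (simp add: face_sign_def eps_def)
  qed (use KD(5)[OF t(1)] KD(1)[OF t(1)] t(2) c in auto)
  finally show "(\<Oplus>\<^bsub>k\<^esub>v\<in>t. (\<ominus>\<^bsub>k\<^esub> \<one>\<^bsub>k\<^esub>) [^]\<^bsub>k\<^esub> card {w \<in> t. R_le B w v \<and> w \<noteq> v} \<otimes>\<^bsub>k\<^esub> restrict_hom n \<phi> (t - {v})) =
      (\<lambda>f\<in>carrier (chain_module (Suc n)). \<phi> (differential n f)) (chain_basis (Suc n) (insert y t))"
    by (simp add: restrict_hom_def chain_basis_closed differential_basis[OF s])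
qed

lemma Ext_chain_resolution:
  "cochain_complex k (simplicial_cochains k K) (simplicial_coboundary k K (R_le B))"
  "mod_isomorphic k (Ext \<iota> A chain_module differential N n)
     (cohomology (simplicial_cochains k K) (simplicial_coboundary k K (R_le B)) n)"
proof -
  interpret CR: central_ring_hom k A \<iota> by (rule central_ring_hom_scalar)
  have C: "cochain_complex k (\<lambda>n. hom_module \<iota> A (chain_module n) N)
      (\<lambda>n f. \<lambda>x\<in>carrier (chain_module (Suc n)). f (differential n x))" (is "cochain_complex k ?C ?\<delta>")
    by (rule CR.hom_cochain_complex[OF chain_resolution[OF chain_module_projective] N.left_module_axioms])
  let ?\<Psi> = "\<lambda>n. \<lambda>\<phi>\<in>mod_hom A (chain_module n) N. restrict_hom n \<phi>"
  have zero: "?\<Psi> n \<zero>\<^bsub>?C n\<^esub> = \<zero>\<^bsub>simplicial_cochains k K n\<^esub>" for n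
  proof -
    interpret H: left_module k "?C n" by (rule cochain_complex_module[OF C])
    have "\<zero>\<^bsub>?C n\<^esub> \<in> mod_hom A (chain_module n) N" using H.M.zero_closed unfolding hom_simps(1) .
    then have "?\<Psi> n \<zero>\<^bsub>?C n\<^esub> = restrict_hom n \<zero>\<^bsub>?C n\<^esub>" by simp
    then show ?thesis by (simp add: restrict_hom_def hom_simps cochains_simps chain_basis_closed)
  qed
  have comm: "simplicial_coboundary k K (R_le B) n (?\<Psi> n \<phi>) = ?\<Psi> (Suc n) (?\<delta> n \<phi>)" if "\<phi> \<in> carrier (?C n)" for n \<phi>
  proof -
    have \<phi>: "\<phi> \<in> mod_hom A (chain_module n) N" using that unfolding hom_simps(1) .
    have "?\<delta> n \<phi> \<in> mod_hom A (chain_module (Suc n)) N"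
      using cochain_complex_closed[OF C that] unfolding hom_simps(1) .
    then show ?thesis using coboundary_restrict_hom[OF \<phi>] \<phi> by simp
  qed
  have bij: "bij_betw (?\<Psi> n) (carrier (?C n)) (carrier (simplicial_cochains k K n))" for n
    unfolding hom_simps(1) by (rule restrict_hom_bij)
  note T = cochain_complex_transport[where \<Psi> = ?\<Psi> and D = "simplicial_cochains k K" and
      \<delta>' = "simplicial_coboundary k K (R_le B)", OF C restrict_hom_mod_hom bij zero comm]
  show "cochain_complex k (simplicial_cochains k K) (simplicial_coboundary k K (R_le B))" by (rule T(1))
  show "mod_isomorphic k (Ext \<iota> A chain_module differential N n)
     (cohomology (simplicial_cochains k K) (simplicial_coboundary k K (R_le B)) n)"
    unfolding Ext_def by (rule T(2))
qed

end

context
  fixes y :: 'b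
  assumes y: "y \<in> carrier B" and base_y: "base \<cdot> y = base"
begin

abbreviation \<C> where "\<C> \<equiv> simplicial_cochains k (Delta B (supp B base) y)"
abbreviation \<delta> where "\<delta> \<equiv> simplicial_coboundary k (Delta B (supp B base) y) (R_le B)"

lemma zero_coboundary: "cochain_complex k C \<delta>' \<Longrightarrow> \<zero>\<^bsub>C n\<^esub> \<in> coboundaries C \<delta>' n"
  using subgroup.one_closed[OF submodule.axioms(1)[OF coboundaries_submodule]] by fastforce

lemma empty_simplex: "{} \<in> Delta B (supp B base) y"
  by (simp add: K_iff[OF y base_y])

lemma Delta_same_support:
  assumes "y \<cdot> base = y"
  shows "Delta B (supp B base) y = {{}}"
proof -
  have "z = y" if "z \<in> carrier B" "base \<cdot> z = base" "y \<cdot> z = z" for z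
    using that assms y base by (metis B.m_assoc)
  then have "t = {}" if "t \<in> Delta B (supp B base) y" for t
    using that unfolding K_iff[OF y base_y] by blast
  then show ?thesis using empty_simplex by blast
qed

lemma cohomology_same_support_0:
  assumes "y \<cdot> base = y"
  shows "mod_isomorphic k (cohomology \<C> \<delta> 0) (regular_module k)"
proof -
  note C = Ext_chain_resolution(1)[OF y base_y]
  note K = Delta_same_support[OF assms]
  define Z where "Z = (\<C> 0)\<lparr>carrier := {f \<in> carrier (\<C> 0). \<delta> 0 f = \<zero>\<^bsub>\<C> (Suc 0)\<^esub>}\<rparr>"
  note q = cohomology_quotient[OF C, of 0, folded Z_def]
  have S: "{t \<in> Delta B (supp B base) y. card t = 0} = {{}}" "{t \<in> Delta B (supp B base) y. card t = Suc 0} = {}"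
    by (auto simp: K)
  have "\<delta> 0 f = \<zero>\<^bsub>\<C> (Suc 0)\<^esub>" for f
    unfolding simplicial_coboundary_def cochains_simps[OF y base_y] S by (rule restrict_ext) blast
  then have Z: "carrier Z = {{}} \<rightarrow>\<^sub>E carrier k"
    by (simp add: Z_def cochains_simps[OF y base_y] S)
  have ops: "f \<oplus>\<^bsub>Z\<^esub> g = (\<lambda>t\<in>{{}}. f t \<oplus>\<^bsub>k\<^esub> g t)" "r \<odot>\<^bsub>Z\<^esub> f = (\<lambda>t\<in>{{}}. r \<otimes>\<^bsub>k\<^esub> f t)"
    "\<zero>\<^bsub>Z\<^esub> = \<zero>\<^bsub>\<C> 0\<^esub>" for f g r
    by (simp_all add: Z_def cochains_simps[OF y base_y] S)
  interpret Z: left_module k Z by (rule q(2))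
  let ?F = "\<lambda>f\<in>carrier Z. f {}"
  have F_closed: "?F f \<in> carrier (regular_module k)" if f: "f \<in> carrier Z" for f
  proof -
    have "f {} \<in> carrier k" using f unfolding Z by (rule PiE_mem) simp
    then show ?thesis using f by (simp add: regular_module_def)
  qed
  have "?F \<in> mod_hom k Z (regular_module k)"
  proof (rule mod_homI)
    fix f g assume fg: "f \<in> carrier Z" "g \<in> carrier Z"
    from Z.M.a_closed[OF this] show "?F (f \<oplus>\<^bsub>Z\<^esub> g) = ?F f \<oplus>\<^bsub>regular_module k\<^esub> ?F g"
      using fg unfolding ops by (simp add: regular_module_def)
  next
    fix r f assume rf: "r \<in> carrier k" "f \<in> carrier Z"
    from Z.smult_closed[OF this] show "?F (r \<odot>\<^bsub>Z\<^esub> f) = r \<odot>\<^bsub>regular_module k\<^esub> ?F f"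
      using rf unfolding ops by (simp add: regular_module_def)
  qed (use F_closed in auto)
  moreover have "bij_betw ?F (carrier Z) (carrier (regular_module k))"
  proof (rule bij_betw_byWitness[where f' = "\<lambda>r. \<lambda>t\<in>{{}}. r"])
    have mem: "(\<lambda>t\<in>{{}}. r) \<in> carrier Z" if "r \<in> carrier (regular_module k)" for r
      using that unfolding Z by (simp add: regular_module_def)
    show "\<forall>f\<in>carrier Z. (\<lambda>t\<in>{{}}. ?F f) = f"
    proof
      fix f assume f: "f \<in> carrier Z"
      show "(\<lambda>t\<in>{{}}. ?F f) = f"
      proof (rule PiE_ext)
        show "f \<in> {{}} \<rightarrow>\<^sub>E carrier k" using f unfolding Z .
        show "(\<lambda>t\<in>{{}}. ?F f) \<in> {{}} \<rightarrow>\<^sub>E carrier k" using F_closed[OF f] by (simp add: regular_module_def)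
      qed (use f in simp)
    qed
    show "\<forall>r\<in>carrier (regular_module k). ?F (\<lambda>t\<in>{{}}. r) = r" using mem by simp
    show "?F ` carrier Z \<subseteq> carrier (regular_module k)" using F_closed by blast
    show "(\<lambda>r. \<lambda>t\<in>{{}}. r) ` carrier (regular_module k) \<subseteq> carrier Z" using mem by blast
  qed
  ultimately have "mod_isomorphic k (quotient_module Z {\<zero>\<^bsub>Z\<^esub>}) (regular_module k)"
    by (rule quotient_zero_isomorphic[OF q(2)])
  then show ?thesis unfolding q(1) by (simp add: coboundaries_def ops(3))
qed

lemma cohomology_same_support_Suc:
  assumes "y \<cdot> base = y"
  shows "carrier (cohomology \<C> \<delta> (Suc n)) = {\<zero>\<^bsub>cohomology \<C> \<delta> (Suc n)\<^esub>}"
proof (rule cohomology_trivial[OF Ext_chain_resolution(1)[OF y base_y]])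
  fix f assume f: "f \<in> carrier (\<C> (Suc n))"
  have S: "{t \<in> Delta B (supp B base) y. card t = Suc n} = {}"
    by (auto simp: Delta_same_support[OF assms])
  have "f = \<zero>\<^bsub>\<C> (Suc n)\<^esub>"
    using f unfolding cochains_simps[OF y base_y] S by (auto simp: fun_eq_iff)
  then show "f \<in> coboundaries \<C> \<delta> (Suc n)"
    using zero_coboundary[OF Ext_chain_resolution(1)[OF y base_y], of "Suc n"] by simp
qed

lemma cohomology_less_support_0:
  assumes "y \<cdot> base \<noteq> y"
  shows "carrier (cohomology \<C> \<delta> 0) = {\<zero>\<^bsub>cohomology \<C> \<delta> 0\<^esub>}"
proof (rule cohomology_trivial[OF Ext_chain_resolution(1)[OF y base_y]])
  fix f assume f: "f \<in> carrier (\<C> 0)" and d: "\<delta> 0 f = \<zero>\<^bsub>\<C> (Suc 0)\<^esub>"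
  let ?K = "Delta B (supp B base) y" and ?v = "y \<cdot> base"
  have "base \<cdot> ?v = base" using fixes_mult_iff[OF base y base] base_y LRB.idem[OF base] by simp
  moreover have "y \<cdot> ?v = ?v" using B.m_assoc[OF y y base] LRB.idem[OF y] by simp
  ultimately have v: "{?v} \<in> ?K" using assms y base R_le_refl by (simp add: K_iff[OF y base_y])
  have S: "{t \<in> ?K. card t = 0} = {{}}"
    using empty_simplex KD(1)[OF y base_y] by (auto simp: card_eq_0_iff)
  have f': "f \<in> {{}} \<rightarrow>\<^sub>E carrier k" using f unfolding cochains_simps[OF y base_y] S .
  then have f0: "f {} \<in> carrier k" by (rule PiE_mem) simp
  have no: "{w \<in> {?v}. R_le B w ?v \<and> w \<noteq> ?v} = {}" by auto
  have "\<delta> 0 f {?v} = (\<Oplus>\<^bsub>k\<^esub>u\<in>{?v}. (\<ominus>\<^bsub>k\<^esub> \<one>\<^bsub>k\<^esub>) [^]\<^bsub>k\<^esub> card {w \<in> {?v}. R_le B w u \<and> w \<noteq> u} \<otimes>\<^bsub>k\<^esub> f ({?v} - {u}))"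
    unfolding simplicial_coboundary_def using v by (intro restrict_apply') simp
  also have "\<dots> = (\<ominus>\<^bsub>k\<^esub> \<one>\<^bsub>k\<^esub>) [^]\<^bsub>k\<^esub> card {w \<in> {?v}. R_le B w ?v \<and> w \<noteq> ?v} \<otimes>\<^bsub>k\<^esub> f ({?v} - {?v})"
    by (rule k.finsum_single) (use f0 in \<open>auto simp: no\<close>)
  also have "\<dots> = f {}" unfolding no using f0 by simp
  finally have "f {} = \<zero>\<^bsub>k\<^esub>" using v unfolding d cochains_simps[OF y base_y] by simp
  then have "f = \<zero>\<^bsub>\<C> 0\<^esub>"
    unfolding cochains_simps[OF y base_y] S
    by (intro PiE_ext[OF f']) (auto intro: k.zero_closed)
  then show "f \<in> coboundaries \<C> \<delta> 0"
    using zero_coboundary[OF Ext_chain_resolution(1)[OF y base_y], of 0] by simp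
qed

end

lemma Ext_incomparable:
  fixes n :: nat
  assumes y: "y \<in> carrier B" "base \<cdot> y \<noteq> base"
  defines "E \<equiv> Ext (monoid_scalar k B) A chain_module differential (support_module k B (supp B y)) n"
  shows "carrier E = {\<zero>\<^bsub>E\<^esub>}"
  unfolding E_def Ext_def
proof (rule cohomology_trivial)
  interpret CR: central_ring_hom k A "monoid_scalar k B" by (rule central_ring_hom_scalar)
  let ?N = "support_module k B (supp B y)"
  let ?C = "\<lambda>n. hom_module (monoid_scalar k B) A (chain_module n) ?N"
  let ?\<delta> = "\<lambda>n f. \<lambda>x\<in>carrier (chain_module (Suc n)). f (differential n x)"
  show C: "cochain_complex k ?C ?\<delta>"
    by (rule CR.hom_cochain_complex[OF chain_resolution[OF chain_module_projective] support_module_el(1)[OF y(1)]])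
  fix \<phi> assume "\<phi> \<in> carrier (?C n)"
  then have \<phi>: "\<phi> \<in> mod_hom A (chain_module n) ?N" by (simp add: hom_module_def)
  have "\<phi> = \<zero>\<^bsub>?C n\<^esub>"
    using support_module_zero_hom[OF y \<phi>] mod_hom_undefined[OF \<phi>]
    by (auto simp: hom_module_def support_mod_simps fun_eq_iff restrict_def)
  then show "\<phi> \<in> coboundaries ?C ?\<delta> n"
    using subgroup.one_closed[OF submodule.axioms(1)[OF coboundaries_submodule[OF C, of n]]] by simp
qed

end

theorem theorem2:
  fixes k :: "('k, 'y) ring_scheme" and B :: "('b, 'z) monoid_scheme"
    and X Y :: "'b set" and y :: 'b and n :: nat
    and P :: "nat \<Rightarrow> ('b \<Rightarrow> 'k, 'p) module" and d :: "nat \<Rightarrow> 'p \<Rightarrow> 'p" and \<epsilon> :: "'p \<Rightarrow> 'k"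
  assumes "left_regular_band_monoid B"
    and "cring k"
    and "X \<in> support_lattice B" and "Y \<in> support_lattice B"
    and "y \<in> carrier B" and "supp B y = Y"
    and "projective_resolution (monoid_algebra k B) (support_module k B X) P d \<epsilon>"
  shows "let E = Ext (monoid_scalar k B) (monoid_algebra k B) P d (support_module k B Y) n in
         (X \<subset> Y \<and> n \<ge> 1 \<longrightarrow>
            mod_isomorphic k E (reduced_cohomology k (Delta B X y) (R_le B) (n - 1))) \<and>
         (X = Y \<and> n = 0 \<longrightarrow> mod_isomorphic k E (regular_module k)) \<and>
         (\<not> (X \<subset> Y \<and> n \<ge> 1) \<and> \<not> (X = Y \<and> n = 0) \<longrightarrow> carrier E = {\<zero>\<^bsub>E\<^esub>})"
proof -
  obtain x where x: "x \<in> carrier B" "X = supp B x" using assms(3) by (auto simp: support_lattice_def)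
  note P = assms(7) and y = assms(5)
  have Y: "Y = supp B y" using assms(6) by simp
  interpret k: cring k by fact
  interpret B: left_regular_band_monoid B by fact
  have "ring (monoid_algebra k B)"
    using projective_resolution_module(2)[OF P, of 0] by (simp add: left_module_def)
  then interpret L: lrb_algebra k B x
    using x(1) B.finite_carrier
    by (intro lrb_algebra.intro lrb_algebra_axioms.intro finite_monoid_algebra.intro
        finite_monoid_algebra_axioms.intro k.is_cring B.left_regular_band_monoid_axioms B.monoid_axioms)
  interpret CR: central_ring_hom k "monoid_algebra k B" "monoid_scalar k B" by (rule L.central_ring_hom_scalar)
  define E where "E = Ext (monoid_scalar k B) (monoid_algebra k B) P d (support_module k B Y) n"
  define E' where "E' = Ext (monoid_scalar k B) (monoid_algebra k B) L.chain_module L.differential (support_module k B Y) n"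
  note q = cohomology_quotient[OF CR.hom_cochain_complex[OF P L.support_module_el(1)[OF y]], of n]
  note closed = quotient_module_closed[OF q(2,3), folded q(1), folded Ext_def, folded Y, folded E_def]
  have EE': "mod_isomorphic k E E'"
    unfolding E_def E'_def Y
    by (rule CR.Ext_resolution_independent[OF P[unfolded x(2)]
          L.chain_resolution[OF L.chain_module_projective]
          L.support_module_el(1)[OF x(1)] L.support_module_el(1)[OF y]])
  have le: "X \<subseteq> Y \<longleftrightarrow> x \<otimes>\<^bsub>B\<^esub> y = x" "Y \<subseteq> X \<longleftrightarrow> y \<otimes>\<^bsub>B\<^esub> x = y"
    using L.supp_subset_iff x y Y by auto
  let ?H = "cohomology (simplicial_cochains k (Delta B X y)) (simplicial_coboundary k (Delta B X y) (R_le B))"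
  have EH: "mod_isomorphic k E (?H n)" if "X \<subseteq> Y"
  proof (rule mod_isomorphic_trans[OF EE'])
    show "mod_isomorphic k E' (?H n)"
      unfolding E'_def Y x(2) using that le by (intro L.Ext_chain_resolution(2)[OF y]) simp
  qed (fact closed)+
  have trivial: "carrier E = {\<zero>\<^bsub>E\<^esub>}" if "mod_isomorphic k E M" "carrier M = {c}" for M :: "('k, 'm) module" and c
    using mod_isomorphic_trivial[OF that] closed(3) by blast
  have "mod_isomorphic k E (reduced_cohomology k (Delta B X y) (R_le B) (n - 1))" if "X \<subset> Y" "n \<ge> 1"
    using EH that by (simp add: reduced_cohomology_def)
  moreover have "mod_isomorphic k E (regular_module k)" if "X = Y" "n = 0"
  proof (rule mod_isomorphic_trans[OF EH])
    show "mod_isomorphic k (?H n) (regular_module k)"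
      unfolding that(2) x(2) using that(1) le by (intro L.cohomology_same_support_0[OF y]) auto
  qed (use that(1) closed in auto)
  moreover have "carrier E = {\<zero>\<^bsub>E\<^esub>}" if n: "\<not> (X \<subset> Y \<and> n \<ge> 1)" "\<not> (X = Y \<and> n = 0)"
  proof -
    consider "X \<subset> Y" "n = 0" | m where "X = Y" "n = Suc m" | "\<not> X \<subseteq> Y"
      using n by (cases n) auto
    then show ?thesis
    proof cases
      case 1
      then have "X \<subseteq> Y" "\<not> Y \<subseteq> X" by auto
      then have "carrier (?H 0) = {\<zero>\<^bsub>?H 0\<^esub>}"
        unfolding le unfolding x(2) by (intro L.cohomology_less_support_0[OF y])
      then show ?thesis using trivial[OF EH] 1 by auto
    next
      case 2
      then have "X \<subseteq> Y" "Y \<subseteq> X" by auto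
      then have "carrier (?H (Suc m)) = {\<zero>\<^bsub>?H (Suc m)\<^esub>}"
        unfolding le unfolding x(2) by (intro L.cohomology_same_support_Suc[OF y])
      then show ?thesis using trivial[OF EH] 2 by auto
    next
      case 3
      then have "carrier E' = {\<zero>\<^bsub>E'\<^esub>}"
        unfolding le unfolding E'_def Y by (rule L.Ext_incomparable[OF y])
      then show ?thesis by (rule trivial[OF EE'])
    qed
  qed
  ultimately show ?thesis unfolding Let_def E_def[symmetric] by blast
qed

end
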